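(* There is a $\mathbf k$-algebra homomorphism $\widehat\Delta:\mathcal A_{q,t}\to A_{q,t}$ with $\widehat\Delta(O_i)=\hat O_i$ for $1\le i\le6$, where $A_{q,t}$ is the algebra generated by the $q$-difference operators $\hat O_1,\dots,\hat O_6$.
   Context: Algebra $\mathcal A_{q,t}$. Let $\mathbf k=\mathbb C(q^{1/4},t^{1/4})$ and $[A,B]_{q^j}=\dfrac{q^{j/4}AB-q^{-j/4}BA}{q^{1/2}-q^{-1/2}}$ for $j\in\mathbb Z$ (with $[A,B]_q=[A,B]_{q^1}$). $\mathcal A_{q,t}$ is the associative unital $\mathbf k$-algebra with 15 generators $O_1,\dots,O_6$, $O_{12},O_{23},O_{34},O_{45},O_{56},O_{61}$, $O_{123},O_{234},O_{345}$. Indices are read cyclically modulo 6 with values in $\{1,\dots,6\}$, and $O_{456}:=O_{123}$, $O_{561}:=O_{234}$, $O_{612}:=O_{345}$. Put $\theta=(q+t)q^{-1/2}t^{-1/2}$. The defining relations are, for all $i$ modulo 6: (R1) $[O_i,O_{i+1}]_q=O_{i,i+1}$; $O_iO_j=O_jO_i$ if $i-j\not\equiv0,\pm1$ mod 6. (R2) $[O_{i,i+1},O_i]_q=O_{i+1}$; $[O_{i+1},O_{i,i+1}]_q=O_i$; $[O_{i,i+1},O_{i+2}]_q=O_{i,i+1,i+2}$; $[O_{i-1},O_{i,i+1}]_q=O_{i-1,i,i+1}$; $O_{i,i+1}$ commutes with $O_{i+3}$ and $O_{i+4}$. (R3) $[O_{i,i+1,i+2},O_i]_q=O_{i+1,i+2}$;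 $[O_{i+2},O_{i,i+1,i+2}]_q=O_{i,i+1}$; $O_{i,i+1,i+2}$ commutes with $O_{i+1}$. (R4) $[O_{i+1,i+2},O_{i,i+1}]_{q^2}=q^{-1/2}(q+1)O_iO_{i+2}-\theta O_{i+4}$; $[O_{i,i+1},O_{i+2,i+3}]_q=O_{i+4,i+5}$; $O_{i,i+1}$ commutes with $O_{i+3,i+4}$. (R5) $[O_{i,i+1,i+2},O_{i,i+1}]_q=O_{i+2}$; $[O_{i+1,i+2},O_{i,i+1,i+2}]_q=O_i$; $[O_{i,i+1,i+2},O_{i+2,i+3}]_{q^0}=O_{i+2}O_{i+4,i+5}-O_{i+3}O_{i,i+1}$. (R6) $[O_{123},O_{345}]_{q^2}=-\theta O_1O_5O_6+\theta q^{-1/4}O_5O_{61}+\theta q^{1/4}O_1O_{56}-\theta O_{234}+q^{-1/2}(q+1)O_3O_6$; $[O_{234},O_{123}]_{q^2}=-\theta O_2O_6O_1+\theta q^{-1/4}O_6O_{12}+\theta q^{1/4}O_2O_{61}-\theta O_{345}+q^{-1/2}(q+1)O_4O_1$; $[O_{345},O_{234}]_{q^2}=-\theta O_3O_1O_2+\theta q^{-1/4}O_1O_{23}+\theta q^{1/4}O_3O_{12}-\theta O_{123}+q^{-1/2}(q+1)O_5O_2$. (R7, $q$-Casimir) $\frac13(O_{123}O_{234}O_{345}+O_{234}O_{345}O_{123}+O_{345}O_{123}O_{234})-\frac16q^{-1/2}(q^2+2)(O_1O_4O_{345}+O_2O_5O_{123}+O_3O_6O_{234}+O_4O_1O_{345}+O_5O_2O_{123}+O_6O_3O_{234})+\frac16q^{-5/4}t^{-1/2}(2q+1)(q+t)(O_1O_6O_{61}+O_2O_1O_{12}+O_3O_2O_{23}+O_4O_3O_{34}+O_5O_4O_{45}+O_6O_5O_{56})-\frac13q^{1/2}(O_1O_3O_5+O_2O_4O_6+O_3O_5O_1+O_4O_6O_2+O_5O_1O_3+O_6O_2O_4)-\frac16q^{-3/2}t^{-1/2}(2q+1)(q+t)(O_{12}^2+O_{23}^2+O_{34}^2+O_{45}^2+O_{56}^2+O_{61}^2)+\frac16q^{-3/2}t^{-1/2}(q-1)(q+t)(O_1^2+\dots+O_6^2)+q^{-3/2}t^{-3/2}(t+1)(q+t)(q^2+t)=0$.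 Difference operators. For $\alpha\in\{12,23,13\}$ let $\hat\delta_\alpha$ be the shift $X_\alpha\mapsto q^{1/2}X_\alpha$ (other variables fixed). For $\{\alpha,\beta,\gamma\}=\{12,23,13\}$ put $$D_{\alpha,\beta;\gamma}=\sum_{a,b\in\{\pm1\}}ab\,\frac{(1-t^{1/2}X_\gamma X_\alpha^aX_\beta^b)(1-t^{1/2}X_\gamma^{-1}X_\alpha^aX_\beta^b)}{t^{1/2}X_\alpha^aX_\beta^b(X_\alpha-X_\alpha^{-1})(X_\beta-X_\beta^{-1})}\,\hat\delta_\alpha^a\hat\delta_\beta^b.$$ Set $\hat O_1=D_{12,13;23}$, $\hat O_2=X_{12}+X_{12}^{-1}$, $\hat O_3=D_{12,23;13}$, $\hat O_4=X_{23}+X_{23}^{-1}$, $\hat O_5=D_{13,23;12}$, $\hat O_6=X_{13}+X_{13}^{-1}$, acting on $\mathcal H=\mathbf k[X_{12}+X_{12}^{-1},X_{23}+X_{23}^{-1},X_{13}+X_{13}^{-1}]$. $A_{q,t}$ is the associative $\mathbf k$-algebra of operators generated by $\hat O_1,\dots,\hat O_6$. *)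

theory Defs
  imports "HOL-Library.Poly_Mapping" "HOL-Library.Numeral_Type"
    "HOL-Algebra.Module" "HOL-Algebra.QuotRing" "HOL-Algebra.Generated_Rings"
    "HOL-Algebra.Algebraic_Closure_Type"
begin

section \<open>The ground field and associative algebras over it\<close>

text \<open>
  The field \<open>k = C(q^(1/4), t^(1/4))\<close> is realised as \<open>C(u)(v)\<close> with \<open>u = q^(1/4)\<close>, \<open>v = t^(1/4)\<close>.
  Throughout, \<open>q\<^sup>r\<close> is written \<open>qroot powi (4r)\<close> and \<open>t\<^sup>r\<close> is written \<open>troot powi (4r)\<close>.
\<close>

type_synonym scalar = "complex poly fract poly fract"

definition qroot :: scalar where
  "qroot = Fract [:Fract [:0, 1:] 1:] 1"

definition troot :: scalar where
  "troot = Fract [:0, 1:] 1"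

definition qpar :: scalar where
  "qpar = qroot ^ 4"

definition tpar :: scalar where
  "tpar = troot ^ 4"

definition scalar_ring :: "scalar ring" where
  "scalar_ring = ring_of_type_algebra"

text \<open>
  The locale \<^locale>\<open>algebra\<close> of HOL-Algebra requires a commutative multiplication, so unital
  associative algebras are introduced separately.
\<close>

locale assoc_algebra = module R M + ring M
  for R :: "('r, 's) ring_scheme" and M :: "('r, 'm, 'n) module_scheme" +
  assumes smult_assoc_left:
      "\<lbrakk>c \<in> carrier R; x \<in> carrier M; y \<in> carrier M\<rbrakk> \<Longrightarrow>
        (c \<odot>\<^bsub>M\<^esub> x) \<otimes>\<^bsub>M\<^esub> y = c \<odot>\<^bsub>M\<^esub> (x \<otimes>\<^bsub>M\<^esub> y)"
    and smult_assoc_right: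
      "\<lbrakk>c \<in> carrier R; x \<in> carrier M; y \<in> carrier M\<rbrakk> \<Longrightarrow>
        x \<otimes>\<^bsub>M\<^esub> (c \<odot>\<^bsub>M\<^esub> y) = c \<odot>\<^bsub>M\<^esub> (x \<otimes>\<^bsub>M\<^esub> y)"

definition algebra_hom ::
  "('r, 's) ring_scheme \<Rightarrow> ('r, 'm, 'n) module_scheme \<Rightarrow> ('r, 'p, 'o) module_scheme \<Rightarrow> ('m \<Rightarrow> 'p) set"
  where "algebra_hom R A B =
    {h \<in> ring_hom A B. \<forall>c\<in>carrier R. \<forall>x\<in>carrier A. h (c \<odot>\<^bsub>A\<^esub> x) = c \<odot>\<^bsub>B\<^esub> h x}"

section \<open>The algebra given by generators and relations\<close>

text \<open>
  Indices modulo 6 are elements of the type \<^typ>\<open>6\<close>, whose arithmetic is that of the integers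
  modulo 6; thus the index 6 is the same as 0, and \<open>O\<^sub>6\<^sub>1\<close> is \<open>Double 6\<close>.
\<close>

datatype gen = Single 6 | Double 6 | G123 | G234 | G345

datatype 'a word = Word "'a list"

instantiation word :: (type) monoid_add
begin

definition zero_word :: "'a word" where
  "0 = Word []"

fun plus_word :: "'a word \<Rightarrow> 'a word \<Rightarrow> 'a word" where
  "Word xs + Word ys = Word (xs @ ys)"

instance
proof
  fix a b c :: "'a word"
  show "a + b + c = a + (b + c)" by (cases a; cases b; cases c) simp
  show "0 + a = a" by (cases a) (simp add: zero_word_def)
  show "a + 0 = a" by (cases a) (simp add: zero_word_def)
qed

end

text \<open>
  The free algebra is the monoid algebra of the monoid of words: the product of
  \<^typ>\<open>'a \<Rightarrow>\<^sub>0 'b\<close> is convolution with respect to the addition of \<^typ>\<open>'a\<close>, here concatenation.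
\<close>

type_synonym free_alg = "gen word \<Rightarrow>\<^sub>0 scalar"

definition sc :: "scalar \<Rightarrow> free_alg" where
  "sc c = Poly_Mapping.single 0 c"

definition gv :: "gen \<Rightarrow> free_alg" where
  "gv g = Poly_Mapping.single (Word [g]) 1"

text \<open>
  \<open>S1 i\<close>, \<open>S2 i\<close>, \<open>S3 i\<close> stand for \<open>O\<^sub>i\<close>, \<open>O\<^sub>i\<^sub>,\<^sub>i\<^sub>+\<^sub>1\<close>, \<open>O\<^sub>i\<^sub>,\<^sub>i\<^sub>+\<^sub>1\<^sub>,\<^sub>i\<^sub>+\<^sub>2\<close>, where
  \<open>S3 (i + 3) = S3 i\<close>.
\<close>

definition S1 :: "6 \<Rightarrow> free_alg" where
  "S1 i = gv (Single i)"

definition S2 :: "6 \<Rightarrow> free_alg" where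
  "S2 i = gv (Double i)"

definition S3 :: "6 \<Rightarrow> free_alg" where
  "S3 i = gv (if i = 1 \<or> i = 4 then G123 else if i = 2 \<or> i = 5 then G234 else G345)"

text \<open>\<open>qbr j A B\<close> is the bracket \<open>[A, B]\<close> with subscript \<open>q\<^sup>j\<close>.\<close>

definition qbr :: "int \<Rightarrow> free_alg \<Rightarrow> free_alg \<Rightarrow> free_alg" where
  "qbr j A B = sc (1 / (qroot powi 2 - qroot powi (-2))) *
     (sc (qroot powi j) * A * B - sc (qroot powi (-j)) * B * A)"

definition theta :: scalar where
  "theta = (qpar + tpar) * qroot powi (-2) * troot powi (-2)"

definition casimir :: free_alg where
  "casimir =
     sc (1/3) * (S3 1 * S3 2 * S3 3 + S3 2 * S3 3 * S3 1 + S3 3 * S3 1 * S3 2)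
   - sc (1/6 * qroot powi (-2) * (qpar^2 + 2)) *
       (S1 1 * S1 4 * S3 3 + S1 2 * S1 5 * S3 1 + S1 3 * S1 6 * S3 2
      + S1 4 * S1 1 * S3 3 + S1 5 * S1 2 * S3 1 + S1 6 * S1 3 * S3 2)
   + sc (1/6 * qroot powi (-5) * troot powi (-2) * (2 * qpar + 1) * (qpar + tpar)) *
       (S1 1 * S1 6 * S2 6 + S1 2 * S1 1 * S2 1 + S1 3 * S1 2 * S2 2
      + S1 4 * S1 3 * S2 3 + S1 5 * S1 4 * S2 4 + S1 6 * S1 5 * S2 5)
   - sc (1/3 * qroot powi 2) *
       (S1 1 * S1 3 * S1 5 + S1 2 * S1 4 * S1 6 + S1 3 * S1 5 * S1 1
      + S1 4 * S1 6 * S1 2 + S1 5 * S1 1 * S1 3 + S1 6 * S1 2 * S1 4)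
   - sc (1/6 * qroot powi (-6) * troot powi (-2) * (2 * qpar + 1) * (qpar + tpar)) *
       ((S2 1)^2 + (S2 2)^2 + (S2 3)^2 + (S2 4)^2 + (S2 5)^2 + (S2 6)^2)
   + sc (1/6 * qroot powi (-6) * troot powi (-2) * (qpar - 1) * (qpar + tpar)) *
       ((S1 1)^2 + (S1 2)^2 + (S1 3)^2 + (S1 4)^2 + (S1 5)^2 + (S1 6)^2)
   + sc (qroot powi (-6) * troot powi (-6) * (tpar + 1) * (qpar + tpar) * (qpar^2 + tpar))"

text \<open>\<open>(a, b) \<in> defining_relations\<close> stands for the relation \<open>a = b\<close>.\<close>

inductive_set defining_relations :: "(free_alg \<times> free_alg) set" where
  R1a: "(qbr 1 (S1 i) (S1 (i+1)), S2 i) \<in> defining_relations"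
| R1b: "i - j \<notin> {0, 1, -1} \<Longrightarrow> (S1 i * S1 j, S1 j * S1 i) \<in> defining_relations"
| R2a: "(qbr 1 (S2 i) (S1 i), S1 (i+1)) \<in> defining_relations"
| R2b: "(qbr 1 (S1 (i+1)) (S2 i), S1 i) \<in> defining_relations"
| R2c: "(qbr 1 (S2 i) (S1 (i+2)), S3 i) \<in> defining_relations"
| R2d: "(qbr 1 (S1 (i-1)) (S2 i), S3 (i-1)) \<in> defining_relations"
| R2e: "(S2 i * S1 (i+3), S1 (i+3) * S2 i) \<in> defining_relations"
| R2f: "(S2 i * S1 (i+4), S1 (i+4) * S2 i) \<in> defining_relations"
| R3a: "(qbr 1 (S3 i) (S1 i), S2 (i+1)) \<in> defining_relations"
| R3b: "(qbr 1 (S1 (i+2)) (S3 i), S2 i) \<in> defining_relations"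
| R3c: "(S3 i * S1 (i+1), S1 (i+1) * S3 i) \<in> defining_relations"
| R4a: "(qbr 2 (S2 (i+1)) (S2 i),
         sc (qroot powi (-2) * (qpar + 1)) * S1 i * S1 (i+2) - sc theta * S1 (i+4))
        \<in> defining_relations"
| R4b: "(qbr 1 (S2 i) (S2 (i+2)), S2 (i+4)) \<in> defining_relations"
| R4c: "(S2 i * S2 (i+3), S2 (i+3) * S2 i) \<in> defining_relations"
| R5a: "(qbr 1 (S3 i) (S2 i), S1 (i+2)) \<in> defining_relations"
| R5b: "(qbr 1 (S2 (i+1)) (S3 i), S1 i) \<in> defining_relations"
| R5c: "(qbr 0 (S3 i) (S2 (i+2)), S1 (i+2) * S2 (i+4) - S1 (i+3) * S2 i) \<in> defining_relations"
| R6a: "(qbr 2 (S3 1) (S3 3),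
         - sc theta * S1 1 * S1 5 * S1 6 + sc (theta * qroot powi (-1)) * S1 5 * S2 6
         + sc (theta * qroot powi 1) * S1 1 * S2 5 - sc theta * S3 2
         + sc (qroot powi (-2) * (qpar + 1)) * S1 3 * S1 6) \<in> defining_relations"
| R6b: "(qbr 2 (S3 2) (S3 1),
         - sc theta * S1 2 * S1 6 * S1 1 + sc (theta * qroot powi (-1)) * S1 6 * S2 1
         + sc (theta * qroot powi 1) * S1 2 * S2 6 - sc theta * S3 3
         + sc (qroot powi (-2) * (qpar + 1)) * S1 4 * S1 1) \<in> defining_relations"
| R6c: "(qbr 2 (S3 3) (S3 2),
         - sc theta * S1 3 * S1 1 * S1 2 + sc (theta * qroot powi (-1)) * S1 1 * S2 2
         + sc (theta * qroot powi 1) * S1 3 * S2 1 - sc theta * S3 1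
         + sc (qroot powi (-2) * (qpar + 1)) * S1 5 * S1 2) \<in> defining_relations"
| R7: "(casimir, 0) \<in> defining_relations"

definition free_ring :: "free_alg ring" where
  "free_ring = ring_of_type_algebra"

definition relation_ideal :: "free_alg set" where
  "relation_ideal = Idl\<^bsub>free_ring\<^esub> {a - b | a b. (a, b) \<in> defining_relations}"

definition residue_class :: "free_alg \<Rightarrow> free_alg set" where
  "residue_class x = relation_ideal +>\<^bsub>free_ring\<^esub> x"

definition Aqt :: "(scalar, free_alg set) module" where
  "Aqt = ring.extend (free_ring Quot relation_ideal)
     \<lparr>module.smult = (\<lambda>c x. residue_class (sc c) \<otimes>\<^bsub>free_ring Quot relation_ideal\<^esub> x)\<rparr>"

section \<open>The algebra of \<open>q\<close>-difference operators\<close>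

datatype edge = E12 | E23 | E13

text \<open>
  The (arbitrary) linear order on the three variables is only needed for the instance making
  polynomials an integral domain.
\<close>

instantiation edge :: linorder
begin

fun edge_rank :: "edge \<Rightarrow> nat" where
  "edge_rank E12 = 0" | "edge_rank E23 = 1" | "edge_rank E13 = 2"

definition less_eq_edge :: "edge \<Rightarrow> edge \<Rightarrow> bool" where
  "a \<le> b \<longleftrightarrow> edge_rank a \<le> edge_rank b"

definition less_edge :: "edge \<Rightarrow> edge \<Rightarrow> bool" where
  "a < b \<longleftrightarrow> edge_rank a < edge_rank b"

instance
proof
  fix a b c :: edge
  show "a \<le> b \<Longrightarrow> b \<le> a \<Longrightarrow> a = b"
    by (cases a; cases b) (simp_all add: less_eq_edge_def)
qed (auto simp: less_eq_edge_def less_edge_def)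

end

type_synonym xpoly = "(edge \<Rightarrow>\<^sub>0 nat) \<Rightarrow>\<^sub>0 scalar"
type_synonym xfield = "xpoly fract"

definition cst :: "scalar \<Rightarrow> xfield" where
  "cst c = Fract (Poly_Mapping.single 0 c) 1"

definition xv :: "edge \<Rightarrow> xfield" where
  "xv \<alpha> = Fract (Poly_Mapping.single (Poly_Mapping.single \<alpha> 1) 1) 1"

text \<open>\<open>dilate \<alpha> c\<close> substitutes \<open>c X\<^sub>\<alpha>\<close> for \<open>X\<^sub>\<alpha>\<close> in a polynomial.\<close>

lift_definition dilate ::
  "'v \<Rightarrow> 'a::comm_ring_1 \<Rightarrow> (('v \<Rightarrow>\<^sub>0 nat) \<Rightarrow>\<^sub>0 'a) \<Rightarrow> (('v \<Rightarrow>\<^sub>0 nat) \<Rightarrow>\<^sub>0 'a)" is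
  "\<lambda>\<alpha> c p m. c ^ Poly_Mapping.lookup m \<alpha> * p m"
  by (rule finite_subset) auto

lemma dilate_add: "dilate \<alpha> c (p + r) = dilate \<alpha> c p + dilate \<alpha> c r"
  by transfer (simp add: fun_eq_iff algebra_simps)

lemma dilate_single:
  "dilate \<alpha> c (Poly_Mapping.single m a) = Poly_Mapping.single m (c ^ Poly_Mapping.lookup m \<alpha> * a)"
  by transfer (auto simp: fun_eq_iff when_def)

lemma poly_mapping_induct_single [case_names zero add_single]:
  fixes p :: "'a \<Rightarrow>\<^sub>0 'b::comm_monoid_add"
  assumes "P 0" and "\<And>p m a. P p \<Longrightarrow> P (p + Poly_Mapping.single m a)"
  shows "P p"
proof (induction p rule: update_induct)
  case (update f a b)
  have "Poly_Mapping.update a b f = f + Poly_Mapping.single a b"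
    using update(1) by (intro poly_mapping_eqI)
      (auto simp: lookup_update lookup_add lookup_single when_def in_keys_iff)
  then show ?case using assms(2) update by simp
qed (rule assms)

lemma dilate_0 [simp]: "dilate \<alpha> c 0 = 0"
  by transfer simp

lemma dilate_mult: "dilate \<alpha> c (p * r) = dilate \<alpha> c p * dilate \<alpha> c r"
proof (induction p rule: poly_mapping_induct_single)
  case (add_single p m a)
  have "dilate \<alpha> c (Poly_Mapping.single m a * r) = dilate \<alpha> c (Poly_Mapping.single m a) * dilate \<alpha> c r"
  proof (induction r rule: poly_mapping_induct_single)
    case (add_single r n b)
    then show ?case
      by (simp add: dilate_add dilate_single mult_single lookup_add power_add algebra_simps)
  qed simp
  with add_single show ?case by (simp add: dilate_add algebra_simps)
qed simp

lemma dilate_eq_0_iff: "(c :: 'a::idom) \<noteq> 0 \<Longrightarrow> dilate \<alpha> c p = 0 \<longleftrightarrow> p = 0"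
  by transfer (simp add: fun_eq_iff)

lemma Fract_1_eq_iff: "Fract a 1 = Fract b 1 \<longleftrightarrow> a = b" "Fract a 1 = 0 \<longleftrightarrow> a = 0" "Fract a 1 = 1 \<longleftrightarrow> a = 1"
  by (simp_all add: Zero_fract_def One_fract_def eq_fract)

lemma qroot_nonzero [simp]: "qroot \<noteq> 0"
  by (simp add: qroot_def Fract_1_eq_iff)

lemma troot_nonzero [simp]: "troot \<noteq> 0"
  by (simp add: troot_def Fract_1_eq_iff)

text \<open>
  \<open>shift \<alpha> a\<close> is the \<open>a\<close>-th power of the shift operator of \<open>X\<^sub>\<alpha>\<close>: it substitutes
  \<open>q\<^sup>a\<^sup>/\<^sup>2 X\<^sub>\<alpha>\<close> for \<open>X\<^sub>\<alpha>\<close>.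
\<close>

definition shift :: "edge \<Rightarrow> int \<Rightarrow> xfield \<Rightarrow> xfield" where
  "shift \<alpha> a f =
     (let (p, r) = SOME (p, r). r \<noteq> 0 \<and> f = Fract p r
      in Fract (dilate \<alpha> (qroot powi (2 * a)) p) (dilate \<alpha> (qroot powi (2 * a)) r))"

lemma shift_Fract:
  assumes "r \<noteq> 0"
  shows "shift \<alpha> a (Fract p r) =
     Fract (dilate \<alpha> (qroot powi (2 * a)) p) (dilate \<alpha> (qroot powi (2 * a)) r)"
proof -
  define P where "P = (\<lambda>(p', r'). r' \<noteq> 0 \<and> Fract p r = Fract p' r')"
  obtain p' r' where eq: "Eps P = (p', r')"
    by (cases "Eps P")
  have "P (p, r)"
    using assms by (simp add: P_def)
  then have "P (p', r')"
    unfolding eq[symmetric] by (rule someI)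
  then have r': "r' \<noteq> 0" and "Fract p r = Fract p' r'"
    by (simp_all add: P_def)
  then have "p * r' = p' * r"
    using assms by (simp add: eq_fract)
  then have "dilate \<alpha> c p * dilate \<alpha> c r' = dilate \<alpha> c p' * dilate \<alpha> c r" for c
    by (simp flip: dilate_mult)
  then show ?thesis
    using assms r' by (simp add: shift_def eq flip: P_def) (simp add: eq_fract dilate_eq_0_iff)
qed

definition D :: "edge \<Rightarrow> edge \<Rightarrow> edge \<Rightarrow> xfield \<Rightarrow> xfield" where
  "D \<alpha> \<beta> \<gamma> f = (\<Sum>a\<in>{1, -1}. \<Sum>b\<in>{1, -1}. of_int (a * b) *
     ((1 - cst (troot powi 2) * xv \<gamma> * xv \<alpha> powi a * xv \<beta> powi b) *
      (1 - cst (troot powi 2) * xv \<gamma> powi (-1) * xv \<alpha> powi a * xv \<beta> powi b) /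
      (cst (troot powi 2) * xv \<alpha> powi a * xv \<beta> powi b *
        (xv \<alpha> - xv \<alpha> powi (-1)) * (xv \<beta> - xv \<beta> powi (-1)))) *
     shift \<alpha> a (shift \<beta> b f))"

definition Ohat :: "6 \<Rightarrow> xfield \<Rightarrow> xfield" where
  "Ohat i =
    (if i = 1 then D E12 E13 E23
     else if i = 2 then (\<lambda>f. (xv E12 + xv E12 powi (-1)) * f)
     else if i = 3 then D E12 E23 E13
     else if i = 4 then (\<lambda>f. (xv E23 + xv E23 powi (-1)) * f)
     else if i = 5 then D E13 E23 E12
     else (\<lambda>f. (xv E13 + xv E13 powi (-1)) * f))"

definition xfield_ring :: "xfield ring" where
  "xfield_ring = ring_of_type_algebra"

definition Hspace :: "xfield set" where
  "Hspace = generate_ring xfield_ring (range cst \<union> {xv \<alpha> + xv \<alpha> powi (-1) | \<alpha>. True})"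

text \<open>The algebra of \<open>k\<close>-linear endomorphisms of \<^const>\<open>Hspace\<close>, as extensional functions.\<close>

definition EndH :: "(scalar, xfield \<Rightarrow> xfield) module" where
  "EndH =
     \<lparr>carrier = {F \<in> Hspace \<rightarrow>\<^sub>E Hspace.
        (\<forall>x\<in>Hspace. \<forall>y\<in>Hspace. F (x + y) = F x + F y) \<and>
        (\<forall>c. \<forall>x\<in>Hspace. F (cst c * x) = cst c * F x)},
      monoid.mult = compose Hspace,
      one = (\<lambda>x\<in>Hspace. x),
      ring.zero = (\<lambda>x\<in>Hspace. 0),
      add = (\<lambda>F G. \<lambda>x\<in>Hspace. F x + G x),
      module.smult = (\<lambda>c F. \<lambda>x\<in>Hspace. cst c * F x)\<rparr>"

definition OhatH :: "6 \<Rightarrow> xfield \<Rightarrow> xfield" where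
  "OhatH i = restrict (Ohat i) Hspace"

definition diff_op_alg :: "(scalar, xfield \<Rightarrow> xfield) module" where
  "diff_op_alg = EndH\<lparr>carrier :=
     generate_ring EndH (range (\<lambda>c. c \<odot>\<^bsub>EndH\<^esub> \<one>\<^bsub>EndH\<^esub>) \<union> range OhatH)\<rparr>"

section \<open>Well-definedness\<close>

text \<open>
  The operators \<^const>\<open>Ohat\<close> are \<open>k\<close>-linear and preserve \<^const>\<open>Hspace\<close>, and \<^const>\<open>Aqt\<close>,
  \<^const>\<open>EndH\<close>, \<^const>\<open>diff_op_alg\<close> are unital associative algebras over the ground field.
\<close>

lemma shift_add: "shift \<alpha> a (f + g) = shift \<alpha> a f + shift \<alpha> a g"
  by (cases f; cases g) (simp add: shift_Fract dilate_eq_0_iff dilate_add dilate_mult)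

lemma shift_mult: "shift \<alpha> a (f * g) = shift \<alpha> a f * shift \<alpha> a g"
  by (cases f; cases g) (simp add: shift_Fract dilate_mult)

lemma dilate_1 [simp]: "dilate \<alpha> c 1 = 1"
  using dilate_single[of \<alpha> c 0 1] by simp

lemma shift_cst [simp]: "shift \<alpha> a (cst c) = cst c"
  by (simp add: cst_def shift_Fract dilate_single)

lemma shift_xv: "shift \<alpha> a (xv \<beta>) = (if \<alpha> = \<beta> then cst (qroot powi (2 * a)) * xv \<beta> else xv \<beta>)"
  by (simp add: xv_def cst_def shift_Fract dilate_single lookup_single mult_single)

lemma cst_hom: "cst 0 = 0" "cst 1 = 1" "cst (c + d) = cst c + cst d" "cst (c * d) = cst c * cst d"
  by (simp_all add: cst_def fract_collapse single_add mult_single)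

lemma cst_uminus: "cst (- c) = - cst c"
  by (simp add: cst_def single_uminus)

lemma shift_0_1 [simp]: "shift \<alpha> a 0 = 0" "shift \<alpha> a 1 = 1"
  using shift_cst[of \<alpha> a 0] shift_cst[of \<alpha> a 1] by (simp_all add: cst_hom)

lemma shift_uminus: "shift \<alpha> a (- f) = - shift \<alpha> a f"
  using shift_add[of \<alpha> a f "- f"] by (simp add: eq_neg_iff_add_eq_0 add.commute)

lemma shift_inverse: "shift \<alpha> a (inverse f) = inverse (shift \<alpha> a f)"
proof (cases "f = 0")
  case False
  then have "shift \<alpha> a (inverse f) * shift \<alpha> a f = 1"
    by (simp flip: shift_mult)
  then show ?thesis by (metis inverse_unique mult.commute)
qed simp

lemma xv_nonzero [simp]: "xv \<alpha> \<noteq> 0"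
  by (simp add: xv_def Fract_1_eq_iff) (metis lookup_single_eq lookup_zero zero_neq_one)

lemma xv_sq_neq_1: "xv \<alpha> * xv \<alpha> \<noteq> 1"
proof
  assume "xv \<alpha> * xv \<alpha> = 1"
  then have "Poly_Mapping.single (Poly_Mapping.single \<alpha> 1 + Poly_Mapping.single \<alpha> 1) 1
    = (Poly_Mapping.single 0 1 :: xpoly)"
    by (simp add: xv_def Fract_1_eq_iff mult_single)
  then have "Poly_Mapping.lookup (Poly_Mapping.single (Poly_Mapping.single \<alpha> 1 + Poly_Mapping.single \<alpha> 1) 1 :: xpoly)
     0 = 1" by simp
  then have "Poly_Mapping.single \<alpha> 1 + Poly_Mapping.single \<alpha> 1 = (0 :: edge \<Rightarrow>\<^sub>0 nat)"
    by (auto simp: lookup_single when_def split: if_splits)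
  then have "Poly_Mapping.lookup (Poly_Mapping.single \<alpha> 1 + Poly_Mapping.single \<alpha> 1 :: edge \<Rightarrow>\<^sub>0 nat) \<alpha> = 0"
    by simp
  then show False by (simp add: lookup_add)
qed

lemma xv_diff_nonzero: "xv \<alpha> - inverse (xv \<alpha>) \<noteq> 0"
  using xv_sq_neq_1[of \<alpha>] by (simp add: field_simps)

lemma ring_of_type_ring: "ring (ring_of_type_algebra :: 'a::ring_1 ring)"
proof -
  have "\<exists>y. x + y = 0" for x :: 'a
    using add.right_inverse by blast
  thus ?thesis
    unfolding ring_of_type_algebra_def using add.right_inverse
    by unfold_locales (auto simp:algebra_simps Units_def)
qed

interpretation xfield: ring xfield_ring
  unfolding xfield_ring_def by (rule ring_of_type_ring)

lemma xfield_ring_simps [simp]: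
  "carrier xfield_ring = UNIV" "f \<otimes>\<^bsub>xfield_ring\<^esub> g = f * g" "f \<oplus>\<^bsub>xfield_ring\<^esub> g = f + g"
  "\<one>\<^bsub>xfield_ring\<^esub> = 1" "\<zero>\<^bsub>xfield_ring\<^esub> = 0"
  by (simp_all add: xfield_ring_def ring_of_type_algebra_def)

lemma xfield_ring_uminus [simp]: "\<ominus>\<^bsub>xfield_ring\<^esub> f = - f"
  by (rule xfield.minus_equality) auto

lemma Hspace_closed:
  "1 \<in> Hspace" "cst c \<in> Hspace" "xv \<alpha> + inverse (xv \<alpha>) \<in> Hspace"
  "f \<in> Hspace \<Longrightarrow> - f \<in> Hspace"
  "f \<in> Hspace \<Longrightarrow> g \<in> Hspace \<Longrightarrow> f + g \<in> Hspace"
  "f \<in> Hspace \<Longrightarrow> g \<in> Hspace \<Longrightarrow> f * g \<in> Hspace"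
  unfolding Hspace_def xfield_ring_simps(2-4)[symmetric] xfield_ring_uminus[symmetric]
  by (rule generate_ring.intros; (assumption | force simp: power_int_minus))+

lemma Hspace_0: "0 \<in> Hspace"
  using Hspace_closed(2)[of 0] by (simp add: cst_hom)

lemma Hspace_diff: "f \<in> Hspace \<Longrightarrow> g \<in> Hspace \<Longrightarrow> f - g \<in> Hspace"
  using Hspace_closed(4,5) by (metis diff_conv_add_uminus)

lemma Hspace_induct [consumes 1, case_names one cst gen uminus add mult]:
  assumes "f \<in> Hspace" "P 1" "\<And>c. P (cst c)" "\<And>\<alpha>. P (xv \<alpha> + inverse (xv \<alpha>))"
    "\<And>f. f \<in> Hspace \<Longrightarrow> P f \<Longrightarrow> P (- f)"
    "\<And>f g. f \<in> Hspace \<Longrightarrow> g \<in> Hspace \<Longrightarrow> P f \<Longrightarrow> P g \<Longrightarrow> P (f + g)"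
    "\<And>f g. f \<in> Hspace \<Longrightarrow> g \<in> Hspace \<Longrightarrow> P f \<Longrightarrow> P g \<Longrightarrow> P (f * g)"
  shows "P f"
  using assms(1) unfolding Hspace_def
proof (induction rule: generate_ring.induct)
  case (incl h)
  then show ?case using assms(3,4) by (auto simp: power_int_minus)
next
  case (a_inv h)
  then show ?case using assms(5)[of h] by (simp add: Hspace_def)
next
  case (eng_add f g)
  then show ?case using assms(6)[of f g] by (simp add: Hspace_def)
next
  case (eng_mult f g)
  then show ?case using assms(7)[of f g] by (simp add: Hspace_def)
qed (simp add: assms(2))

text \<open>
  \<^term>\<open>D \<alpha> \<beta> \<gamma>\<close> preserves \<^const>\<open>Hspace\<close>: it is a combination of products of the one-variable
  operators \<open>Tsh\<close> below, with coefficients in \<^const>\<open>Hspace\<close>.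
\<close>

definition Tsh :: "edge \<Rightarrow> int \<Rightarrow> xfield \<Rightarrow> xfield" where
  "Tsh \<alpha> n f = (xv \<alpha> powi n * shift \<alpha> 1 f - xv \<alpha> powi (-n) * shift \<alpha> (-1) f) /
             (xv \<alpha> - inverse (xv \<alpha>))"

lemma xv_powi_step:
  "xv \<alpha> powi (n + 1) = xv \<alpha> powi n * xv \<alpha>" "xv \<alpha> powi (n - 1) = xv \<alpha> powi n * inverse (xv \<alpha>)"
  "xv \<alpha> powi (- n - 1) = xv \<alpha> powi (- n) * inverse (xv \<alpha>)"
  "xv \<alpha> powi (1 - n) = xv \<alpha> powi (- n) * xv \<alpha>"
  "xv \<alpha> powi (1 + n) = xv \<alpha> powi n * xv \<alpha>"
  "xv \<alpha> powi (- 1 - n) = xv \<alpha> powi (- n) * inverse (xv \<alpha>)"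
  using power_int_add[of "xv \<alpha>" 1 "- n"] power_int_add[of "xv \<alpha>" n 1]
    power_int_diff[of "xv \<alpha>" n 1] power_int_diff[of "xv \<alpha>" "- n" 1]
    power_int_add[of "xv \<alpha>" "-1" "- n"]
  by (simp_all add: divide_inverse mult.commute add.commute)

lemma Tsh_rec: "Tsh \<alpha> (n + 1) f + Tsh \<alpha> (n - 1) f = (xv \<alpha> + inverse (xv \<alpha>)) * Tsh \<alpha> n f"
proof -
  show ?thesis
    by (simp add: Tsh_def xv_powi_step add_divide_distrib[symmetric] algebra_simps)
qed

lemma Tsh_Hspace_from_two:
  assumes "Tsh \<alpha> 0 f \<in> Hspace" "Tsh \<alpha> 1 f \<in> Hspace"
  shows "Tsh \<alpha> n f \<in> Hspace"
proof -
  have step: "Tsh \<alpha> (n + 1) f = (xv \<alpha> + inverse (xv \<alpha>)) * Tsh \<alpha> n f + - Tsh \<alpha> (n - 1) f" for n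
    using Tsh_rec[of \<alpha> n f] by (simp add: algebra_simps)
  have step': "Tsh \<alpha> (n - 1) f = (xv \<alpha> + inverse (xv \<alpha>)) * Tsh \<alpha> n f + - Tsh \<alpha> (n + 1) f" for n
    using Tsh_rec[of \<alpha> n f] by (simp add: algebra_simps)
  have "Tsh \<alpha> n f \<in> Hspace \<and> Tsh \<alpha> (n + 1) f \<in> Hspace"
  proof (induction n rule: int_induct[where k = 0])
    case (step1 i)
    then show ?case using step[of "i + 1"] by (auto intro!: Hspace_closed Hspace_diff)
  next
    case (step2 i)
    then show ?case using step'[of i] by (auto intro!: Hspace_closed Hspace_diff)
  qed (use assms in simp)
  then show ?thesis ..
qed

lemma Tsh_add: "Tsh \<alpha> n (f + g) = Tsh \<alpha> n f + Tsh \<alpha> n g"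
  by (simp add: Tsh_def shift_add algebra_simps flip: add_divide_distrib diff_divide_distrib)

lemma Tsh_uminus: "Tsh \<alpha> n (- f) = - Tsh \<alpha> n f"
  using Tsh_add[of \<alpha> n f "- f"] by (simp add: Tsh_def shift_uminus algebra_simps)
    (metis (no_types) minus_divide_left minus_diff_eq)

lemma Tsh_mult_invariant:
  "shift \<alpha> 1 f = f \<Longrightarrow> shift \<alpha> (-1) f = f \<Longrightarrow> Tsh \<alpha> n (f * g) = f * Tsh \<alpha> n g"
  by (simp add: Tsh_def shift_mult algebra_simps)

lemma Tsh_mult_gen:
  "Tsh \<alpha> n ((xv \<alpha> + inverse (xv \<alpha>)) * g) =
     cst (qroot powi 2) * Tsh \<alpha> (n + 1) g + cst (qroot powi (-2)) * Tsh \<alpha> (n - 1) g"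
proof -
  have inv: "inverse (cst (qroot powi 2)) = cst (qroot powi (-2))"
    "inverse (cst (qroot powi (-2))) = cst (qroot powi 2)"
    by (rule inverse_unique; simp flip: cst_hom add: power_int_minus)+
  show ?thesis
    using inv by (simp add: Tsh_def xv_powi_step shift_mult shift_add shift_inverse shift_xv add_divide_distrib[symmetric] algebra_simps)
qed

lemma Tsh_Hspace:
  assumes "f \<in> Hspace"
  shows "Tsh \<alpha> n f \<in> Hspace"
proof -
  have "\<forall>g\<in>Hspace. (\<forall>n. Tsh \<alpha> n g \<in> Hspace) \<longrightarrow> (\<forall>n. Tsh \<alpha> n (f * g) \<in> Hspace)"
    using assms
  proof (induction rule: Hspace_induct)
    case (cst c)
    then show ?case by (auto simp: Tsh_mult_invariant intro!: Hspace_closed Hspace_diff)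
  next
    case (gen \<beta>)
    show ?case
    proof (cases "\<beta> = \<alpha>")
      case True
      then show ?thesis by (auto simp: Tsh_mult_gen intro!: Hspace_closed Hspace_diff)
    next
      case False
      then show ?thesis
        by (auto simp: Tsh_mult_invariant shift_add shift_inverse shift_xv intro!: Hspace_closed Hspace_diff)
    qed
  next
    case (uminus f)
    then show ?case by (auto simp: Tsh_uminus intro!: Hspace_closed Hspace_diff)
  next
    case (add f g)
    then show ?case by (auto simp: Tsh_add distrib_right intro!: Hspace_closed Hspace_diff)
  next
    case (mult f g)
    then show ?case by (auto simp: mult.assoc intro!: Hspace_closed Hspace_diff)
  qed simp
  moreover have "Tsh \<alpha> n 1 \<in> Hspace" for n
  proof (rule Tsh_Hspace_from_two)
    show "Tsh \<alpha> 0 1 \<in> Hspace" by (simp add: Tsh_def Hspace_0)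
    show "Tsh \<alpha> 1 1 \<in> Hspace" using xv_diff_nonzero[of \<alpha>]
      by (simp add: Tsh_def power_int_minus Hspace_closed Hspace_diff)
  qed
  ultimately show ?thesis using Hspace_closed(1) by force
qed

lemma shift_diff: "shift \<alpha> a (f - g) = shift \<alpha> a f - shift \<alpha> a g"
  using shift_add[of \<alpha> a f "- g"] by (simp add: shift_uminus)

lemma shift_divide: "shift \<alpha> a (f / g) = shift \<alpha> a f / shift \<alpha> a g"
  by (simp add: divide_inverse shift_mult shift_inverse)

lemma D_eq_Tsh:
  assumes "\<alpha> \<noteq> \<beta>"
  shows "D \<alpha> \<beta> \<gamma> f =
    cst (troot powi (-2)) * Tsh \<alpha> (-1) (Tsh \<beta> (-1) f)
    + - ((xv \<gamma> + inverse (xv \<gamma>)) * Tsh \<alpha> 0 (Tsh \<beta> 0 f))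
    + cst (troot powi 2) * Tsh \<alpha> 1 (Tsh \<beta> 1 f)"
proof -
  define s x y z where "s = cst (troot powi 2)" and "x = xv \<alpha>" and "y = xv \<beta>" and "z = xv \<gamma>"
  have s: "s \<noteq> 0"
  proof
    assume "s = 0"
    then have "s * cst (troot powi (-2)) = 0" by simp
    then show False by (simp add: s_def cst_hom power_int_minus flip: cst_hom(4))
  qed
  have si: "cst (troot powi (-2)) = inverse s"
    unfolding s_def by (rule inverse_unique[symmetric]) (simp flip: cst_hom add: power_int_minus)
  have nz: "x \<noteq> 0" "y \<noteq> 0" "z \<noteq> 0" "x - inverse x \<noteq> 0" "y - inverse y \<noteq> 0"
    using xv_diff_nonzero by (auto simp: x_def y_def z_def)
  have sh: "shift \<alpha> a y = y" for a
    using assms by (simp add: y_def shift_xv)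
  have coef: "(1 - s * z * x' * y') * (1 - s * inverse z * x' * y') / (s * x' * y' * A * B)
     = (inverse s * inverse x' * inverse y' - (z + inverse z) + s * x' * y') / (A * B)"
    if "x' \<noteq> 0" "y' \<noteq> 0" "A \<noteq> 0" "B \<noteq> 0" for x' y' A B
    using that s nz by (simp add: field_simps)
  have 1: "Tsh \<beta> n f = (y powi n * shift \<beta> 1 f - y powi (-n) * shift \<beta> (-1) f) / (y - inverse y)" for n
    by (simp add: Tsh_def y_def)
  have powsh: "shift \<alpha> a (y powi n) = y powi n" if "n \<in> {-1, 0, 1}" for a n
    using that sh by (auto simp: power_int_minus shift_inverse)
  have 2: "Tsh \<alpha> n (Tsh \<beta> n f) =
     (x powi n * (y powi n * shift \<alpha> 1 (shift \<beta> 1 f) - y powi (-n) * shift \<alpha> 1 (shift \<beta> (-1) f))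
      - x powi (-n) * (y powi n * shift \<alpha> (-1) (shift \<beta> 1 f) - y powi (-n) * shift \<alpha> (-1) (shift \<beta> (-1) f)))
      / ((x - inverse x) * (y - inverse y))" if "n \<in> {-1, 0, 1}" for n
  proof -
    have neg: "- n \<in> {-1, 0, 1}" using that by auto
    have 3: "shift \<alpha> a (Tsh \<beta> n f) = (y powi n * shift \<alpha> a (shift \<beta> 1 f) -
        y powi (-n) * shift \<alpha> a (shift \<beta> (-1) f)) / (y - inverse y)" for a
      unfolding 1 by (simp only: shift_divide shift_diff shift_mult shift_inverse sh
          powsh[OF that] powsh[OF neg])
    have comb: "(A * (N / d) - A' * (N' / d)) / c = (A * N - A' * N') / (c * d)"
      for A A' N N' c d :: xfield
      by (simp add: diff_divide_distrib mult.commute)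
    show ?thesis
      unfolding Tsh_def[of \<alpha>] 3 comb x_def ..
  qed
  show ?thesis
    unfolding D_def s_def[symmetric] x_def[symmetric] y_def[symmetric] z_def[symmetric] si
    using nz s by (simp add: 2 power_int_minus coef) (simp add: divide_inverse algebra_simps)
qed

lemma Ohat_Hspace: "f \<in> Hspace \<Longrightarrow> Ohat i f \<in> Hspace"
  by (auto simp: Ohat_def D_eq_Tsh power_int_minus intro!: Hspace_closed Hspace_diff Tsh_Hspace)

lemma D_linear:
  "D \<alpha> \<beta> \<gamma> (f + g) = D \<alpha> \<beta> \<gamma> f + D \<alpha> \<beta> \<gamma> g" "D \<alpha> \<beta> \<gamma> (cst c * f) = cst c * D \<alpha> \<beta> \<gamma> f"
  unfolding D_def shift_add shift_mult shift_cst distrib_left sum.distrib sum_distrib_left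
  by (simp_all only: mult.left_commute)

lemma OhatH_in_EndH: "OhatH i \<in> carrier EndH"
proof -
  have "Ohat i (f + g) = Ohat i f + Ohat i g" "Ohat i (cst c * f) = cst c * Ohat i f" for f g c
    by (simp_all add: Ohat_def D_linear distrib_left mult.left_commute)
  then show ?thesis
    by (auto simp: EndH_def OhatH_def Ohat_Hspace Hspace_closed)
qed

lemma scalar_cring: "cring scalar_ring"
  unfolding scalar_ring_def by (rule cring_from_type_algebra)

lemma scalar_ring_simps [simp]:
  "carrier scalar_ring = UNIV" "c \<otimes>\<^bsub>scalar_ring\<^esub> d = c * d" "c \<oplus>\<^bsub>scalar_ring\<^esub> d = c + d"
  "\<one>\<^bsub>scalar_ring\<^esub> = 1" "\<zero>\<^bsub>scalar_ring\<^esub> = 0"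
  by (simp_all add: scalar_ring_def ring_of_type_algebra_def)

lemma EndH_ring: "ring EndH"
proof (rule ringI)
  show "abelian_group EndH"
  proof (rule abelian_groupI)
    fix F assume F: "F \<in> carrier EndH"
    then have "(\<lambda>x\<in>Hspace. - F x) \<in> carrier EndH"
      by (auto simp: EndH_def dest: PiE_mem intro!: Hspace_closed)
    then show "\<exists>G\<in>carrier EndH. G \<oplus>\<^bsub>EndH\<^esub> F = \<zero>\<^bsub>EndH\<^esub>"
      by (rule rev_bexI) (auto simp: EndH_def fun_eq_iff restrict_def)
  qed (auto simp: EndH_def Hspace_closed Hspace_0 fun_eq_iff restrict_def distrib_left
      add.assoc add.commute add.left_commute PiE_def extensional_def Pi_def)
  show "Group.monoid EndH"
    by (rule monoidI) (auto simp: EndH_def Hspace_closed compose_def fun_eq_iff restrict_def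
        PiE_def extensional_def Pi_def)
qed (auto simp: EndH_def Hspace_closed compose_def fun_eq_iff restrict_def PiE_def Pi_def)

lemma EndH_algebra: "assoc_algebra scalar_ring EndH"
proof (rule assoc_algebra.intro)
  show "module scalar_ring EndH"
    by (rule moduleI[OF scalar_cring ring.is_abelian_group[OF EndH_ring]])
      (auto simp: EndH_def Hspace_closed cst_hom fun_eq_iff restrict_def distrib_left distrib_right
        mult.assoc mult.left_commute PiE_def extensional_def Pi_def)
  show "assoc_algebra_axioms scalar_ring EndH"
    by unfold_locales (auto simp: EndH_def Hspace_closed compose_def fun_eq_iff restrict_def PiE_def Pi_def)
qed (rule EndH_ring)

lemma diff_op_gens_in_EndH:
  "range (\<lambda>c. c \<odot>\<^bsub>EndH\<^esub> \<one>\<^bsub>EndH\<^esub>) \<union> range OhatH \<subseteq> carrier EndH"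
proof -
  interpret E: assoc_algebra scalar_ring EndH
    by (rule EndH_algebra)
  show ?thesis
    using OhatH_in_EndH E.smult_closed[OF _ E.one_closed] by auto
qed

lemma diff_op_alg_algebra: "assoc_algebra scalar_ring diff_op_alg"
proof -
  interpret E: assoc_algebra scalar_ring EndH
    by (rule EndH_algebra)
  let ?G = "generate_ring EndH (range (\<lambda>c. c \<odot>\<^bsub>EndH\<^esub> \<one>\<^bsub>EndH\<^esub>) \<union> range OhatH)"
  have sub: "subring ?G EndH"
    by (rule E.generate_ring_is_subring[OF diff_op_gens_in_EndH])
  have in_E: "x \<in> carrier EndH" if "x \<in> ?G" for x
    using E.generate_ring_in_carrier[OF diff_op_gens_in_EndH that] .
  have ring: "ring diff_op_alg"
    using E.subring_is_ring[OF sub] by (simp add: diff_op_alg_def)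
  have smult: "c \<odot>\<^bsub>EndH\<^esub> x \<in> ?G" if "x \<in> ?G" for c x
  proof -
    have "(c \<odot>\<^bsub>EndH\<^esub> \<one>\<^bsub>EndH\<^esub>) \<otimes>\<^bsub>EndH\<^esub> x = c \<odot>\<^bsub>EndH\<^esub> (\<one>\<^bsub>EndH\<^esub> \<otimes>\<^bsub>EndH\<^esub> x)"
      by (rule E.smult_assoc_left) (simp_all add: in_E[OF that])
    moreover have "c \<odot>\<^bsub>EndH\<^esub> \<one>\<^bsub>EndH\<^esub> \<in> ?G"
      by (rule generate_ring.incl) blast
    ultimately show ?thesis
      using generate_ring.eng_mult[OF _ that] E.l_one[OF in_E[OF that]] by metis
  qed
  show ?thesis
  proof (rule assoc_algebra.intro)
    show "module scalar_ring diff_op_alg"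
      by (rule moduleI[OF scalar_cring ring.is_abelian_group[OF ring]])
        (use in_E smult E.smult_l_distr E.smult_r_distr E.smult_assoc1 E.smult_one in
          \<open>simp_all add: diff_op_alg_def\<close>)
    show "assoc_algebra_axioms scalar_ring diff_op_alg"
      by unfold_locales (use in_E E.smult_assoc_left E.smult_assoc_right in
          \<open>simp_all add: diff_op_alg_def\<close>)
  qed (rule ring)
qed

interpretation free: ring free_ring
  unfolding free_ring_def by (rule ring_of_type_ring)

lemma free_ring_simps [simp]:
  "carrier free_ring = UNIV" "x \<otimes>\<^bsub>free_ring\<^esub> y = x * y" "x \<oplus>\<^bsub>free_ring\<^esub> y = x + y"
  "\<one>\<^bsub>free_ring\<^esub> = 1" "\<zero>\<^bsub>free_ring\<^esub> = 0"
  by (simp_all add: free_ring_def ring_of_type_algebra_def)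

lemma relation_ideal_ideal: "ideal relation_ideal free_ring"
  unfolding relation_ideal_def by (rule free.genideal_ideal) simp

lemma sc_hom: "sc 1 = 1" "sc (c + d) = sc c + sc d" "sc (c * d) = sc c * sc d"
  by (simp_all add: sc_def single_add mult_single)

lemma sc_central: "x * sc c = sc c * x"
proof (induction x rule: poly_mapping_induct_single)
  case (add_single p m a)
  then show ?case by (simp add: sc_def mult_single distrib_left distrib_right mult.commute)
qed simp

lemma Aqt_carrier: "carrier Aqt = range residue_class"
  by (auto simp: Aqt_def ring.defs FactRing_def A_RCOSETS_def RCOSETS_def residue_class_def a_r_coset_def)

lemma Aqt_ops:
  "residue_class x \<otimes>\<^bsub>Aqt\<^esub> residue_class y = residue_class (x * y)"
  "residue_class x \<oplus>\<^bsub>Aqt\<^esub> residue_class y = residue_class (x + y)"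
  "\<one>\<^bsub>Aqt\<^esub> = residue_class 1"
  "\<zero>\<^bsub>Aqt\<^esub> = residue_class 0"
  "c \<odot>\<^bsub>Aqt\<^esub> residue_class x = residue_class (sc c * x)"
  using ring_hom_mult[OF ideal.rcos_ring_hom[OF relation_ideal_ideal]] ring_hom_add[OF ideal.rcos_ring_hom[OF relation_ideal_ideal]]
    ring_hom_one[OF ideal.rcos_ring_hom[OF relation_ideal_ideal]]
    ring_hom_zero[OF ideal.rcos_ring_hom[OF relation_ideal_ideal] free.ring_axioms ideal.quotient_is_ring[OF relation_ideal_ideal]]
  by (simp_all add: Aqt_def ring.defs residue_class_def)

lemma Aqt_ring: "ring Aqt"
proof (rule ringI)
  show "abelian_group Aqt"
  proof (rule abelian_groupI)
    fix a assume "a \<in> carrier Aqt"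
    then obtain x where "a = residue_class x"
      by (auto simp: Aqt_carrier)
    then have "residue_class (- x) \<oplus>\<^bsub>Aqt\<^esub> a = \<zero>\<^bsub>Aqt\<^esub>"
      by (simp add: Aqt_ops)
    then show "\<exists>b\<in>carrier Aqt. b \<oplus>\<^bsub>Aqt\<^esub> a = \<zero>\<^bsub>Aqt\<^esub>"
      by (auto simp: Aqt_carrier)
  qed (unfold Aqt_carrier, safe, simp_all add: Aqt_ops add.assoc, simp_all add: add.commute)
  show "Group.monoid Aqt"
  proof (rule monoidI)
  qed (unfold Aqt_carrier, safe, simp_all add: Aqt_ops mult.assoc)
qed (unfold Aqt_carrier, safe, simp_all add: Aqt_ops distrib_left distrib_right)

lemma Aqt_algebra: "assoc_algebra scalar_ring Aqt"
proof (rule assoc_algebra.intro)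
  show "module scalar_ring Aqt"
  proof (rule moduleI[OF scalar_cring ring.is_abelian_group[OF Aqt_ring]])
  qed (unfold Aqt_carrier scalar_ring_simps,
      safe, simp_all only: Aqt_ops sc_hom distrib_left distrib_right mult.assoc mult_1_left rangeI)
  have *: "x * (sc c * y) = sc c * (x * y)" for x y c
    by (metis sc_central mult.assoc)
  show "assoc_algebra_axioms scalar_ring Aqt"
    by (rule assoc_algebra_axioms.intro; unfold Aqt_carrier; safe; simp only: Aqt_ops mult.assoc *)
qed (rule Aqt_ring)

end

theory Submission
  imports Defs
begin

text \<open>
  The homomorphism exists because the \<open>q\<close>-difference operators satisfy the defining relations; the
  point is to reduce these relations to a few identities that can be seen to hold.

  Write \<open>u = q\<^sup>1\<^sup>/\<^sup>4\<close>, \<open>h = q\<^sup>1\<^sup>/\<^sup>2\<close>, \<open>s = t\<^sup>1\<^sup>/\<^sup>2\<close> and \<open>p\<^sub>\<alpha> = X\<^sub>\<alpha> + X\<^sub>\<alpha>\<^sup>-\<^sup>1\<close>. Multiplying out the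
  numerators shows that \<open>D\<^sub>\<alpha>\<^sub>,\<^sub>\<beta>\<^sub>;\<^sub>\<gamma>\<close> is the member \<open>W\<^sub>\<alpha>\<^sub>\<beta>\<^sub>\<gamma>(0, 0)\<close> of the family
  \<open>W\<^sub>\<alpha>\<^sub>\<beta>\<^sub>\<gamma>(m, n) = s\<^sup>-\<^sup>1 T\<^sub>\<alpha>(m-1) T\<^sub>\<beta>(n-1) - p\<^sub>\<gamma> T\<^sub>\<alpha>(m) T\<^sub>\<beta>(n) + s T\<^sub>\<alpha>(m+1) T\<^sub>\<beta>(n+1)\<close>, where
  \<open>T\<^sub>\<alpha>(n) = (X\<^sub>\<alpha>\<^sup>n \<delta>\<^sub>\<alpha> - X\<^sub>\<alpha>\<^sup>-\<^sup>n \<delta>\<^sub>\<alpha>\<^sup>-\<^sup>1) / (X\<^sub>\<alpha> - X\<^sub>\<alpha>\<^sup>-\<^sup>1)\<close>. A \<open>q\<close>-commutator with \<open>p\<^sub>\<alpha>\<close> merely moves the index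
  of \<open>\<alpha>\<close> by one, so all fifteen generators have to act, up to powers of \<open>u\<close>, as some \<open>p\<^sub>\<alpha>\<close> or as some
  \<open>W(0, 0)\<close>, \<open>W(1, 0)\<close>, \<open>W(0, -1)\<close> or \<open>W(1, -1)\<close>.

  The operators on one edge satisfy the quadratic relation \<open>T(m) T(n+1) = h T(m+1) T(n) + h\<^sup>-\<^sup>n U\<close> with
  \<open>U\<close> a Chebyshev polynomial in \<open>p\<close> (lemma \<open>T_T\<close>). For two operators \<open>W\<close> that share exactly one edge
  it yields the skein relation \<open>W_skein\<close>: one unit of index moves along the shared edge from one
  factor to the other, and the correction is a combination of three operators \<open>W\<close> on the two other
  edges. Together with \<open>W_commute\<close> and \<open>W_exchange\<close> this gives all relations between generators on
  different pairs of edges. Generators on the same pair of edges are compared through a normal form.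

  For the \<open>q\<close>-Casimir relation, the product of the three triple operators is transported along the
  three edges, one after the other (\<open>triple_product\<close>); it becomes the product of the three single
  operators plus a constant and terms that are quadratic, cubic with a multiplication operator, or
  the invariants \<open>boundary\<close> of the pairs of neighbouring loops. These invariants have a symmetry (\<open>boundary_sym\<close>)
  through which the average of the formula over the three rotations becomes the Casimir relation.

  All calculations take place over an arbitrary field with commuting automorphisms that dilate
  variables. The relations make the evaluation of words in the generators vanish on the ideal of
  relations, and the induced map on the quotient is the homomorphism. Its values lie in the algebra
  of difference operators since every generator is an iterated \<open>q\<close>-commutator of the \<open>O\<^sub>i\<close>.
\<close>

section \<open>Symmetrised shifts in one variable\<close>

text \<open>
  \<open>sh \<alpha> a\<close> plays the role of \<open>\<delta>\<^sub>\<alpha>\<^sup>a\<close>, \<open>h\<close> of \<open>q\<^sup>1\<^sup>/\<^sup>2\<close> and \<open>s\<close> of \<open>t\<^sup>1\<^sup>/\<^sup>2\<close>. The inverses \<open>h'\<close> and \<open>s'\<close> are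
  parameters of their own: the identities below then are polynomial identities modulo \<open>h h' = 1\<close> and
  \<open>s s' = 1\<close>, and no denominators have to be cleared.
\<close>

locale dilation_system =
  fixes sh :: "'e \<Rightarrow> int \<Rightarrow> 'k::field \<Rightarrow> 'k" and x :: "'e \<Rightarrow> 'k" and h h' s s' :: 'k
  assumes sh_add: "sh \<alpha> a (f + g) = sh \<alpha> a f + sh \<alpha> a g"
    and sh_mult: "sh \<alpha> a (f * g) = sh \<alpha> a f * sh \<alpha> a g"
    and sh_1 [simp]: "sh \<alpha> a 1 = 1"
    and sh_zero: "sh \<alpha> 0 f = f"
    and sh_sh: "sh \<alpha> a (sh \<alpha> b f) = sh \<alpha> (a + b) f"
    and sh_commute: "sh \<alpha> a (sh \<beta> b f) = sh \<beta> b (sh \<alpha> a f)"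
    and sh_x: "sh \<alpha> a (x \<beta>) = (if \<alpha> = \<beta> then h powi a * x \<beta> else x \<beta>)"
    and sh_h: "sh \<alpha> a h = h" and sh_s: "sh \<alpha> a s = s"
    and hh': "h * h' = 1" and ss': "s * s' = 1"
    and x_nonzero [simp]: "x \<alpha> \<noteq> 0" and x_diff_nonzero: "x \<alpha> - inverse (x \<alpha>) \<noteq> 0"
begin

lemma sh_0 [simp]: "sh \<alpha> a 0 = 0"
  by (metis sh_add add_0 add_cancel_right_right)

lemma sh_uminus: "sh \<alpha> a (- f) = - sh \<alpha> a f"
  using sh_add[of \<alpha> a f "- f"] by (simp add: eq_neg_iff_add_eq_0 add.commute)

lemma sh_diff: "sh \<alpha> a (f - g) = sh \<alpha> a f - sh \<alpha> a g"
  using sh_add[of \<alpha> a f "- g"] by (simp add: sh_uminus)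

lemma sh_inverse: "sh \<alpha> a (inverse f) = inverse (sh \<alpha> a f)"
proof (cases "f = 0")
  case False
  then have "sh \<alpha> a f * sh \<alpha> a (inverse f) = 1"
    by (simp flip: sh_mult)
  then show ?thesis by (rule inverse_unique[symmetric])
qed simp

lemma sh_divide: "sh \<alpha> a (f / g) = sh \<alpha> a f / sh \<alpha> a g"
  by (simp add: divide_inverse sh_mult sh_inverse)

lemma sh_powi: "sh \<alpha> a (f powi n) = sh \<alpha> a f powi n"
proof -
  have "sh \<alpha> a (f ^ k) = sh \<alpha> a f ^ k" for k f
    by (induction k) (simp_all add: sh_mult)
  then show ?thesis by (simp add: power_int_def sh_inverse)
qed

lemma sh_eq_0_iff: "sh \<alpha> a f = 0 \<longleftrightarrow> f = 0"
proof
  assume "sh \<alpha> a f = 0"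
  then have "sh \<alpha> (- a) (sh \<alpha> a f) = 0" by simp
  then show "f = 0" by (simp add: sh_sh sh_zero)
qed simp

lemma inverse_h: "inverse h = h'" and inverse_s: "inverse s = s'" and inverse_h': "inverse h' = h"
  using hh' ss' inverse_unique[of h' h] by (simp_all add: inverse_unique mult.commute)

lemma h_nonzero [simp]: "h \<noteq> 0" and s_nonzero [simp]: "s \<noteq> 0"
  using hh' ss' by auto

text \<open>
  The shifts commute with multiplication by such elements, so they are the scalars for all operators
  considered here.
\<close>

definition scal :: "'k \<Rightarrow> bool" where
  "scal c \<longleftrightarrow> (\<forall>\<alpha> a. sh \<alpha> a c = c)"

lemma scal_simps [simp]:
  "scal h" "scal s" "scal h'" "scal s'" "scal 1"
  "scal c \<Longrightarrow> scal d \<Longrightarrow> scal (c * d)" "scal c \<Longrightarrow> scal d \<Longrightarrow> scal (c + d)"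
  "scal c \<Longrightarrow> scal d \<Longrightarrow> scal (c - d)"
  "scal c \<Longrightarrow> scal (- c)"
  by (simp_all add: scal_def sh_h sh_s sh_mult sh_add sh_diff sh_inverse sh_uminus flip: inverse_h inverse_s)

lemma scal_powi [simp]: "scal c \<Longrightarrow> scal (c powi n)"
  by (simp add: scal_def sh_powi)

text \<open>
  Replacing \<open>x \<alpha>\<close> by its inverse and the shift by its inverse leaves \<open>T \<alpha> n\<close> unchanged. The factor
  \<open>x \<alpha> powi n\<close> is the twist that arises from \<open>q\<close>-commutators with \<open>p \<alpha>\<close>.
\<close>

definition T :: "'e \<Rightarrow> int \<Rightarrow> 'k \<Rightarrow> 'k" where
  "T \<alpha> n f = (x \<alpha> powi n * sh \<alpha> 1 f - x \<alpha> powi (-n) * sh \<alpha> (-1) f) / (x \<alpha> - inverse (x \<alpha>))"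

definition p :: "'e \<Rightarrow> 'k" where
  "p \<alpha> = x \<alpha> + inverse (x \<alpha>)"

text \<open>
  The Chebyshev polynomial of the second kind \<open>U\<^sub>k\<^sub>-\<^sub>1(p/2)\<close>, for all integers \<open>k\<close>.
\<close>

definition cheb :: "'e \<Rightarrow> int \<Rightarrow> 'k" where
  "cheb \<alpha> k = (x \<alpha> powi k - x \<alpha> powi (-k)) / (x \<alpha> - inverse (x \<alpha>))"

lemma T_add: "T \<alpha> n (f + g) = T \<alpha> n f + T \<alpha> n g"
  by (simp add: T_def sh_add algebra_simps flip: add_divide_distrib diff_divide_distrib)

lemma T_mult_invariant: "sh \<alpha> 1 c = c \<Longrightarrow> sh \<alpha> (-1) c = c \<Longrightarrow> T \<alpha> n (c * f) = c * T \<alpha> n f"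
  by (simp add: T_def sh_mult algebra_simps)

lemma T_scal: "scal c \<Longrightarrow> T \<alpha> n (c * f) = c * T \<alpha> n f"
  by (rule T_mult_invariant) (simp_all add: scal_def)

lemma T_uminus: "T \<alpha> n (- f) = - T \<alpha> n f"
  using T_scal[of "- 1" \<alpha> n f] by simp

lemma T_diff: "T \<alpha> n (f - g) = T \<alpha> n f - T \<alpha> n g"
  using T_add[of \<alpha> n f "- g"] by (simp add: T_uminus)

lemma T_p_other: "\<alpha> \<noteq> \<beta> \<Longrightarrow> T \<alpha> n (p \<beta> * f) = p \<beta> * T \<alpha> n f"
  by (rule T_mult_invariant) (simp_all add: p_def sh_add sh_inverse sh_x)

lemma x_powi_step:
  "x \<alpha> powi (n + 1) = x \<alpha> powi n * x \<alpha>" "x \<alpha> powi (n - 1) = x \<alpha> powi n * inverse (x \<alpha>)"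
  "x \<alpha> powi (- (n + 1)) = x \<alpha> powi (- n) * inverse (x \<alpha>)"
  "x \<alpha> powi (- (n - 1)) = x \<alpha> powi (- n) * x \<alpha>"
  by (simp_all add: power_int_add power_int_diff power_int_minus divide_inverse)

text \<open>
  This and the next lemma say that \<open>q\<close>-commutators with \<open>p \<alpha>\<close> act on the index only: both products are
  combinations of the same two operators, and the coefficients differ by powers of \<open>h\<close>.
\<close>

lemma T_p: "T \<alpha> n (p \<alpha> * f) = h * T \<alpha> (n + 1) f + h' * T \<alpha> (n - 1) f"
  unfolding T_def p_def sh_mult sh_add sh_inverse sh_x x_powi_step
  by (simp add: power_int_minus inverse_h inverse_h' add_divide_distrib diff_divide_distrib algebra_simps)

lemma p_T: "p \<alpha> * T \<alpha> n f = T \<alpha> (n + 1) f + T \<alpha> (n - 1) f"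
  unfolding T_def p_def x_powi_step by (simp add: add_divide_distrib[symmetric] algebra_simps)

lemma T_commute:
  assumes "\<alpha> \<noteq> \<beta>"
  shows "T \<alpha> m (T \<beta> n f) = T \<beta> n (T \<alpha> m f)"
proof -
  define A B where "A = x \<alpha> - inverse (x \<alpha>)" and "B = x \<beta> - inverse (x \<beta>)"
  have inv: "sh \<alpha> a (x \<beta> powi k) = x \<beta> powi k" "sh \<beta> a (x \<alpha> powi k) = x \<alpha> powi k"
    "sh \<alpha> a B = B" "sh \<beta> a A = A" for a k
    using assms by (simp_all add: A_def B_def sh_powi sh_x sh_diff sh_inverse)
  show ?thesis
    unfolding T_def A_def[symmetric] B_def[symmetric] sh_divide sh_diff sh_mult inv sh_commute[of \<beta> _ \<alpha>]
    by (simp add: right_diff_distrib diff_divide_distrib mult.left_commute mult.commute)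
qed

lemma cheb_base [simp]: "cheb \<alpha> 0 = 0" "cheb \<alpha> 1 = 1"
  using x_diff_nonzero[of \<alpha>] by (simp_all add: cheb_def power_int_minus)

lemma cheb_minus: "cheb \<alpha> (- k) = - cheb \<alpha> k"
  by (simp add: cheb_def minus_divide_left)

lemma cheb_rec: "p \<alpha> * cheb \<alpha> k = cheb \<alpha> (k + 1) + cheb \<alpha> (k - 1)"
  unfolding cheb_def p_def x_powi_step by (simp add: add_divide_distrib[symmetric] algebra_simps)

text \<open>
  The coefficients of the second power of the shift and of its inverse in \<open>T \<alpha> m (T \<alpha> n f)\<close> depend on
  \<open>m + n\<close> only, apart from a power of \<open>h\<close>. So these terms cancel in the difference of the two products,
  and what remains are the terms in which the two shifts are inverse to each other.
\<close>

lemma T_T: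
  "T \<alpha> m (T \<alpha> (n + 1) f) = h * T \<alpha> (m + 1) (T \<alpha> n f) + h powi (- n) * (cheb \<alpha> (m - n) * f)"
proof -
  define z where "z = x \<alpha>"
  define A B C where "A = z - inverse z" and "B = h * z - inverse (h * z)" and "C = z / h - h / z"
  define M N G where "M = z powi m" and "N = z powi n" and "G = h powi n"
  define F where "F = (\<lambda>a. sh \<alpha> a f)"
  have nz [simp]: "z \<noteq> 0" "M \<noteq> 0" "N \<noteq> 0" "G \<noteq> 0"
    by (simp_all add: z_def M_def N_def G_def)
  have sx: "sh \<alpha> 1 z = h * z" "sh \<alpha> (-1) z = z / h"
    by (simp_all add: z_def sh_x power_int_minus divide_inverse mult.commute)
  have A: "A \<noteq> 0" using x_diff_nonzero by (simp add: A_def z_def)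
  have AB: "sh \<alpha> 1 A = B" "sh \<alpha> (-1) A = C"
    by (simp_all add: A_def B_def C_def sh_diff sh_inverse sx)
  then have BC: "B \<noteq> 0" "C \<noteq> 0" using A sh_eq_0_iff by metis+
  have T2: "T \<alpha> k (T \<alpha> l f) =
      (z powi k * ((h powi l * z powi l * F 2 - f / (h powi l * z powi l)) / B)
       - (((z powi l / h powi l) * f - (h powi l / z powi l) * F (-2)) / C) / z powi k) / A" for k l
  proof -
    have F: "sh \<alpha> 1 (F 1) = F 2" "sh \<alpha> (-1) (F (-1)) = F (-2)" "sh \<alpha> 1 (F (-1)) = f" "sh \<alpha> (-1) (F 1) = f"
      by (simp_all add: F_def sh_sh sh_zero)
    have pw: "(h * z) powi l = h powi l * z powi l" "(z / h) powi l = z powi l / h powi l"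
      by (simp_all add: power_int_mult_distrib power_int_divide_distrib power_int_mult)
    have T1: "T \<alpha> l f = (z powi l * F 1 - F (-1) / z powi l) / A"
      by (simp add: T_def z_def A_def F_def power_int_minus divide_inverse mult.commute)
    have "sh \<alpha> 1 (T \<alpha> l f) = (h powi l * z powi l * F 2 - f / (h powi l * z powi l)) / B"
      unfolding T1 sh_divide sh_diff sh_mult sh_powi sx pw F AB ..
    moreover have "sh \<alpha> (-1) (T \<alpha> l f) = ((z powi l / h powi l) * f - (h powi l / z powi l) * F (-2)) / C"
      unfolding T1 sh_divide sh_diff sh_mult sh_powi sx pw F AB by simp
    ultimately show ?thesis
      by (simp add: T_def[of \<alpha> k] power_int_minus z_def A_def divide_inverse mult.commute)
  qed
  have pws: "z powi (m+1) = M * z" "z powi (n+1) = N * z" "h powi (n+1) = G * h"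
    "h powi n = G" "h powi (-n) = inverse G" "z powi m = M" "z powi n = N"
    "z powi (m-n) = M * inverse N" "z powi (-(m-n)) = N * inverse M"
    by (simp_all add: M_def N_def G_def power_int_add power_int_diff power_int_minus divide_inverse distrib_left)
  have ch: "cheb \<alpha> (m - n) = (M * inverse N - N * inverse M) * inverse A"
    unfolding cheb_def z_def[symmetric] pws A_def divide_inverse ..
  define y w b c Mi Ni Gi where "y = inverse z" and "w = inverse h" and "b = inverse B" and "c = inverse C"
    and "Mi = inverse M" and "Ni = inverse N" and "Gi = inverse G"
  \<comment> \<open>the only two facts about the denominators \<open>B\<close> and \<open>C\<close> of the inner operator that the comparison needs\<close>
  have h: "b * (h * z - w * y) = 1" "c * (z * w - h * y) = 1"
    using BC by (simp_all add: b_def c_def w_def y_def B_def C_def divide_inverse)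
  have "M * ((G * h * (N * z) * F 2 - f * (Gi * w * (Ni * y))) * b)
      - ((N * z) * (Gi * w) * f - (G * h) * (Ni * y) * F (-2)) * c * Mi
    - (h * (M * z * ((G * N * F 2 - f * (Gi * Ni)) * b) - (N * Gi * f - G * Ni * F (-2)) * c * (Mi * y))
      + Gi * (M * Ni - N * Mi) * f)
    = f * Gi * M * Ni * (b * (h * z - w * y) - 1) - f * Gi * N * Mi * (c * (z * w - h * y) - 1)"
    by (simp add: algebra_simps)
  then have eq: "M * ((G * h * (N * z) * F 2 - f * (Gi * w * (Ni * y))) * b)
      - ((N * z) * (Gi * w) * f - (G * h) * (Ni * y) * F (-2)) * c * Mi
    = h * (M * z * ((G * N * F 2 - f * (Gi * Ni)) * b) - (N * Gi * f - G * Ni * F (-2)) * c * (Mi * y))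
      + Gi * (M * Ni - N * Mi) * f"
    unfolding h by simp
  have "T \<alpha> m (T \<alpha> (n + 1) f) = (M * ((G * h * (N * z) * F 2 - f * (Gi * w * (Ni * y))) * b)
      - ((N * z) * (Gi * w) * f - (G * h) * (Ni * y) * F (-2)) * c * Mi) * inverse A"
    unfolding T2 pws divide_inverse y_def w_def b_def c_def Mi_def Ni_def Gi_def inverse_mult_distrib
    by (simp only: mult.assoc)
  also have "\<dots> = h * ((M * z * ((G * N * F 2 - f * (Gi * Ni)) * b) - (N * Gi * f - G * Ni * F (-2)) * c * (Mi * y)) * inverse A)
      + Gi * ((M * Ni - N * Mi) * inverse A * f)"
    unfolding eq by (simp add: algebra_simps)
  also have "\<dots> = h * T \<alpha> (m + 1) (T \<alpha> n f) + h powi (- n) * (cheb \<alpha> (m - n) * f)"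
    unfolding T2 ch pws divide_inverse y_def w_def b_def c_def Mi_def Ni_def Gi_def inverse_mult_distrib
    by (simp only: mult.assoc)
  finally show ?thesis .
qed

section \<open>Two-edge operators and skein relations along a shared edge\<close>

text \<open>
  \<open>W \<alpha> \<beta> \<gamma> 0 0\<close> is the operator \<open>D \<alpha> \<beta> \<gamma>\<close>; general indices multiply its term with the shifts
  \<open>\<delta>\<^sub>\<alpha>\<^sup>a \<delta>\<^sub>\<beta>\<^sup>b\<close> by \<open>x \<alpha> powi (m * a) * x \<beta> powi (n * b)\<close>.
\<close>

definition W :: "'e \<Rightarrow> 'e \<Rightarrow> 'e \<Rightarrow> int \<Rightarrow> int \<Rightarrow> 'k \<Rightarrow> 'k" where
  "W \<alpha> \<beta> \<gamma> m n f = s' * T \<alpha> (m - 1) (T \<beta> (n - 1) f) - p \<gamma> * T \<alpha> m (T \<beta> n f)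
     + s * T \<alpha> (m + 1) (T \<beta> (n + 1) f)"

definition \<theta> :: 'k where "\<theta> = h * s' + h' * s"
definition \<kappa> :: 'k where "\<kappa> = h - h'"

lemma cancel: "h * (h' * c) = c" "h' * (h * c) = c" "s * (s' * c) = c" "s' * (s * c) = c" "h' * h = 1" "s' * s = 1"
  by (simp_all flip: inverse_h inverse_s)

lemmas cancels = cancel hh' ss'

lemma W_linear:
  "W \<alpha> \<beta> \<gamma> m n (f + g) = W \<alpha> \<beta> \<gamma> m n f + W \<alpha> \<beta> \<gamma> m n g"
  "W \<alpha> \<beta> \<gamma> m n (f - g) = W \<alpha> \<beta> \<gamma> m n f - W \<alpha> \<beta> \<gamma> m n g"
  "W \<alpha> \<beta> \<gamma> m n (- f) = - W \<alpha> \<beta> \<gamma> m n f"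
  "scal c \<Longrightarrow> W \<alpha> \<beta> \<gamma> m n (c * f) = c * W \<alpha> \<beta> \<gamma> m n f"
  by (simp_all add: W_def T_add T_diff T_uminus T_scal algebra_simps)

lemma W_swap: "\<alpha> \<noteq> \<beta> \<Longrightarrow> W \<alpha> \<beta> \<gamma> m n f = W \<beta> \<alpha> \<gamma> n m f"
  by (simp add: W_def T_commute[of \<alpha> \<beta>])

lemma W_p_left: "\<alpha> \<noteq> \<beta> \<Longrightarrow> W \<alpha> \<beta> \<gamma> m n (p \<alpha> * f) = h * W \<alpha> \<beta> \<gamma> (m + 1) n f + h' * W \<alpha> \<beta> \<gamma> (m - 1) n f"
  unfolding W_def by (simp add: T_p_other T_p T_add T_scal) (simp add: algebra_simps)

lemma p_W_left: "\<alpha> \<noteq> \<beta> \<Longrightarrow> p \<alpha> * W \<alpha> \<beta> \<gamma> m n f = W \<alpha> \<beta> \<gamma> (m + 1) n f + W \<alpha> \<beta> \<gamma> (m - 1) n f"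
  unfolding W_def distrib_left right_diff_distrib
    mult.left_commute[of "p \<alpha>" s] mult.left_commute[of "p \<alpha>" s'] mult.left_commute[of "p \<alpha>" "p \<gamma>"] p_T
  by (simp add: algebra_simps)

lemma W_p_right: "\<alpha> \<noteq> \<beta> \<Longrightarrow> W \<alpha> \<beta> \<gamma> m n (p \<beta> * f) = h * W \<alpha> \<beta> \<gamma> m (n + 1) f + h' * W \<alpha> \<beta> \<gamma> m (n - 1) f"
  using W_p_left[of \<beta> \<alpha> \<gamma> n m f] by (simp add: W_swap[of \<beta> \<alpha>])

lemma p_W_right: "\<alpha> \<noteq> \<beta> \<Longrightarrow> p \<beta> * W \<alpha> \<beta> \<gamma> m n f = W \<alpha> \<beta> \<gamma> m (n + 1) f + W \<alpha> \<beta> \<gamma> m (n - 1) f"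
  using p_W_left[of \<beta> \<alpha> \<gamma> n m f] by (simp add: W_swap[of \<beta> \<alpha>])

lemma W_p_other: "\<gamma> \<noteq> \<alpha> \<Longrightarrow> \<gamma> \<noteq> \<beta> \<Longrightarrow> W \<alpha> \<beta> \<gamma> m n (p \<gamma> * f) = p \<gamma> * W \<alpha> \<beta> \<gamma> m n f"
  unfolding W_def by (simp add: T_p_other) (simp add: algebra_simps)

lemma W_T:
  "W \<alpha> \<beta> \<gamma> m n (T \<gamma> k f) = s' * T \<alpha> (m - 1) (T \<beta> (n - 1) (T \<gamma> k f)) - T \<alpha> m (T \<beta> n (T \<gamma> (k + 1) f))
     - T \<alpha> m (T \<beta> n (T \<gamma> (k - 1) f)) + s * T \<alpha> (m + 1) (T \<beta> (n + 1) (T \<gamma> k f))"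
  if "\<alpha> \<noteq> \<gamma>" "\<beta> \<noteq> \<gamma>"
proof -
  have "p \<gamma> * T \<alpha> m (T \<beta> n (T \<gamma> k f)) = T \<alpha> m (T \<beta> n (p \<gamma> * T \<gamma> k f))"
    using that by (simp add: T_p_other)
  then show ?thesis by (simp add: W_def p_T T_add)
qed

text \<open>
  Each factor contains the multiplication by \<open>p\<close> of the edge that only the other factor shifts. These
  multiplications are absorbed into the operators \<open>T\<close> of the other factor, which leaves a combination of
  products \<open>M\<close> in which only the shared edge \<open>\<alpha>\<close> occurs twice.
\<close>

lemma W_W_shared:
  assumes d: "\<alpha> \<noteq> \<beta>" "\<beta> \<noteq> \<gamma>" "\<alpha> \<noteq> \<gamma>"
  defines "M \<equiv> \<lambda>k a b j f. T \<gamma> k (T \<beta> j (T \<alpha> a (T \<alpha> b f)))"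
  shows "W \<gamma> \<alpha> \<beta> k a (W \<alpha> \<beta> \<gamma> b j f) =
      s' * (s' * M (k-1) (a-1) (b-1) (j-1) f) + M (k-1) (a-1) (b+1) (j+1) f
    + M (k+1) (a+1) (b-1) (j-1) f + s * (s * M (k+1) (a+1) (b+1) (j+1) f)
    - s' * (M k a (b-1) j f + M k a (b-1) (j-2) f) - s * (M k a (b+1) (j+2) f + M k a (b+1) j f)
    - s' * (h * M k (a-1) b j f + h' * M (k-2) (a-1) b j f)
    - s * (h * M (k+2) (a+1) b j f + h' * M k (a+1) b j f)
    + h * (M (k+1) a b (j+1) f + M (k+1) a b (j-1) f)
    + h' * (M (k-1) a b (j+1) f + M (k-1) a b (j-1) f)"
proof -
  note d' = d d[symmetric]
  have 1: "W \<gamma> \<alpha> \<beta> k a (T \<alpha> b (T \<beta> j f)) =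
     s' * M (k-1) (a-1) b j f - M k a b (j+1) f - M k a b (j-1) f + s * M (k+1) (a+1) b j f" for k a b j
    using d' by (simp add: T_commute[of \<alpha> \<beta>] W_T M_def)
  show ?thesis
    unfolding W_def[of \<alpha> \<beta> \<gamma>] W_linear(1,2)
    using d' by (simp add: W_linear W_p_left 1)
      (simp add: algebra_simps cancels)
qed

text \<open>
  Applying \<open>T_T\<close> on the shared edge to each of the sixteen products of \<open>W_W_shared\<close> moves a unit of
  index from the second factor to the first. The sixteen corrections contain no shift of \<open>\<alpha>\<close> any more,
  and the recursion of the Chebyshev polynomials assembles them into three operators on the other
  two edges, as in the resolution of a crossing of two curves.
\<close>

lemma W_skein:
  assumes d: "\<alpha> \<noteq> \<beta>" "\<beta> \<noteq> \<gamma>" "\<alpha> \<noteq> \<gamma>" 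
  shows "W \<gamma> \<alpha> \<beta> k l (W \<alpha> \<beta> \<gamma> (i + 1) j f) = h * W \<gamma> \<alpha> \<beta> k (l + 1) (W \<alpha> \<beta> \<gamma> i j f)
    + h powi (- i) * (\<theta> * cheb \<alpha> (l - i) * W \<gamma> \<beta> \<alpha> k j f
       - h' * (cheb \<alpha> (l - i - 1) * W \<gamma> \<beta> \<alpha> (k - 1) (j + 1) f)
       - h * (cheb \<alpha> (l - i + 1) * W \<gamma> \<beta> \<alpha> (k + 1) (j - 1) f))"
proof -
  note d' = d d[symmetric]
  define M where "M = (\<lambda>k a b j. T \<gamma> k (T \<beta> j (T \<alpha> a (T \<alpha> b f))))"
  \<comment> \<open>the same function as \<open>M\<close>; the second name keeps the products that have been rewritten apart from those that have not\<close>
  define M' where "M' = (\<lambda>k a b j. T \<gamma> k (T \<beta> j (T \<alpha> a (T \<alpha> b f))))"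
  define B where "B = (\<lambda>k j. T \<gamma> k (T \<beta> j f))"
  define g where "g = h powi (- i)"
  define c c' P where "c = cheb \<alpha> (l - i)" and "c' = cheb \<alpha> (l - i - 1)" and "P = p \<alpha>"
  have ch: "cheb \<alpha> (l - i + 1) = P * c - c'" "cheb \<alpha> (l - i + 2) = P * (P * c - c') - c"
    "cheb \<alpha> (l - i - 2) = P * c' - c" "cheb \<alpha> (l - i) = c" "cheb \<alpha> (l - i - 1) = c'"
    using cheb_rec[of \<alpha> "l - i"] cheb_rec[of \<alpha> "l - i + 1"] cheb_rec[of \<alpha> "l - i - 1"]
    by (simp_all add: c_def c'_def P_def algebra_simps)
  have inv: "sh \<beta> a (cheb \<alpha> r) = cheb \<alpha> r" "sh \<gamma> a (cheb \<alpha> r) = cheb \<alpha> r" for a r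
    using d' by (simp_all add: cheb_def sh_divide sh_diff sh_inverse sh_powi sh_x)
  have MM: "M k a (b + 1) j = h * M' k (a + 1) b j + h powi (- b) * (cheb \<alpha> (a - b) * B k j)" for k a b j
    unfolding M_def M'_def B_def T_T T_add by (simp add: T_scal T_mult_invariant inv)
  have g: "h powi (- (i - 1)) = h * g" "h powi (- (i + 1)) = h' * g" "h powi (- i) = g"
    by (simp_all add: g_def power_int_add power_int_diff power_int_minus inverse_h divide_inverse)
  have M3: "M k a (i + 1 - 1) j = h * M' k (a + 1) (i - 1) j + h * g * (cheb \<alpha> (a - (i - 1)) * B k j)"
    "M k a (i + 1) j = h * M' k (a + 1) i j + g * (cheb \<alpha> (a - i) * B k j)"
    "M k a (i + 1 + 1) j = h * M' k (a + 1) (i + 1) j + h' * g * (cheb \<alpha> (a - (i + 1)) * B k j)" for k a j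
    using MM[of k a "i - 1" j] MM[of k a i j] MM[of k a "i + 1" j] g
    by simp_all
  have ch': "cheb \<alpha> (l - 1 - (i - 1)) = c" "cheb \<alpha> (l - 1 - i) = c'" "cheb \<alpha> (l - 1 - (i + 1)) = P * c' - c"
    "cheb \<alpha> (l + 1 - (i - 1)) = P * (P * c - c') - c" "cheb \<alpha> (l + 1 - i) = P * c - c'" "cheb \<alpha> (l + 1 - (i + 1)) = c"
    "cheb \<alpha> (l - (i - 1)) = P * c - c'" "cheb \<alpha> (l - (i + 1)) = c'"
    using ch by (simp_all add: algebra_simps)
  have idx: "l - 1 + 1 = l + 1 - 1" by simp
  have W: "W \<gamma> \<beta> \<alpha> k j f = s' * B (k-1) (j-1) - P * B k j + s * B (k+1) (j+1)" for k j
    by (simp add: W_def B_def P_def)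
  have step: "k - 1 - 1 = k - 2" "k + 1 - 1 = k" "k + 1 + 1 = k + 2" "k - 1 + 1 = k" for k :: int
    by simp_all
  have fold: "T \<gamma> k (T \<beta> j (T \<alpha> a (T \<alpha> b f))) = M k a b j" "T \<gamma> k (T \<beta> j (T \<alpha> a (T \<alpha> b f))) = M' k a b j" for k a b j
    by (simp_all add: M_def M'_def)
  note L = W_W_shared[OF d, of k l "i + 1" j f, unfolded fold(1), unfolded M3 ch ch']
  note R = W_W_shared[OF d, of k "l + 1" i j f, unfolded fold(2)]
  show ?thesis
    unfolding L R g \<theta>_def W ch ch' idx step
    by (simp add: algebra_simps cancels)
qed

lemma cheb_numeral: "cheb \<alpha> 2 = p \<alpha>" "cheb \<alpha> (-1) = -1" "cheb \<alpha> (-2) = - p \<alpha>"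
  "cheb \<alpha> 3 = p \<alpha> * p \<alpha> - 1" "cheb \<alpha> (-3) = 1 - p \<alpha> * p \<alpha>"
  using cheb_rec[of \<alpha> 1] cheb_rec[of \<alpha> 2] cheb_minus[of \<alpha> 1] cheb_minus[of \<alpha> 2] cheb_minus[of \<alpha> 3]
  by (simp_all add: algebra_simps)

text \<open>
  Products of two operators on one edge whose indices are close to \<open>l\<close>, in either order, expressed by
  products whose left index exceeds the right one by 0 or 1: these are all the products that
  occur when two operators \<open>W\<close> with nearly equal indices at an edge are interchanged.
\<close>

lemma T_T_near:
  "T \<alpha> (l - 1) (T \<alpha> l f) = h * T \<alpha> l (T \<alpha> (l - 1) f)"
  "T \<alpha> l (T \<alpha> (l + 1) f) = h * T \<alpha> (l + 1) (T \<alpha> l f)"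
  "T \<alpha> (l + 1) (T \<alpha> (l + 2) f) = h * T \<alpha> (l + 2) (T \<alpha> (l + 1) f)"
  "T \<alpha> (l - 1) (T \<alpha> (l + 1) f) = h * T \<alpha> l (T \<alpha> l f) - h powi (- l) * f"
  "T \<alpha> l (T \<alpha> (l + 2) f) = h * T \<alpha> (l + 1) (T \<alpha> (l + 1) f) - h' * (h powi (- l) * f)"
  "T \<alpha> (l + 1) (T \<alpha> (l - 1) f) = h' * T \<alpha> l (T \<alpha> l f) - h powi (- l) * f"
  "T \<alpha> (l + 2) (T \<alpha> l f) = h' * T \<alpha> (l + 1) (T \<alpha> (l + 1) f) - h' * (h powi (- l) * f)"
  "T \<alpha> (l - 1) (T \<alpha> (l + 2) f) = h * (h * T \<alpha> (l + 1) (T \<alpha> l f)) - h' * (h powi (- l) * (p \<alpha> * f))"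
  "T \<alpha> (l + 2) (T \<alpha> (l - 1) f) = h' * T \<alpha> (l + 1) (T \<alpha> l f) - h powi (- l) * (p \<alpha> * f)"
proof -
  have g: "h powi (- (l - 1)) = h * h powi (- l)" "h powi (- (l + 1)) = h' * h powi (- l)"
    by (simp_all add: power_int_add power_int_diff power_int_minus inverse_h divide_inverse)
  have idx: "l - 1 + 1 = l" "l + 1 + 1 = l + 2" by simp_all
  have diff: "l - 1 - (l - 1) = 0" "l - (l - 1) = 1" "l + 1 - (l - 1) = 2" "l - 1 - l = - 1" "l - l = 0"
    "l + 1 - l = 1" "l - 1 - (l + 1) = - 2" "l - (l + 1) = - 1" "l + 1 - (l + 1) = 0"
    by simp_all
  note T = T_T[of \<alpha> _ "l - 1", unfolded g idx] T_T[of \<alpha> _ l] T_T[of \<alpha> _ "l + 1", unfolded g idx]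
  note near = T(1)[of "l - 1"] T(1)[of l] T(1)[of "l + 1"] T(2)[of "l - 1"] T(2)[of l] T(2)[of "l + 1"]
      T(3)[of "l - 1"] T(3)[of l] T(3)[of "l + 1"]
  show "T \<alpha> (l - 1) (T \<alpha> l f) = h * T \<alpha> l (T \<alpha> (l - 1) f)"
    "T \<alpha> l (T \<alpha> (l + 1) f) = h * T \<alpha> (l + 1) (T \<alpha> l f)"
    "T \<alpha> (l + 1) (T \<alpha> (l + 2) f) = h * T \<alpha> (l + 2) (T \<alpha> (l + 1) f)"
    "T \<alpha> (l - 1) (T \<alpha> (l + 1) f) = h * T \<alpha> l (T \<alpha> l f) - h powi (- l) * f"
    "T \<alpha> l (T \<alpha> (l + 2) f) = h * T \<alpha> (l + 1) (T \<alpha> (l + 1) f) - h' * (h powi (- l) * f)"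
    "T \<alpha> (l + 1) (T \<alpha> (l - 1) f) = h' * T \<alpha> l (T \<alpha> l f) - h powi (- l) * f"
    "T \<alpha> (l + 2) (T \<alpha> l f) = h' * T \<alpha> (l + 1) (T \<alpha> (l + 1) f) - h' * (h powi (- l) * f)"
    "T \<alpha> (l - 1) (T \<alpha> (l + 2) f) = h * (h * T \<alpha> (l + 1) (T \<alpha> l f)) - h' * (h powi (- l) * (p \<alpha> * f))"
    "T \<alpha> (l + 2) (T \<alpha> (l - 1) f) = h' * T \<alpha> (l + 1) (T \<alpha> l f) - h powi (- l) * (p \<alpha> * f)"
    unfolding near[unfolded diff idx cheb_numeral cheb_base] by (simp_all add: algebra_simps cancels)
qed

text \<open>
  Equal indices at the shared edge: the corrections from reordering the products of \<open>T \<alpha>\<close> cancel.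
\<close>

lemma W_commute:
  assumes d: "\<alpha> \<noteq> \<beta>" "\<beta> \<noteq> \<gamma>" "\<alpha> \<noteq> \<gamma>"
  shows "W \<gamma> \<alpha> \<beta> k l (W \<alpha> \<beta> \<gamma> l j f) = W \<alpha> \<beta> \<gamma> l j (W \<gamma> \<alpha> \<beta> k l f)"
proof -
  have d2: "\<alpha> \<noteq> \<gamma>" "\<gamma> \<noteq> \<beta>" "\<alpha> \<noteq> \<beta>" using d by auto
  have swap: "W \<alpha> \<beta> \<gamma> l j (W \<gamma> \<alpha> \<beta> k l f) = W \<beta> \<alpha> \<gamma> j l (W \<alpha> \<gamma> \<beta> l k f)"
    using d W_swap[of \<alpha> \<beta> \<gamma> l j] W_swap[of \<gamma> \<alpha> \<beta> k l f] by simp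
  show ?thesis
    unfolding swap W_W_shared[OF d] W_W_shared[OF d2]
    unfolding T_T_near T_commute[OF d(2)]
    using d by (simp add: T_add T_diff T_scal T_p_other) (simp add: algebra_simps cancels)
qed

text \<open>
  Indices that differ by one at the shared edge: the two orders agree up to a power of \<open>q\<close> and a single
  operator on the other two edges. This is the \<open>q\<close>-commutator of two curves that cross once.
\<close>

lemma W_exchange:
  assumes d: "\<alpha> \<noteq> \<beta>" "\<beta> \<noteq> \<gamma>" "\<alpha> \<noteq> \<gamma>"
  shows "W \<gamma> \<alpha> \<beta> k l (W \<alpha> \<beta> \<gamma> (l + 1) j f) =
    h * W \<alpha> \<beta> \<gamma> (l + 1) j (W \<gamma> \<alpha> \<beta> k l f) - h powi (- l) * (\<kappa> * W \<gamma> \<beta> \<alpha> (k - 1) (j + 1) f)"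
proof -
  have d2: "\<alpha> \<noteq> \<gamma>" "\<gamma> \<noteq> \<beta>" "\<alpha> \<noteq> \<beta>" using d by auto
  have swap: "W \<alpha> \<beta> \<gamma> (l + 1) j (W \<gamma> \<alpha> \<beta> k l f) = W \<beta> \<alpha> \<gamma> j (l + 1) (W \<alpha> \<gamma> \<beta> l k f)"
    using d W_swap[of \<alpha> \<beta> \<gamma> "l + 1" j] W_swap[of \<gamma> \<alpha> \<beta> k l f] by simp
  have idx: "l + 1 - 1 = l" "l + 1 + 1 = l + 2" by simp_all
  show ?thesis
    unfolding swap W_W_shared[OF d] W_W_shared[OF d2] idx
    unfolding T_T_near T_commute[OF d(2)] W_def \<kappa>_def
    using d by (simp add: T_add T_diff T_scal T_p_other) (simp add: algebra_simps cancels)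
qed

text \<open>
  For indices that differ by two, both orders of the product lead to the product in the middle, whose
  factors commute by \<open>W_commute\<close>. Hence this lemma and the next one give the \<open>q\<^sup>2\<close>-commutators.
\<close>

lemma W_skein_up:
  assumes d: "\<alpha> \<noteq> \<beta>" "\<beta> \<noteq> \<gamma>" "\<alpha> \<noteq> \<gamma>"
  shows "W \<gamma> \<alpha> \<beta> k l (W \<alpha> \<beta> \<gamma> (l + 2) j f) = h * W \<gamma> \<alpha> \<beta> k (l + 1) (W \<alpha> \<beta> \<gamma> (l + 1) j f)
    + h' * (h powi (- l) * (h' * (p \<alpha> * W \<gamma> \<beta> \<alpha> (k - 1) (j + 1) f) - \<theta> * W \<gamma> \<beta> \<alpha> k j f))"
proof -
  have g: "h powi (- (l + 1)) = h' * h powi (- l)"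
    by (simp add: power_int_add power_int_diff power_int_minus inverse_h divide_inverse)
  have idx: "l + 1 + 1 = l + 2" "l - (l + 1) = - 1" "- 1 - 1 = (- 2 :: int)" "- 1 + 1 = (0 :: int)" by simp_all
  show ?thesis
    using W_skein[OF d, of k l "l + 1" j f] unfolding g idx cheb_numeral cheb_base
    by (simp add: algebra_simps)
qed

lemma W_skein_down:
  assumes d: "\<alpha> \<noteq> \<beta>" "\<beta> \<noteq> \<gamma>" "\<alpha> \<noteq> \<gamma>"
  shows "W \<alpha> \<beta> \<gamma> (l + 2) j (W \<gamma> \<alpha> \<beta> k l f) = h' * W \<alpha> \<beta> \<gamma> (l + 1) j (W \<gamma> \<alpha> \<beta> k (l + 1) f)
    + h powi (- l) * (p \<alpha> * W \<gamma> \<beta> \<alpha> (k - 1) (j + 1) f - h' * (\<theta> * W \<gamma> \<beta> \<alpha> k j f))"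
proof -
  have d2: "\<alpha> \<noteq> \<gamma>" "\<gamma> \<noteq> \<beta>" "\<alpha> \<noteq> \<beta>" using d by auto
  have idx: "l + 1 + 1 = l + 2" "l + 1 - l = 1" "1 - 1 = (0 :: int)" "1 + 1 = (2 :: int)" by simp_all
  \<comment> \<open>the skein relation for \<open>\<beta>\<close> and \<open>\<gamma>\<close> interchanged, read backwards\<close>
  have eq: "W \<alpha> \<beta> \<gamma> (l + 1) j (W \<gamma> \<alpha> \<beta> k (l + 1) f) = h * W \<alpha> \<beta> \<gamma> (l + 2) j (W \<gamma> \<alpha> \<beta> k l f)
      + h powi (- l) * (\<theta> * W \<gamma> \<beta> \<alpha> k j f - h * (p \<alpha> * W \<gamma> \<beta> \<alpha> (k - 1) (j + 1) f))"
    using W_skein[OF d2, of j "l + 1" l k f]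
    unfolding idx cheb_numeral cheb_base W_swap[OF d(2)] W_swap[OF d(1)[symmetric]] W_swap[OF d2(1)]
    by simp
  show ?thesis
    unfolding eq by (simp add: algebra_simps cancels)
qed

text \<open>
  The two sides are the products that \<open>W_exchange\<close> and \<open>W_skein\<close> relate to one and the same third product.
\<close>

lemma W_slide:
  assumes d: "\<alpha> \<noteq> \<beta>" "\<beta> \<noteq> \<gamma>" "\<alpha> \<noteq> \<gamma>"
  shows "W \<alpha> \<beta> \<gamma> (l + 1) j (W \<gamma> \<alpha> \<beta> k l f) = W \<gamma> \<alpha> \<beta> k (l + 1) (W \<alpha> \<beta> \<gamma> l j f)
    + h powi (- l) * (W \<gamma> \<beta> \<alpha> (k - 1) (j + 1) f - W \<gamma> \<beta> \<alpha> (k + 1) (j - 1) f)"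
proof -
  have "h * W \<alpha> \<beta> \<gamma> (l + 1) j (W \<gamma> \<alpha> \<beta> k l f)
    = W \<gamma> \<alpha> \<beta> k l (W \<alpha> \<beta> \<gamma> (l + 1) j f) + h powi (- l) * (\<kappa> * W \<gamma> \<beta> \<alpha> (k - 1) (j + 1) f)"
    unfolding W_exchange[OF d] by simp
  also have "\<dots> = h * W \<gamma> \<alpha> \<beta> k (l + 1) (W \<alpha> \<beta> \<gamma> l j f)
    + h * (h powi (- l) * (W \<gamma> \<beta> \<alpha> (k - 1) (j + 1) f - W \<gamma> \<beta> \<alpha> (k + 1) (j - 1) f))"
    unfolding W_skein[OF d] by (simp add: cheb_numeral \<kappa>_def algebra_simps)
  finally show ?thesis
    by (metis distrib_left mult_left_cancel h_nonzero)
qed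

section \<open>Operators on the same pair of edges\<close>

text \<open>
  If both factors live on the same two edges, then \<open>p \<gamma>\<close> is central and the product is a combination of
  products of two operators \<open>T \<alpha>\<close> and two operators \<open>T \<beta>\<close>.
\<close>

lemma W_W_same:
  assumes d: "\<alpha> \<noteq> \<beta>" "\<beta> \<noteq> \<gamma>" "\<alpha> \<noteq> \<gamma>"
  defines "M \<equiv> \<lambda>a a' b b' f. T \<alpha> a (T \<alpha> a' (T \<beta> b (T \<beta> b' f)))"
  shows "W \<alpha> \<beta> \<gamma> m n (W \<alpha> \<beta> \<gamma> m' n' f) =
      s' * (s' * M (m-1) (m'-1) (n-1) (n'-1) f) + M (m-1) (m'+1) (n-1) (n'+1) f
    + M (m+1) (m'-1) (n+1) (n'-1) f + s * (s * M (m+1) (m'+1) (n+1) (n'+1) f)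
    - s' * (p \<gamma> * (M m (m'-1) n (n'-1) f + M (m-1) m' (n-1) n' f))
    - s * (p \<gamma> * (M m (m'+1) n (n'+1) f + M (m+1) m' (n+1) n' f))
    + p \<gamma> * (p \<gamma> * M m m' n n' f)"
proof -
  have M: "T \<alpha> a (T \<beta> b (T \<alpha> a' (T \<beta> b' f))) = M a a' b b' f" for a a' b b'
    using d by (simp add: M_def T_commute[of \<alpha> \<beta>])
  show ?thesis
    unfolding W_def using d
    by (simp add: T_add T_diff T_scal T_p_other M) (simp add: algebra_simps cancels)
qed

lemmas T_rules = T_add T_diff T_scal T_p_other

lemma W_self_exchange:
  assumes d: "\<alpha> \<noteq> \<beta>" "\<beta> \<noteq> \<gamma>" "\<alpha> \<noteq> \<gamma>"
  shows "W \<alpha> \<beta> \<gamma> m n (W \<alpha> \<beta> \<gamma> (m + 1) n f) =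
    h * W \<alpha> \<beta> \<gamma> (m + 1) n (W \<alpha> \<beta> \<gamma> m n f) - h powi (- m) * (h powi (- n) * (\<kappa> * (p \<alpha> * f)))"
proof -
  have idx: "m + 1 - 1 = m" "m + 1 + 1 = m + 2" by simp_all
  show ?thesis
    unfolding W_W_same[OF d] idx T_T_near[of _ m] T_T_near[of _ n] \<kappa>_def
    using d by (simp add: T_rules) (simp add: algebra_simps cancels)
qed

lemma W_self_exchange_right:
  assumes d: "\<alpha> \<noteq> \<beta>" "\<beta> \<noteq> \<gamma>" "\<alpha> \<noteq> \<gamma>"
  shows "W \<alpha> \<beta> \<gamma> m n (W \<alpha> \<beta> \<gamma> m (n + 1) f) =
    h * W \<alpha> \<beta> \<gamma> m (n + 1) (W \<alpha> \<beta> \<gamma> m n f) - h powi (- m) * (h powi (- n) * (\<kappa> * (p \<beta> * f)))"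
  using W_self_exchange[of \<beta> \<alpha> \<gamma> n m f] d by (simp add: W_swap[of \<beta> \<alpha>] mult.left_commute)

lemma W_self_commute:
  assumes d: "\<alpha> \<noteq> \<beta>" "\<beta> \<noteq> \<gamma>" "\<alpha> \<noteq> \<gamma>"
  shows "W \<alpha> \<beta> \<gamma> (m + 1) n (W \<alpha> \<beta> \<gamma> m (n + 1) f) = W \<alpha> \<beta> \<gamma> m (n + 1) (W \<alpha> \<beta> \<gamma> (m + 1) n f)"
proof -
  have idx: "m + 1 - 1 = m" "m + 1 + 1 = m + 2" for m :: int by simp_all
  show ?thesis
    unfolding W_W_same[OF d] idx T_T_near[of _ m] T_T_near[of _ n]
    using d by (simp add: T_rules) (simp add: algebra_simps cancels)
qed

text \<open>
  Both indices differ by one. The two curves cross twice, in the two-holed torus that is left after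
  cutting along the curve of \<open>p \<gamma>\<close>. Its boundary curves are the two mixed resolutions and give the
  multiple of \<open>p \<gamma>\<close>; of the other two resolutions, the \<open>q\<^sup>2\<close>-commutator keeps \<open>p \<alpha> * p \<beta>\<close>.
\<close>

lemma W_self_diagonal:
  assumes d: "\<alpha> \<noteq> \<beta>" "\<beta> \<noteq> \<gamma>" "\<alpha> \<noteq> \<gamma>"
  shows "W \<alpha> \<beta> \<gamma> (m + 1) (n + 1) (W \<alpha> \<beta> \<gamma> m n f) = h' * (h' * W \<alpha> \<beta> \<gamma> m n (W \<alpha> \<beta> \<gamma> (m + 1) (n + 1) f))
    + h' * (h' * (h powi (- m) * (h powi (- n) * (\<kappa> * ((h + h') * (p \<alpha> * (p \<beta> * f)) - \<theta> * (p \<gamma> * f))))))"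
proof -
  have idx: "m + 1 - 1 = m" "m + 1 + 1 = m + 2" for m :: int by simp_all
  show ?thesis
    unfolding W_W_same[OF d] idx T_T_near[of _ m] T_T_near[of _ n] \<kappa>_def \<theta>_def
    using d by (simp add: T_rules) (simp add: algebra_simps cancels)
qed

lemma W_self_resolve:
  assumes d: "\<alpha> \<noteq> \<beta>" "\<beta> \<noteq> \<gamma>" "\<alpha> \<noteq> \<gamma>"
  shows "W \<alpha> \<beta> \<gamma> m n (W \<alpha> \<beta> \<gamma> (m + 1) (n + 1) f) = h * W \<alpha> \<beta> \<gamma> m (n + 1) (W \<alpha> \<beta> \<gamma> (m + 1) n f)
    + h' * (h powi (- m) * (h powi (- n) * (h' * (p \<alpha> * (p \<beta> * f)) - \<theta> * (p \<gamma> * f))))"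
proof -
  have idx: "m + 1 - 1 = m" "m + 1 + 1 = m + 2" for m :: int by simp_all
  show ?thesis
    unfolding W_W_same[OF d] idx T_T_near[of _ m] T_T_near[of _ n] \<kappa>_def \<theta>_def
    using d by (simp add: T_rules) (simp add: algebra_simps cancels)
qed

text \<open>
  Rules for a normal form on one edge: a product of two operators becomes a multiple of some \<open>T \<alpha> k\<close>
  times \<open>T \<alpha> 0\<close>, plus a polynomial in \<open>p \<alpha>\<close>.
\<close>

lemma T_T_numeral:
  "T \<alpha> m (T \<alpha> 1 f) = h * T \<alpha> (m + 1) (T \<alpha> 0 f) + cheb \<alpha> m * f"
  "T \<alpha> m (T \<alpha> 2 f) = h * (h * T \<alpha> (m + 2) (T \<alpha> 0 f)) + h * (cheb \<alpha> (m + 1) * f) + h' * (cheb \<alpha> (m - 1) * f)"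
  "T \<alpha> m (T \<alpha> (-1) f) = h' * T \<alpha> (m - 1) (T \<alpha> 0 f) - cheb \<alpha> m * f"
  "T \<alpha> m (T \<alpha> (-2) f) = h' * (h' * T \<alpha> (m - 2) (T \<alpha> 0 f)) - h' * (cheb \<alpha> (m - 1) * f) - h * (cheb \<alpha> (m + 1) * f)"
proof -
  show 1: "T \<alpha> m (T \<alpha> 1 f) = h * T \<alpha> (m + 1) (T \<alpha> 0 f) + cheb \<alpha> m * f" for m
    using T_T[of \<alpha> m 0 f] by simp
  show "T \<alpha> m (T \<alpha> 2 f) = h * (h * T \<alpha> (m + 2) (T \<alpha> 0 f)) + h * (cheb \<alpha> (m + 1) * f) + h' * (cheb \<alpha> (m - 1) * f)"
    using T_T[of \<alpha> m 1 f] 1[of "m + 1"] by (simp add: power_int_minus inverse_h algebra_simps)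
  have 2: "T \<alpha> (m - 1) (T \<alpha> 0 f) = h * T \<alpha> m (T \<alpha> (-1) f) + h * (cheb \<alpha> m * f)" for m
    using T_T[of \<alpha> "m - 1" "-1" f] by simp
  show 3: "T \<alpha> m (T \<alpha> (-1) f) = h' * T \<alpha> (m - 1) (T \<alpha> 0 f) - cheb \<alpha> m * f" for m
    unfolding 2[of m] by (simp add: distrib_left cancels)
  have 4: "T \<alpha> (m - 1) (T \<alpha> (-1) f) = h * T \<alpha> m (T \<alpha> (-2) f) + h * (h * (cheb \<alpha> (m + 1) * f))"
    using T_T[of \<alpha> "m - 1" "-2" f] by (simp add: power2_eq_square mult.assoc add.commute)
  have "T \<alpha> m (T \<alpha> (-2) f) = h' * (T \<alpha> (m - 1) (T \<alpha> (-1) f) - h * (h * (cheb \<alpha> (m + 1) * f)))"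
    unfolding 4 by (simp add: cancels)
  then show "T \<alpha> m (T \<alpha> (-2) f) = h' * (h' * T \<alpha> (m - 2) (T \<alpha> 0 f)) - h' * (cheb \<alpha> (m - 1) * f) - h * (cheb \<alpha> (m + 1) * f)"
    unfolding 3 by (simp add: right_diff_distrib cancels)
qed

lemmas normal_form_rules = T_rules T_T_numeral cheb_numeral

text \<open>
  The \<open>q\<close>-Casimir element of the algebra generated by \<open>p \<alpha>\<close> and \<open>W \<alpha> \<beta> \<gamma> 0 0\<close>. Two loops that cross
  once fill a one-holed torus, and up to a scalar factor and an additive constant this element is
  the operator of the boundary curve of that torus.
\<close>

definition boundary :: "'e \<Rightarrow> 'e \<Rightarrow> 'e \<Rightarrow> 'k \<Rightarrow> 'k" where
  "boundary \<alpha> \<beta> \<gamma> f = h * (p \<alpha> * W \<alpha> \<beta> \<gamma> 0 0 (W \<alpha> \<beta> \<gamma> 1 0 f)) - h * (h * W \<alpha> \<beta> \<gamma> 0 0 (W \<alpha> \<beta> \<gamma> 0 0 f))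
     - h * W \<alpha> \<beta> \<gamma> 1 0 (W \<alpha> \<beta> \<gamma> 1 0 f) - p \<alpha> * (p \<alpha> * f)"

text \<open>
  The generators \<open>O\<^sub>1, O\<^sub>2\<close> and \<open>O\<^sub>4, O\<^sub>5\<close> fill the two complementary one-holed tori of the surface of genus
  two, which have the same boundary curve. In the calculation, both sides turn out to contain shifts
  of \<open>\<beta>\<close> only.
\<close>

lemma boundary_sym:
  assumes d: "\<alpha> \<noteq> \<beta>" "\<beta> \<noteq> \<gamma>" "\<alpha> \<noteq> \<gamma>"
  shows "boundary \<alpha> \<beta> \<gamma> f = boundary \<gamma> \<beta> \<alpha> f"
proof -
  have d': "\<gamma> \<noteq> \<beta>" "\<beta> \<noteq> \<alpha>" "\<gamma> \<noteq> \<alpha>" using d by auto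
  show ?thesis
    unfolding boundary_def p_W_left[OF d(1)] p_W_left[OF d'(1)]
    unfolding W_W_same[OF d] W_W_same[OF d']
    using d d' by (simp add: normal_form_rules) (simp add: algebra_simps cancels)
qed

text \<open>
  The same invariant computed from the opposite twist \<open>W \<alpha> \<beta> \<gamma> (-1) 0\<close> in place of \<open>W \<alpha> \<beta> \<gamma> 1 0\<close>.
\<close>

lemma boundary_alt:
  assumes d: "\<alpha> \<noteq> \<beta>" "\<beta> \<noteq> \<gamma>" "\<alpha> \<noteq> \<gamma>"
  shows "boundary \<alpha> \<beta> \<gamma> f = W \<alpha> \<beta> \<gamma> 0 0 (p \<alpha> * W \<alpha> \<beta> \<gamma> (-1) 0 f) - h * (h * (p \<alpha> * (p \<alpha> * f)))
     - h' * W \<alpha> \<beta> \<gamma> (-1) 0 (W \<alpha> \<beta> \<gamma> (-1) 0 f) - W \<alpha> \<beta> \<gamma> 0 0 (W \<alpha> \<beta> \<gamma> 0 0 f)"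
  unfolding boundary_def W_p_left[OF d(1)]
  unfolding p_W_left[OF d(1)]
  unfolding W_W_same[OF d]
  using d by (simp add: normal_form_rules) (simp add: algebra_simps cancels)

text \<open>
  The product of a triple operator \<open>W \<alpha> \<beta> \<gamma> 1 (-1)\<close> and its mirror image. It arises in
  \<open>triple_product\<close>, and it is the source of the constant term of the \<open>q\<close>-Casimir relation.
\<close>

lemma W_antidiagonal:
  assumes d: "\<alpha> \<noteq> \<beta>" "\<beta> \<noteq> \<gamma>" "\<alpha> \<noteq> \<gamma>"
  shows "W \<alpha> \<beta> \<gamma> 1 (-1) (W \<alpha> \<beta> \<gamma> (-1) 1 f) = h' * (h' * boundary \<beta> \<alpha> \<gamma> f) + boundary \<alpha> \<beta> \<gamma> f
    + p \<gamma> * (p \<gamma> * f) + W \<alpha> \<beta> \<gamma> 0 0 (W \<alpha> \<beta> \<gamma> 0 0 f) + (\<theta> * \<theta> + \<kappa> * \<kappa>) * f"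
proof -
  have b: "boundary \<beta> \<alpha> \<gamma> f = h * (p \<beta> * W \<alpha> \<beta> \<gamma> 0 0 (W \<alpha> \<beta> \<gamma> 0 1 f)) - h * (h * W \<alpha> \<beta> \<gamma> 0 0 (W \<alpha> \<beta> \<gamma> 0 0 f))
     - h * W \<alpha> \<beta> \<gamma> 0 1 (W \<alpha> \<beta> \<gamma> 0 1 f) - p \<beta> * (p \<beta> * f)"
    using d by (simp add: boundary_def W_swap[of \<beta> \<alpha>])
  show ?thesis
    unfolding boundary_def[of \<alpha>] b p_W_left[OF d(1)] p_W_right[OF d(1)]
    unfolding W_W_same[OF d] \<theta>_def \<kappa>_def
    using d by (simp add: normal_form_rules) (simp add: algebra_simps cancels)
qed

end

section \<open>The fifteen loop operators\<close>

text \<open>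
  \<open>u\<close> plays the role of \<open>q\<^sup>1\<^sup>/\<^sup>4\<close>. The existence of \<open>\<kappa>'\<close> means that \<open>q\<^sup>1\<^sup>/\<^sup>2 - q\<^sup>-\<^sup>1\<^sup>/\<^sup>2\<close> is invertible, as needed for
  the brackets.
\<close>

locale loop_operators = dilation_system sh x h h' s s'
  for sh :: "'e \<Rightarrow> int \<Rightarrow> 'k::field \<Rightarrow> 'k" and x h h' s s' +
  fixes u u' \<kappa>' :: 'k
  assumes h_eq: "h = u * u" and uu': "u * u' = 1" and scal_u [simp]: "scal u" and \<kappa>\<kappa>': "\<kappa> * \<kappa>' = 1"
begin

lemma h'_eq: "h' = u' * u'"
  using inverse_h uu' by (simp add: h_eq) (metis inverse_unique inverse_mult_distrib)

lemma scal_u' [simp]: "scal u'"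
proof -
  have "inverse u = u'" using uu' by (rule inverse_unique)
  then show ?thesis using scal_u by (auto simp: scal_def sh_inverse)
qed

lemma u_cancel: "u * (u' * c) = c" "u' * (u * c) = c" "u' * u = 1"
  using uu' by (metis mult.assoc mult.commute mult_1)+

lemmas u_cancels = u_cancel uu' cancels

definition qbracket :: "int \<Rightarrow> ('k \<Rightarrow> 'k) \<Rightarrow> ('k \<Rightarrow> 'k) \<Rightarrow> 'k \<Rightarrow> 'k" where
  "qbracket j F G f = \<kappa>' * (u powi j * F (G f) - u powi (- j) * G (F f))"

lemma qbracketI:
  "F (G f) - G (F f) = \<kappa> * r \<Longrightarrow> qbracket 0 F G f = r"
  "u * F (G f) - u' * G (F f) = \<kappa> * r \<Longrightarrow> qbracket 1 F G f = r"
  "h * F (G f) - h' * G (F f) = \<kappa> * r \<Longrightarrow> qbracket 2 F G f = r"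
proof -
  have "\<kappa>' * (\<kappa> * r) = r"
    using \<kappa>\<kappa>' by (metis mult.assoc mult.commute mult_1)
  moreover have "inverse u = u'" using uu' by (rule inverse_unique)
  ultimately show
    "F (G f) - G (F f) = \<kappa> * r \<Longrightarrow> qbracket 0 F G f = r"
    "u * F (G f) - u' * G (F f) = \<kappa> * r \<Longrightarrow> qbracket 1 F G f = r"
    "h * F (G f) - h' * G (F f) = \<kappa> * r \<Longrightarrow> qbracket 2 F G f = r"
    by (simp_all add: qbracket_def power_int_minus h_eq h'_eq power2_eq_square)
qed

text \<open>
  The generators are arranged in a hexagon. For odd \<open>i\<close> let \<open>\<alpha>\<close> and \<open>\<beta>\<close> be the edges for which \<open>O\<^sub>i\<^sub>+\<^sub>1\<close> is
  \<open>mul \<alpha>\<close> and \<open>O\<^sub>i\<^sub>-\<^sub>1\<close> is \<open>mul \<beta>\<close>, and \<open>\<gamma>\<close> the third edge. Then \<open>loop \<alpha> \<beta> \<gamma>\<close> is \<open>O\<^sub>i\<close>, \<open>loop_right \<alpha> \<beta> \<gamma>\<close> is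
  \<open>O\<^sub>i\<^sub>,\<^sub>i\<^sub>+\<^sub>1\<close>, \<open>loop_left \<alpha> \<beta> \<gamma>\<close> is \<open>O\<^sub>i\<^sub>-\<^sub>1\<^sub>,\<^sub>i\<close> and \<open>loop_both \<alpha> \<beta> \<gamma>\<close> is \<open>O\<^sub>i\<^sub>-\<^sub>1\<^sub>,\<^sub>i\<^sub>,\<^sub>i\<^sub>+\<^sub>1\<close>. Passing from \<open>i\<close> to \<open>i + 2\<close>
  replaces \<open>(\<alpha>, \<beta>, \<gamma>)\<close> by \<open>(\<gamma>, \<alpha>, \<beta>)\<close>, which reduces every relation to one odd and one even index.
\<close>

definition mul :: "'e \<Rightarrow> 'k \<Rightarrow> 'k" where "mul \<alpha> f = p \<alpha> * f"
definition loop :: "'e \<Rightarrow> 'e \<Rightarrow> 'e \<Rightarrow> 'k \<Rightarrow> 'k" where "loop \<alpha> \<beta> \<gamma> f = W \<alpha> \<beta> \<gamma> 0 0 f"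
definition loop_right :: "'e \<Rightarrow> 'e \<Rightarrow> 'e \<Rightarrow> 'k \<Rightarrow> 'k" where "loop_right \<alpha> \<beta> \<gamma> f = u * W \<alpha> \<beta> \<gamma> 1 0 f"
definition loop_left :: "'e \<Rightarrow> 'e \<Rightarrow> 'e \<Rightarrow> 'k \<Rightarrow> 'k" where "loop_left \<alpha> \<beta> \<gamma> f = u' * W \<alpha> \<beta> \<gamma> 0 (-1) f"
definition loop_both :: "'e \<Rightarrow> 'e \<Rightarrow> 'e \<Rightarrow> 'k \<Rightarrow> 'k" where "loop_both \<alpha> \<beta> \<gamma> f = W \<alpha> \<beta> \<gamma> 1 (-1) f"

lemmas op_defs = mul_def loop_def loop_right_def loop_left_def loop_both_def

text \<open>
  The lemmas of this context are the relations for an odd index \<open>i\<close> as above (suffix \<open>odd\<close>) and for the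
  index \<open>i - 1\<close> (suffix \<open>even\<close>); their names are those of the relations. With \<open>mul\<close> as one entry they
  are the index shifts \<open>W_p_left\<close> to \<open>W_p_other\<close>. Otherwise the two entries share one edge, where the
  indices differ by at most two and \<open>W_commute\<close>, \<open>W_exchange\<close> or the skein relation applies, or they
  live on the same edges.
\<close>

context
  fixes \<alpha> \<beta> \<gamma> :: 'e
  assumes d: "\<alpha> \<noteq> \<beta>" "\<beta> \<noteq> \<gamma>" "\<alpha> \<noteq> \<gamma>"
begin

lemma distinct_sym: "\<beta> \<noteq> \<alpha>" "\<gamma> \<noteq> \<beta>" "\<gamma> \<noteq> \<alpha>"
  using d by auto

lemmas rotate = distinct_sym(3) d(1) distinct_sym(2)
lemmas rotate_twice = d(2) distinct_sym(3) distinct_sym(1)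

lemmas [simp] = inverse_h inverse_h'
lemmas W_scal = W_linear(4)[OF scal_u] W_linear(4)[OF scal_u']
lemmas swap = W_swap[OF distinct_sym(1)] W_swap[OF distinct_sym(2)] W_swap[OF d(3)]
lemmas pW = W_p_left[OF d(1)] p_W_left[OF d(1)] W_p_right[OF d(1)] p_W_right[OF d(1)]
  W_p_other[OF distinct_sym(3) distinct_sym(2)] W_p_other[OF distinct_sym(2) distinct_sym(3)]
  W_p_left[OF rotate(1)] p_W_left[OF rotate(1)] W_p_right[OF rotate(1)] p_W_right[OF rotate(1)]
  W_p_other[OF d(2) distinct_sym(1)] W_p_left[OF rotate_twice(1)] p_W_left[OF rotate_twice(1)] W_p_right[OF rotate_twice(1)] p_W_right[OF rotate_twice(1)]
  W_p_other[OF d(1) d(3)]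
lemmas expand = \<kappa>_def \<theta>_def algebra_simps pW
lemmas collect = h_eq h'_eq algebra_simps u_cancels

lemma R1a_odd: "qbracket 1 (loop \<alpha> \<beta> \<gamma>) (mul \<alpha>) f =
    loop_right \<alpha> \<beta> \<gamma> f"
  by (rule qbracketI(2), unfold op_defs W_scal pW,
      (simp add: W_linear)?, (simp add: expand)?, (simp add: collect)?)

lemma R1a_even: "qbracket 1 (mul \<beta>) (loop \<alpha> \<beta> \<gamma>) f =
    loop_left \<alpha> \<beta> \<gamma> f"
  by (rule qbracketI(2), unfold op_defs W_scal pW,
      (simp add: W_linear)?, (simp add: expand)?, (simp add: collect)?)

lemma R2a_even: "qbracket 1 (loop_left \<alpha> \<beta> \<gamma>) (mul \<beta>) f =
    loop \<alpha> \<beta> \<gamma> f"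
  by (rule qbracketI(2), unfold op_defs W_scal pW,
      (simp add: W_linear)?, (simp add: expand)?, (simp add: collect)?)

lemma R2b_odd: "qbracket 1 (mul \<alpha>) (loop_right \<alpha> \<beta> \<gamma>) f =
    loop \<alpha> \<beta> \<gamma> f"
  by (rule qbracketI(2), unfold op_defs W_scal pW,
      (simp add: W_linear)?, (simp add: expand)?, (simp add: collect)?)

lemma R2c_even: "qbracket 1 (loop_left \<alpha> \<beta> \<gamma>) (mul \<alpha>) f =
    loop_both \<alpha> \<beta> \<gamma> f"
  by (rule qbracketI(2), unfold op_defs W_scal pW,
      (simp add: W_linear)?, (simp add: expand)?, (simp add: collect)?)

lemma R2d_odd: "qbracket 1 (mul \<beta>) (loop_right \<alpha> \<beta> \<gamma>) f =
    loop_both \<alpha> \<beta> \<gamma> f"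
  by (rule qbracketI(2), unfold op_defs W_scal pW,
      (simp add: W_linear)?, (simp add: expand)?, (simp add: collect)?)

lemma R3a_even: "qbracket 1 (loop_both \<alpha> \<beta> \<gamma>) (mul \<beta>) f =
    loop_right \<alpha> \<beta> \<gamma> f"
  by (rule qbracketI(2), unfold op_defs W_scal pW,
      (simp add: W_linear)?, (simp add: expand)?, (simp add: collect)?)

lemma R3b_even: "qbracket 1 (mul \<alpha>) (loop_both \<alpha> \<beta> \<gamma>) f =
    loop_left \<alpha> \<beta> \<gamma> f"
  by (rule qbracketI(2), unfold op_defs W_scal pW,
      (simp add: W_linear)?, (simp add: expand)?, (simp add: collect)?)

lemma R2c_odd: "qbracket 1 (loop_right \<alpha> \<beta> \<gamma>) (loop \<gamma> \<alpha> \<beta>) f =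
    loop_both \<beta> \<gamma> \<alpha> f"
  by (rule qbracketI(2), unfold op_defs W_scal W_exchange[OF d, of 0 0 0 f, simplified] swap,
      (simp add: W_linear)?, (simp add: expand)?, (simp add: collect)?)

lemma R2d_even: "qbracket 1 (loop \<beta> \<gamma> \<alpha>) (loop_left \<alpha> \<beta> \<gamma>) f =
    loop_both \<gamma> \<alpha> \<beta> f"
  by (rule qbracketI(2), unfold op_defs W_scal W_exchange[OF rotate_twice, of 0 "-1" 0 f, simplified] swap,
      (simp add: W_linear)?, (simp add: expand)?, (simp add: collect)?)

lemma R3a_odd: "qbracket 1 (loop_both \<beta> \<gamma> \<alpha>) (loop \<alpha> \<beta> \<gamma>) f =
    loop_left \<gamma> \<alpha> \<beta> f"
  by (rule qbracketI(2), unfold op_defs W_scal W_exchange[OF rotate_twice, of 0 0 "-1" f, simplified] swap,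
      (simp add: W_linear)?, (simp add: expand)?, (simp add: collect)?)

lemma R3b_odd: "qbracket 1 (loop \<gamma> \<alpha> \<beta>) (loop_both \<beta> \<gamma> \<alpha>) f =
    loop_right \<alpha> \<beta> \<gamma> f"
  by (rule qbracketI(2), unfold op_defs W_scal W_exchange[OF rotate, of 1 "-1" 0 f, simplified] swap,
      (simp add: W_linear)?, (simp add: expand)?, (simp add: collect)?)

lemma R4b_odd: "qbracket 1 (loop_right \<alpha> \<beta> \<gamma>) (loop_right \<gamma> \<alpha> \<beta>) f =
    loop_right \<beta> \<gamma> \<alpha> f"
  by (rule qbracketI(2), unfold op_defs W_scal W_exchange[OF d, of 1 0 0 f, simplified] swap,
      (simp add: W_linear)?, (simp add: expand)?, (simp add: collect)?)

lemma R4b_even: "qbracket 1 (loop_left \<alpha> \<beta> \<gamma>) (loop_left \<gamma> \<alpha> \<beta>) f =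
    loop_left \<beta> \<gamma> \<alpha> f"
  by (rule qbracketI(2), unfold op_defs W_scal W_exchange[OF d, of 0 "-1" "-1" f, simplified] swap,
      (simp add: W_linear)?, (simp add: expand)?, (simp add: collect)?)

lemma R5a_odd: "qbracket 1 (loop_both \<beta> \<gamma> \<alpha>) (loop_right \<alpha> \<beta> \<gamma>) f =
    loop \<gamma> \<alpha> \<beta> f"
  by (rule qbracketI(2), unfold op_defs W_scal W_exchange[OF rotate_twice, of 1 0 "-1" f, simplified] swap,
      (simp add: W_linear)?, (simp add: expand)?, (simp add: collect)?)

lemma R5b_odd: "qbracket 1 (loop_left \<gamma> \<alpha> \<beta>) (loop_both \<beta> \<gamma> \<alpha>) f =
    loop \<alpha> \<beta> \<gamma> f"
  by (rule qbracketI(2), unfold op_defs W_scal W_exchange[OF rotate, of 1 "-1" "-1" f, simplified] swap,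
      (simp add: W_linear)?, (simp add: expand)?, (simp add: collect)?)

lemma R1b_13: "loop \<alpha> \<beta> \<gamma> (loop \<gamma> \<alpha> \<beta> f) =
    loop \<gamma> \<alpha> \<beta> (loop \<alpha> \<beta> \<gamma> f)"
  by (unfold op_defs W_scal W_commute[OF d, of 0 0 0 f],
      (simp add: W_linear)?, (simp add: expand)?, (simp add: collect)?)

lemma R1b_15: "loop \<alpha> \<beta> \<gamma> (loop \<beta> \<gamma> \<alpha> f) =
    loop \<beta> \<gamma> \<alpha> (loop \<alpha> \<beta> \<gamma> f)"
  by (unfold op_defs W_scal W_commute[OF rotate_twice, of 0 0 0 f],
      (simp add: W_linear)?, (simp add: expand)?, (simp add: collect)?)

lemma R2f_odd: "loop_right \<alpha> \<beta> \<gamma> (loop \<beta> \<gamma> \<alpha> f) =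
    loop \<beta> \<gamma> \<alpha> (loop_right \<alpha> \<beta> \<gamma> f)"
  by (unfold op_defs W_scal W_commute[OF rotate_twice, of 1 0 0 f],
      (simp add: W_linear)?, (simp add: expand)?, (simp add: collect)?)

lemma R2e_even: "loop_left \<alpha> \<beta> \<gamma> (loop \<gamma> \<alpha> \<beta> f) =
    loop \<gamma> \<alpha> \<beta> (loop_left \<alpha> \<beta> \<gamma> f)"
  by (unfold op_defs W_scal W_commute[OF d, of 0 0 "-1" f],
      (simp add: W_linear)?, (simp add: expand)?, (simp add: collect)?)

lemma R4c_odd: "loop_right \<alpha> \<beta> \<gamma> (loop_left \<beta> \<gamma> \<alpha> f) =
    loop_left \<beta> \<gamma> \<alpha> (loop_right \<alpha> \<beta> \<gamma> f)"
  by (unfold op_defs W_scal W_commute[OF rotate_twice, of 1 0 "-1" f],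
      (simp add: W_linear)?, (simp add: expand)?, (simp add: collect)?)

lemma R4c_even: "loop_left \<alpha> \<beta> \<gamma> (loop_right \<gamma> \<alpha> \<beta> f) =
    loop_right \<gamma> \<alpha> \<beta> (loop_left \<alpha> \<beta> \<gamma> f)"
  by (unfold op_defs W_scal W_commute[OF d, of 1 0 "-1" f],
      (simp add: W_linear)?, (simp add: expand)?, (simp add: collect)?)

lemma R1b_14: "loop \<alpha> \<beta> \<gamma> (mul \<gamma> f) =
    mul \<gamma> (loop \<alpha> \<beta> \<gamma> f)"
  by (unfold op_defs W_scal pW,
      (simp add: W_linear)?, (simp add: expand)?, (simp add: collect)?)

lemma R1b_63: "mul \<beta> (loop \<gamma> \<alpha> \<beta> f) =
    loop \<gamma> \<alpha> \<beta> (mul \<beta> f)"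
  by (unfold op_defs W_scal pW,
      (simp add: W_linear)?, (simp add: expand)?, (simp add: collect)?)

lemma R2e_odd: "loop_right \<alpha> \<beta> \<gamma> (mul \<gamma> f) =
    mul \<gamma> (loop_right \<alpha> \<beta> \<gamma> f)"
  by (unfold op_defs W_scal pW,
      (simp add: W_linear)?, (simp add: expand)?, (simp add: collect)?)

lemma R2f_even: "loop_left \<alpha> \<beta> \<gamma> (mul \<gamma> f) =
    mul \<gamma> (loop_left \<alpha> \<beta> \<gamma> f)"
  by (unfold op_defs W_scal pW,
      (simp add: W_linear)?, (simp add: expand)?, (simp add: collect)?)

lemma R3c_odd: "loop_both \<beta> \<gamma> \<alpha> (mul \<alpha> f) =
    mul \<alpha> (loop_both \<beta> \<gamma> \<alpha> f)"
  by (unfold op_defs W_scal pW,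
      (simp add: W_linear)?, (simp add: expand)?, (simp add: collect)?)

lemma R2a_odd: "qbracket 1 (loop_right \<alpha> \<beta> \<gamma>) (loop \<alpha> \<beta> \<gamma>) f =
    mul \<alpha> f"
  by (rule qbracketI(2), unfold op_defs W_scal W_self_exchange[OF d, of 0 0 f, simplified],
      (simp add: W_linear)?, (simp add: expand)?, (simp add: collect)?)

lemma R2b_even: "qbracket 1 (loop \<alpha> \<beta> \<gamma>) (loop_left \<alpha> \<beta> \<gamma>) f =
    mul \<beta> f"
  by (rule qbracketI(2), unfold op_defs W_scal W_self_exchange_right[OF d, of 0 "-1" f, simplified],
      (simp add: W_linear)?, (simp add: expand)?, (simp add: collect)?)

lemma R5a_even: "qbracket 1 (loop_both \<alpha> \<beta> \<gamma>) (loop_left \<alpha> \<beta> \<gamma>) f =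
    mul \<alpha> f"
  by (rule qbracketI(2), unfold op_defs W_scal W_self_exchange[OF d, of 0 "-1" f, simplified],
      (simp add: W_linear)?, (simp add: expand)?, (simp add: collect)?)

lemma R5b_even: "qbracket 1 (loop_right \<alpha> \<beta> \<gamma>) (loop_both \<alpha> \<beta> \<gamma>) f =
    mul \<beta> f"
  by (rule qbracketI(2), unfold op_defs W_scal W_self_exchange_right[OF d, of 1 "-1" f, simplified],
      (simp add: W_linear)?, (simp add: expand)?, (simp add: collect)?)

lemma R3c_even: "loop_both \<alpha> \<beta> \<gamma> (loop \<alpha> \<beta> \<gamma> f) =
    loop \<alpha> \<beta> \<gamma> (loop_both \<alpha> \<beta> \<gamma> f)"
  by (unfold op_defs W_scal W_self_commute[OF d, of 0 "-1" f, simplified],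
      (simp add: W_linear)?, (simp add: expand)?, (simp add: collect)?)

lemma R4a_even: "qbracket 2 (loop_right \<alpha> \<beta> \<gamma>) (loop_left \<alpha> \<beta> \<gamma>) f =
    (h + h') * mul \<beta> (mul \<alpha> f) - \<theta> * mul \<gamma> f"
  by (rule qbracketI(3), unfold op_defs W_scal W_self_diagonal[OF d, of 0 "-1" f, simplified],
      (simp add: W_linear)?, (simp add: expand)?, (simp add: collect)?)

lemma R4a_odd: "qbracket 2 (loop_left \<gamma> \<alpha> \<beta>) (loop_right \<alpha> \<beta> \<gamma>) f =
    (h + h') * loop \<alpha> \<beta> \<gamma> (loop \<gamma> \<alpha> \<beta> f) - \<theta> * loop \<beta> \<gamma> \<alpha> f"
  by (rule qbracketI(3), unfold op_defs W_scal
      W_skein_up[OF d, of 0 "-1" 0 f, simplified]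
      W_skein_down[OF d, of "-1" 0 0 f, simplified]
      W_commute[OF d, of 0 0 0 f]
      swap,
      (simp add: W_linear)?, (simp add: expand)?, (simp add: collect)?)

lemma R5c_odd: "qbracket 0 (loop_both \<beta> \<gamma> \<alpha>) (loop_right \<gamma> \<alpha> \<beta>) f =
    loop \<gamma> \<alpha> \<beta> (loop_right \<beta> \<gamma> \<alpha> f) - mul \<gamma> (loop_right \<alpha> \<beta> \<gamma> f)"
  by (rule qbracketI(1), unfold op_defs W_scal
      W_skein_up[OF rotate, of 1 "-1" 0 f, simplified]
      W_skein_down[OF rotate, of "-1" 0 1 f, simplified]
      W_commute[OF rotate, of 1 0 0 f]
      swap,
      (simp add: W_linear)?, (simp add: expand)?, (simp add: collect)?)

lemma R5c_even: "qbracket 0 (loop_both \<alpha> \<beta> \<gamma>) (loop_left \<gamma> \<alpha> \<beta>) f =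
    mul \<alpha> (loop_left \<beta> \<gamma> \<alpha> f) - loop \<gamma> \<alpha> \<beta> (loop_left \<alpha> \<beta> \<gamma> f)"
  by (rule qbracketI(1), unfold op_defs W_scal
      W_skein_up[OF d, of 0 "-1" "-1" f, simplified]
      W_skein_down[OF d, of "-1" "-1" 0 f, simplified]
      W_commute[OF d, of 0 0 "-1" f]
      swap,
      (simp add: W_linear)?, (simp add: expand)?, (simp add: collect)?)

lemma R6_odd: "qbracket 2 (loop_both \<beta> \<gamma> \<alpha>) (loop_both \<alpha> \<beta> \<gamma>) f =
    - (\<theta> * loop \<alpha> \<beta> \<gamma> (loop \<beta> \<gamma> \<alpha> (mul \<beta> f)))
    + \<theta> * (u' * loop \<beta> \<gamma> \<alpha> (loop_left \<alpha> \<beta> \<gamma> f))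
    + \<theta> * (u * loop \<alpha> \<beta> \<gamma> (loop_right \<beta> \<gamma> \<alpha> f))
    - \<theta> * loop_both \<gamma> \<alpha> \<beta> f + (h + h') * loop \<gamma> \<alpha> \<beta> (mul \<beta> f)"
  by (rule qbracketI(3), unfold op_defs W_scal
      W_skein_up[OF rotate_twice, of 1 "-1" "-1" f, simplified]
      W_skein_down[OF rotate_twice, of "-1" "-1" 1 f, simplified]
      W_commute[OF rotate_twice, of 1 0 "-1" f]
      pW
      W_slide[OF rotate_twice, of "-1" 0 0 f, simplified]
      swap,
      (simp add: W_linear)?, (simp add: expand)?, (simp add: collect)?)

lemma R6_even: "qbracket 2 (loop_both \<gamma> \<alpha> \<beta>) (loop_both \<beta> \<gamma> \<alpha>) f =
    - (\<theta> * mul \<alpha> (mul \<beta> (loop \<alpha> \<beta> \<gamma> f)))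
    + \<theta> * (u' * mul \<beta> (loop_right \<alpha> \<beta> \<gamma> f))
    + \<theta> * (u * mul \<alpha> (loop_left \<alpha> \<beta> \<gamma> f))
    - \<theta> * loop_both \<alpha> \<beta> \<gamma> f + (h + h') * mul \<gamma> (loop \<alpha> \<beta> \<gamma> f)"
  by (rule qbracketI(3), unfold op_defs W_scal
      W_skein_up[OF rotate, of 1 "-1" "-1" f, simplified]
      W_skein_down[OF rotate, of "-1" "-1" 1 f, simplified]
      W_commute[OF rotate, of 1 0 "-1" f]
      swap,
      (simp add: W_linear)?, (simp add: expand)?, (simp add: collect)?)

end

section \<open>The Casimir relation\<close>

text \<open>
  With \<open>i = 1\<close> the left-hand side is \<open>O\<^sub>1\<^sub>2\<^sub>3 O\<^sub>2\<^sub>3\<^sub>4 O\<^sub>3\<^sub>4\<^sub>5\<close>. Moving an index along the edge \<open>\<alpha>\<close>, which the last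
  two factors share, turns it into \<open>O\<^sub>1\<^sub>2\<^sub>3 O\<^sub>6\<^sub>1 O\<^sub>3\<^sub>4\<close> plus corrections, among them a multiple of the product
  of \<open>O\<^sub>1\<^sub>2\<^sub>3\<close> and its mirror image. Moving an index along \<open>\<beta>\<close> and then along \<open>\<gamma>\<close>
  continues with \<open>O\<^sub>1 O\<^sub>4\<^sub>5 O\<^sub>3\<^sub>4\<close> and ends with \<open>O\<^sub>1 O\<^sub>5 O\<^sub>3\<close>. All corrections are, up to
  multiplication operators, products of operators on one and the same pair of edges.
\<close>

lemma triple_product:
  assumes d: "\<alpha> \<noteq> \<beta>" "\<beta> \<noteq> \<gamma>" "\<alpha> \<noteq> \<gamma>"
  shows "loop_both \<beta> \<gamma> \<alpha> (loop_both \<gamma> \<alpha> \<beta> (loop_both \<alpha> \<beta> \<gamma> f)) =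
      h * (loop \<alpha> \<beta> \<gamma> (loop \<beta> \<gamma> \<alpha> (loop \<gamma> \<alpha> \<beta> f)) + mul \<alpha> (mul \<beta> (mul \<gamma> f)))
    + h' * (loop \<alpha> \<beta> \<gamma> (mul \<gamma> (loop_both \<alpha> \<beta> \<gamma> f)) + mul \<alpha> (loop \<beta> \<gamma> \<alpha> (loop_both \<beta> \<gamma> \<alpha> f)))
    + h * (h * (h * loop \<gamma> \<alpha> \<beta> (mul \<beta> (loop_both \<gamma> \<alpha> \<beta> f))))
    - \<theta> * (loop \<alpha> \<beta> \<gamma> (loop \<alpha> \<beta> \<gamma> f) + h * (h * loop \<gamma> \<alpha> \<beta> (loop \<gamma> \<alpha> \<beta> f)) + loop \<beta> \<gamma> \<alpha> (loop \<beta> \<gamma> \<alpha> f)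
      + mul \<alpha> (mul \<alpha> f) + h * (h * mul \<beta> (mul \<beta> f)) + mul \<gamma> (mul \<gamma> f)
      + boundary \<gamma> \<alpha> \<beta> f + h' * (h' * boundary \<gamma> \<beta> \<alpha> f) + boundary \<beta> \<gamma> \<alpha> f
      + (\<theta> * \<theta> + \<kappa> * \<kappa>) * f)"
proof -
  have d': "\<beta> \<noteq> \<alpha>" "\<gamma> \<noteq> \<beta>" "\<gamma> \<noteq> \<alpha>" using d by auto
  note rot1 = d'(3) d(1) d'(2)
  note rot2 = d(2) d'(3) d'(1)
  note swap = W_swap[OF d'(1)] W_swap[OF d'(2)] W_swap[OF d(3)]
  have out: "W \<beta> \<gamma> \<alpha> m n (p \<alpha> * g) = p \<alpha> * W \<beta> \<gamma> \<alpha> m n g" "W \<alpha> \<beta> \<gamma> m n (p \<gamma> * g) = p \<gamma> * W \<alpha> \<beta> \<gamma> m n g"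
     "W \<gamma> \<alpha> \<beta> m n (p \<beta> * g) = p \<beta> * W \<gamma> \<alpha> \<beta> m n g" for m n g
    by (intro W_p_other; use d d' in blast)+
  \<comment> \<open>transport along \<open>\<alpha>\<close>; \<open>W \<beta> \<gamma> \<alpha> (-1) 1\<close> is the mirror image of the first factor of the triple product\<close>
  have BC: "W \<gamma> \<alpha> \<beta> 1 (-1) (W \<alpha> \<beta> \<gamma> 1 (-1) f) = h * W \<alpha> \<beta> \<gamma> 0 (-1) (W \<gamma> \<alpha> \<beta> 1 0 f)
      + (h' * (p \<alpha> * W \<beta> \<gamma> \<alpha> 0 0 f) - \<theta> * W \<beta> \<gamma> \<alpha> (-1) 1 f)"
    using W_skein_up[OF d, of 1 "-1" "-1" f] W_commute[OF d, of 1 0 "-1" f]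
    by (simp add: swap cancels)
  \<comment> \<open>transport along \<open>\<beta>\<close>\<close>
  have A61: "W \<beta> \<gamma> \<alpha> 1 (-1) (W \<alpha> \<beta> \<gamma> 0 (-1) g) = h' * W \<alpha> \<beta> \<gamma> 0 0 (W \<beta> \<gamma> \<alpha> 0 (-1) g)
      + (h * (p \<beta> * W \<gamma> \<alpha> \<beta> 0 (-1) g) - \<theta> * W \<gamma> \<alpha> \<beta> (-1) 0 g)" for g
    using W_skein_down[OF rot2, of "-1" "-1" 0 g] W_commute[OF rot2, of 0 0 "-1" g]
    by (simp add: swap cancels right_diff_distrib)
  \<comment> \<open>transport along \<open>\<gamma>\<close>\<close>
  have O45_34: "W \<beta> \<gamma> \<alpha> 0 (-1) (W \<gamma> \<alpha> \<beta> 1 0 f) = h * W \<beta> \<gamma> \<alpha> 0 0 (W \<gamma> \<alpha> \<beta> 0 0 f)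
      + (h' * (p \<gamma> * W \<alpha> \<beta> \<gamma> 1 (-1) f) - \<theta> * W \<alpha> \<beta> \<gamma> 0 0 f)"
    using W_skein_up[OF rot1, of 0 "-1" 0 f] by (simp add: swap cancels)
  have O23_34: "W \<gamma> \<alpha> \<beta> 0 (-1) (W \<gamma> \<alpha> \<beta> 1 0 f) = h * W \<gamma> \<alpha> \<beta> 0 0 (W \<gamma> \<alpha> \<beta> 1 (-1) f)
      + (h' * (p \<gamma> * (p \<alpha> * f)) - \<theta> * (p \<beta> * f))"
    using W_self_resolve[OF rot1, of 0 "-1" f] by (simp add: cancels)
  have left: "W \<gamma> \<alpha> \<beta> (-1) 0 g = p \<gamma> * W \<gamma> \<alpha> \<beta> 0 0 g - W \<gamma> \<alpha> \<beta> 1 0 g" for g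
    using p_W_left[OF rot1(1), of \<beta> 0 0 g] by simp
  have AA: "W \<beta> \<gamma> \<alpha> 1 (-1) (W \<beta> \<gamma> \<alpha> (-1) 1 f) = h' * (h' * boundary \<gamma> \<beta> \<alpha> f) + boundary \<beta> \<gamma> \<alpha> f
    + p \<alpha> * (p \<alpha> * f) + W \<beta> \<gamma> \<alpha> 0 0 (W \<beta> \<gamma> \<alpha> 0 0 f) + (\<theta> * \<theta> + \<kappa> * \<kappa>) * f"
    by (rule W_antidiagonal[OF rot2])
  have A5: "W \<beta> \<gamma> \<alpha> 1 (-1) (W \<beta> \<gamma> \<alpha> 0 0 f) = W \<beta> \<gamma> \<alpha> 0 0 (W \<beta> \<gamma> \<alpha> 1 (-1) f)"
    using W_self_commute[OF rot2, of 0 "-1" f] by simp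
  have lin: "W a b c m n (h * g) = h * W a b c m n g" "W a b c m n (h' * g) = h' * W a b c m n g"
    "W a b c m n (\<theta> * g) = \<theta> * W a b c m n g" for a b c m n g
    by (simp_all add: W_linear \<theta>_def)
  \<comment> \<open>\<open>Z\<close> and \<open>Y\<close> are the two products that only occur inside the boundary invariant\<close>
  define Z where "Z = W \<gamma> \<alpha> \<beta> 0 0 (W \<gamma> \<alpha> \<beta> 1 0 f)"
  define Y where "Y = W \<gamma> \<alpha> \<beta> 1 0 (W \<gamma> \<alpha> \<beta> 1 0 f)"
  have b: "boundary \<gamma> \<alpha> \<beta> f = h * (p \<gamma> * Z) - h * (h * W \<gamma> \<alpha> \<beta> 0 0 (W \<gamma> \<alpha> \<beta> 0 0 f)) - h * Y - p \<gamma> * (p \<gamma> * f)"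
    unfolding boundary_def Z_def Y_def ..
  show ?thesis
    unfolding mul_def loop_def loop_both_def BC W_linear(1-3) lin A61 O45_34 O23_34 out left AA A5 b Z_def[symmetric] Y_def[symmetric]
    by (simp add: algebra_simps cancels)
qed

text \<open>
  Six times the Casimir relation. The sum of \<open>triple_product\<close> over the three rotations contains each of
  the three boundary invariants with the factor \<open>2 + q\<^sup>-\<^sup>1\<close>, up to \<open>-\<theta>\<close>; by \<open>boundary_sym\<close> half of each is
  expressed by either of the two pairs of loops that define it, which produces the symmetric sum over all six cubic
  products of neighbouring generators.
\<close>

lemma q_casimir:
  assumes d: "\<alpha> \<noteq> \<beta>" "\<beta> \<noteq> \<gamma>" "\<alpha> \<noteq> \<gamma>"
  defines "O1 \<equiv> loop \<alpha> \<beta> \<gamma>" and "O2 \<equiv> mul \<alpha>" and "O3 \<equiv> loop \<gamma> \<alpha> \<beta>" and "O4 \<equiv> mul \<gamma>"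
    and "O5 \<equiv> loop \<beta> \<gamma> \<alpha>" and "O6 \<equiv> mul \<beta>"
    and "O12 \<equiv> loop_right \<alpha> \<beta> \<gamma>" and "O23 \<equiv> loop_left \<gamma> \<alpha> \<beta>" and "O34 \<equiv> loop_right \<gamma> \<alpha> \<beta>"
    and "O45 \<equiv> loop_left \<beta> \<gamma> \<alpha>" and "O56 \<equiv> loop_right \<beta> \<gamma> \<alpha>" and "O61 \<equiv> loop_left \<alpha> \<beta> \<gamma>"
    and "O123 \<equiv> loop_both \<beta> \<gamma> \<alpha>" and "O234 \<equiv> loop_both \<gamma> \<alpha> \<beta>" and "O345 \<equiv> loop_both \<alpha> \<beta> \<gamma>"
  shows "2 * (O123 (O234 (O345 f)) + O234 (O345 (O123 f)) + O345 (O123 (O234 f)))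
    - h' * (h ^ 4 + 2) * (O1 (O4 (O345 f)) + O2 (O5 (O123 f)) + O3 (O6 (O234 f))
        + O4 (O1 (O345 f)) + O5 (O2 (O123 f)) + O6 (O3 (O234 f)))
    + u' ^ 3 * (2 * h\<^sup>2 + 1) * \<theta> * (O1 (O6 (O61 f)) + O2 (O1 (O12 f)) + O3 (O2 (O23 f))
        + O4 (O3 (O34 f)) + O5 (O4 (O45 f)) + O6 (O5 (O56 f)))
    - 2 * h * (O1 (O3 (O5 f)) + O2 (O4 (O6 f)) + O3 (O5 (O1 f)) + O4 (O6 (O2 f)) + O5 (O1 (O3 f)) + O6 (O2 (O4 f)))
    - h'\<^sup>2 * (2 * h\<^sup>2 + 1) * \<theta> * (O12 (O12 f) + O23 (O23 f) + O34 (O34 f) + O45 (O45 f) + O56 (O56 f) + O61 (O61 f))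
    + h'\<^sup>2 * (h\<^sup>2 - 1) * \<theta> * (O1 (O1 f) + O2 (O2 f) + O3 (O3 f) + O4 (O4 f) + O5 (O5 f) + O6 (O6 f))
    + 6 * (\<theta> * ((\<theta> * \<theta> + \<kappa> * \<kappa>) * f)) = 0"
proof -
  have d': "\<beta> \<noteq> \<alpha>" "\<gamma> \<noteq> \<beta>" "\<gamma> \<noteq> \<alpha>" using d by auto
  note rot1 = d'(3) d(1) d'(2)
  note rot2 = d(2) d'(3) d'(1)
  define K1 K2 K3 where "K1 = boundary \<gamma> \<alpha> \<beta> f" and "K2 = boundary \<alpha> \<beta> \<gamma> f" and "K3 = boundary \<beta> \<gamma> \<alpha> f"
  have K: "boundary \<gamma> \<alpha> \<beta> f = K1" "boundary \<beta> \<alpha> \<gamma> f = K1" "boundary \<alpha> \<beta> \<gamma> f = K2" "boundary \<gamma> \<beta> \<alpha> f = K2"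
     "boundary \<beta> \<gamma> \<alpha> f = K3" "boundary \<alpha> \<gamma> \<beta> f = K3"
    using boundary_sym[OF d, of f] boundary_sym[OF rot1, of f] boundary_sym[OF rot2, of f]
    by (simp_all add: K1_def K2_def K3_def)
  have right: "mul a (loop a b c (loop_right a b c f)) = u' * (boundary a b c f + h * (h * loop a b c (loop a b c f))
      + loop_right a b c (loop_right a b c f) + mul a (mul a f))" for a b c
    by (simp add: op_defs boundary_def W_linear algebra_simps u_cancels) (simp add: h_eq algebra_simps u_cancels)
  have left: "loop a b c (mul b (loop_left a b c f)) = u' * (boundary b a c f + h * (h * mul b (mul b f))
      + loop_left a b c (loop_left a b c f) + loop a b c (loop a b c f))"
    if "a \<noteq> b" "b \<noteq> c" "a \<noteq> c" for a b c
  proof -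
    have eq: "boundary b a c f = W a b c 0 0 (p b * W a b c 0 (-1) f) - h * (h * (p b * (p b * f)))
     - h' * W a b c 0 (-1) (W a b c 0 (-1) f) - W a b c 0 0 (W a b c 0 0 f)"
      using boundary_alt[of b a c f] W_swap[of b a] that by auto
    have mul_u': "p b * (u' * x) = u' * (p b * x)" for x
      by (simp add: mult.left_commute)
    show ?thesis
      unfolding eq by (simp add: op_defs W_linear mul_u') (simp add: h'_eq algebra_simps)
  qed
  \<comment> \<open>each boundary invariant appears twice here, once through the twist to the right and once through the twist to the left\<close>
  have doubles: "O2 (O1 (O12 f)) = u' * (K2 + h * (h * O1 (O1 f)) + O12 (O12 f) + O2 (O2 f))"
    "O4 (O3 (O34 f)) = u' * (K1 + h * (h * O3 (O3 f)) + O34 (O34 f) + O4 (O4 f))"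
    "O6 (O5 (O56 f)) = u' * (K3 + h * (h * O5 (O5 f)) + O56 (O56 f) + O6 (O6 f))"
    "O1 (O6 (O61 f)) = u' * (K1 + h * (h * O6 (O6 f)) + O61 (O61 f) + O1 (O1 f))"
    "O3 (O2 (O23 f)) = u' * (K3 + h * (h * O2 (O2 f)) + O23 (O23 f) + O3 (O3 f))"
    "O5 (O4 (O45 f)) = u' * (K2 + h * (h * O4 (O4 f)) + O45 (O45 f) + O5 (O5 f))"
    using right[of \<alpha> \<beta> \<gamma>] right[of \<gamma> \<alpha> \<beta>] right[of \<beta> \<gamma> \<alpha>] left[OF d] left[OF rot1] left[OF rot2]
    unfolding K O1_def O2_def O3_def O4_def O5_def O6_def O12_def O23_def O34_def O45_def O56_def O61_def by simp_all
  have opp: "O4 (O1 g) = O1 (O4 g)" "O5 (O2 g) = O2 (O5 g)" "O6 (O3 g) = O3 (O6 g)" for g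
    unfolding O1_def O2_def O3_def O4_def O5_def O6_def op_defs
    using W_p_other[OF d'(3) d'(2)] W_p_other[OF d(1) d(3)] W_p_other[OF d(2) d'(1)] by simp_all
  have odd: "O3 (O1 g) = O1 (O3 g)" "O5 (O1 g) = O1 (O5 g)" "O5 (O3 g) = O3 (O5 g)" for g
    unfolding O1_def O3_def O5_def loop_def
    using W_commute[OF d, of 0 0 0 g] W_commute[OF rot2, of 0 0 0 g] W_commute[OF rot1, of 0 0 0 g] by simp_all
  have even: "O4 (O2 g) = O2 (O4 g)" "O6 (O2 g) = O2 (O6 g)" "O6 (O4 g) = O4 (O6 g)" for g
    unfolding O2_def O4_def O6_def mul_def by (simp_all add: mult.left_commute)
  note triples = triple_product[OF d, of f] triple_product[OF rot1, of f] triple_product[OF rot2, of f]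
  note triples' = triples[unfolded K, folded O1_def O2_def O3_def O4_def O5_def O6_def O123_def O234_def O345_def, unfolded opp odd even]
  have sq: "u' * (u' * x) = h' * x" "u' * u' = h'" for x
    by (simp_all add: h'_eq mult.assoc)
  show ?thesis
    unfolding triples' doubles opp odd even mult.assoc
    by (simp add: power2_eq_square eval_nat_numeral algebra_simps cancels sq)
qed

end

section \<open>Evaluation of the free algebra\<close>

lemma index_cases:
  fixes i :: 6
  obtains "i = 0" | "i = 1" | "i = 2" | "i = 3" | "i = 4" | "i = 5"
proof (cases i rule: bit0_cases)
  case (of_int z)
  then have "z \<in> {0, 1, 2, 3, 4, 5}" by auto
  with of_int that show thesis by auto
qed

text \<open>
  An even index is written as \<open>j + 5\<close> with \<open>j\<close> odd; these equations bring the indices of the relations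
  for \<open>j + 5\<close> back to the form \<open>j + k\<close> with \<open>k < 6\<close>.
\<close>

lemma index_arith:
  fixes j :: 6
  shows "j + 5 + 1 = j" "j + 5 + 2 = j + 1" "j + 5 + 3 = j + 2" "j + 5 + 4 = j + 3" "j + 5 + 5 = j + 4"
    "j - 1 = j + 5" "j + 5 - 1 = j + 4"
  by (cases j rule: index_cases; simp)+

lemma numeral_fract: "(numeral n :: 'a::idom fract) = Fract (numeral n) 1"
proof -
  have "Fract a 1 + Fract b 1 = Fract (a + b) 1" for a b :: 'a
    by simp
  then show ?thesis
    by (induction n) (simp_all only: numeral.simps One_fract_def)
qed

lemma numeral_scalar_nonzero: "(numeral n :: scalar) \<noteq> 0"
proof -
  have "(numeral n :: complex poly) \<noteq> 0"
    by (simp add: numeral_poly)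
  then have "(numeral n :: complex poly fract) \<noteq> 0"
    by (simp only: numeral_fract Fract_1_eq_iff) simp
  then have "(numeral n :: complex poly fract poly) \<noteq> 0"
    by (simp only: numeral_poly pCons_eq_0_iff) simp
  then show ?thesis
    by (simp only: numeral_fract Fract_1_eq_iff) simp
qed

text \<open>
  \<open>c\<close> embeds the ground field as the constants.
\<close>

locale operator_model = loop_operators sh x h h' s s' u u' \<kappa>'
  for sh :: "edge \<Rightarrow> int \<Rightarrow> 'k::field \<Rightarrow> 'k" and x h h' s s' u u' \<kappa>' +
  fixes c :: "scalar \<Rightarrow> 'k"
  assumes c_1: "c 1 = 1" and c_add: "c (a + b) = c a + c b" and c_mult: "c (a * b) = c a * c b"
    and scal_c [simp]: "scal (c a)" and c_qroot: "c qroot = u" and c_troot: "c (troot ^ 2) = s"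
begin

lemma c_0: "c 0 = 0"
  using c_add[of 0 0] by (metis add_0 add_cancel_right_right)

lemma c_uminus: "c (- a) = - c a"
  using c_add[of a "- a"] by (simp add: c_0 eq_neg_iff_add_eq_0 add.commute)

lemma c_diff: "c (a - b) = c a - c b"
  using c_add[of a "- b"] by (simp add: c_uminus)

lemma c_inverse: "c (inverse a) = inverse (c a)"
proof (cases "a = 0")
  case False
  then have "c a * c (inverse a) = 1"
    by (simp flip: c_mult add: c_1)
  then show ?thesis by (rule inverse_unique[symmetric])
qed (simp add: c_0)

lemma c_power: "c (a ^ n) = c a ^ n"
  by (induction n) (simp_all add: c_1 c_mult)

lemma c_numeral: "c (numeral n) = numeral n"
  by (induction n) (simp_all only: numeral.simps c_1 c_add)

text \<open>
  The images of the \<open>O\<^sub>i\<close> are prescribed, and those of the other generators are forced by the relations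
  that express them as brackets.
\<close>

definition gen_op :: "gen \<Rightarrow> 'k \<Rightarrow> 'k" where
  "gen_op g = (case g of
      Single i \<Rightarrow> if i = 1 then loop E12 E13 E23 else if i = 2 then mul E12
        else if i = 3 then loop E23 E12 E13 else if i = 4 then mul E23
        else if i = 5 then loop E13 E23 E12 else mul E13
    | Double i \<Rightarrow> if i = 1 then loop_right E12 E13 E23 else if i = 2 then loop_left E23 E12 E13
        else if i = 3 then loop_right E23 E12 E13 else if i = 4 then loop_left E13 E23 E12
        else if i = 5 then loop_right E13 E23 E12 else loop_left E12 E13 E23
    | G123 \<Rightarrow> loop_both E13 E23 E12 | G234 \<Rightarrow> loop_both E23 E12 E13 | G345 \<Rightarrow> loop_both E12 E13 E23)"

definition linear_op :: "('k \<Rightarrow> 'k) \<Rightarrow> bool" where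
  "linear_op F \<longleftrightarrow> (\<forall>f g. F (f + g) = F f + F g) \<and> (\<forall>a f. F (c a * f) = c a * F f)"

lemma linear_ops: "linear_op (mul a)" "linear_op (loop a b d)" "linear_op (loop_right a b d)"
  "linear_op (loop_left a b d)" "linear_op (loop_both a b d)"
  by (simp_all add: linear_op_def op_defs W_linear distrib_left mult.left_commute)

lemma linear_gen_op: "linear_op (gen_op g)"
  unfolding gen_op_def by (simp add: linear_ops split: gen.split)

fun word_op :: "gen word \<Rightarrow> 'k \<Rightarrow> 'k" where
  "word_op (Word gs) f = foldr gen_op gs f"

lemma word_op_plus: "word_op (v + w) f = word_op v (word_op w f)"
  by (cases v; cases w) simp

lemma word_op_0: "word_op 0 f = f"
  by (simp add: zero_word_def)

lemma linear_word_op: "linear_op (word_op w)"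
proof -
  have "linear_op (\<lambda>f. foldr gen_op gs f)" for gs
    using linear_gen_op by (induction gs) (simp_all add: linear_op_def)
  then show ?thesis by (cases w) (simp add: linear_op_def)
qed

text \<open>
  The extension of \<open>gen_op\<close> to an algebra homomorphism from the free algebra to the operators.
\<close>

definition ev :: "free_alg \<Rightarrow> 'k \<Rightarrow> 'k" where
  "ev A f = (\<Sum>w\<in>Poly_Mapping.keys A. c (Poly_Mapping.lookup A w) * word_op w f)"

lemma ev_superset: "finite K \<Longrightarrow> Poly_Mapping.keys A \<subseteq> K \<Longrightarrow> ev A f = (\<Sum>w\<in>K. c (Poly_Mapping.lookup A w) * word_op w f)"
  unfolding ev_def by (rule sum.mono_neutral_left) (auto simp: in_keys_iff c_0)

lemma ev_add: "ev (A + B) f = ev A f + ev B f"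
proof -
  let ?K = "Poly_Mapping.keys A \<union> Poly_Mapping.keys B"
  have "Poly_Mapping.keys (A + B) \<subseteq> ?K" by (rule keys_add)
  then show ?thesis
    using ev_superset[of ?K A f] ev_superset[of ?K B f] ev_superset[of ?K "A + B" f]
    by (simp add: lookup_add c_add distrib_right sum.distrib)
qed

lemma ev_single: "ev (Poly_Mapping.single w a) f = c a * word_op w f"
  by (simp add: ev_def c_0)

lemma ev_0: "ev 0 f = 0"
  by (simp add: ev_def)

lemma linear_ev: "linear_op (ev A)"
  using linear_word_op by (simp add: linear_op_def ev_def distrib_left sum.distrib sum_distrib_left mult.left_commute)

lemma ev_mult: "ev (A * B) f = ev A (ev B f)"
proof (induction A rule: poly_mapping_induct_single)
  case zero
  show ?case by (simp add: ev_0)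
next
  case (add_single A v a)
  have "ev (Poly_Mapping.single v a * B) f = ev (Poly_Mapping.single v a) (ev B f)"
  proof (induction B rule: poly_mapping_induct_single)
    case zero
    show ?case using linear_ev[of "Poly_Mapping.single v a"] c_0 unfolding linear_op_def
      by (metis ev_0 mult_zero_left mult_zero_right)
  next
    case (add_single B w b)
    then show ?case
      using linear_word_op[of v]
      by (simp add: linear_op_def distrib_left ev_add ev_single mult_single word_op_plus c_mult mult.assoc)
  qed
  with add_single show ?case by (simp add: distrib_right ev_add)
qed

lemma ev_uminus: "ev (- A) f = - ev A f"
  using ev_add[of A "- A" f] by (simp add: ev_0 eq_neg_iff_add_eq_0 add.commute)

lemma ev_diff: "ev (A - B) f = ev A f - ev B f"
  using ev_add[of A "- B" f] by (simp add: ev_uminus)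

lemma ev_sc: "ev (sc a) f = c a * f"
  by (simp add: sc_def ev_single word_op_0)

lemma ev_gv: "ev (gv g) f = gen_op g f"
  by (simp add: gv_def ev_single c_1)

lemma ev_square: "ev (A ^ 2) f = ev A (ev A f)"
  by (simp add: power2_eq_square ev_mult)

lemmas ev_simps = ev_add ev_diff ev_uminus ev_mult ev_square ev_sc ev_0

lemma c_qroot_powi: "c (qroot powi j) = u powi j"
  by (simp add: power_int_def c_power c_inverse c_qroot)

lemma inverse_u: "inverse u = u'"
  using uu' by (rule inverse_unique)

lemma c_roots:
  "c (qroot powi 2) = h" "c (qroot powi (-2)) = h'" "c (qroot powi (-1)) = u'" "c (qroot powi 1) = u"
  "c (qroot powi (-5)) = h' * (h' * u')" "c (qroot powi (-6)) = h' * (h' * h')"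
  "c (troot powi (-2)) = s'" "c (troot powi (-6)) = s' * (s' * s')" "c qpar = h * h" "c tpar = s * s"
proof -
  show "c (qroot powi 2) = h" "c (qroot powi (-2)) = h'" "c (qroot powi (-1)) = u'" "c (qroot powi 1) = u"
    "c (qroot powi (-5)) = h' * (h' * u')" "c (qroot powi (-6)) = h' * (h' * h')"
    unfolding c_qroot_powi by (simp_all add: h_eq h'_eq power_int_minus power_inverse inverse_u eval_nat_numeral mult.assoc)
  show t: "c (troot powi (-2)) = s'"
    by (simp add: power_int_minus c_inverse c_troot inverse_s)
  have "troot powi (-6) = troot powi (-2) * (troot powi (-2) * troot powi (-2))"
    by (simp flip: power_int_add)
  then show "c (troot powi (-6)) = s' * (s' * s')"
    by (simp only: c_mult t)
  show "c qpar = h * h"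
    unfolding qpar_def c_power c_qroot by (simp add: h_eq eval_nat_numeral mult.assoc)
  have tpar_eq: "tpar = troot ^ 2 * troot ^ 2"
    by (simp add: tpar_def flip: power_add)
  show "c tpar = s * s"
    unfolding tpar_eq c_mult c_troot ..
qed

lemma c_theta: "c theta = \<theta>"
  unfolding theta_def c_mult c_add c_roots by (simp add: \<theta>_def algebra_simps cancels)

lemma c_quantum_two: "c (qroot powi (-2) * (qpar + 1)) = h + h'"
  unfolding c_mult c_add c_roots c_1 by (simp add: algebra_simps cancels)

lemma ev_qbr: "ev (qbr j A B) f = qbracket j (ev A) (ev B) f"
proof -
  have "\<kappa>' = inverse \<kappa>"
    using \<kappa>\<kappa>' by (simp add: inverse_unique)
  then have "c (1 / (qroot powi 2 - qroot powi (-2))) = \<kappa>'"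
    by (simp only: divide_inverse c_mult c_1 c_inverse mult_1_left c_diff c_roots \<kappa>_def)
  then show ?thesis
    by (simp only: qbr_def qbracket_def ev_simps c_qroot_powi)
qed

text \<open>
  The position \<open>j\<close> of the hexagon is the one that carries \<open>loop \<alpha> \<beta> \<gamma>\<close>; this determines what all
  generators evaluate to. The last three equations hold since \<open>S3\<close> has period three.
\<close>

definition chart :: "6 \<Rightarrow> edge \<Rightarrow> edge \<Rightarrow> edge \<Rightarrow> bool" where
  "chart j \<alpha> \<beta> \<gamma> \<longleftrightarrow> \<alpha> \<noteq> \<beta> \<and> \<beta> \<noteq> \<gamma> \<and> \<alpha> \<noteq> \<gamma> \<and>
    ev (S1 j) = loop \<alpha> \<beta> \<gamma> \<and> ev (S1 (j + 1)) = mul \<alpha> \<and> ev (S1 (j + 2)) = loop \<gamma> \<alpha> \<beta> \<and>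
    ev (S1 (j + 3)) = mul \<gamma> \<and> ev (S1 (j + 4)) = loop \<beta> \<gamma> \<alpha> \<and> ev (S1 (j + 5)) = mul \<beta> \<and>
    ev (S2 j) = loop_right \<alpha> \<beta> \<gamma> \<and> ev (S2 (j + 1)) = loop_left \<gamma> \<alpha> \<beta> \<and> ev (S2 (j + 2)) = loop_right \<gamma> \<alpha> \<beta> \<and>
    ev (S2 (j + 3)) = loop_left \<beta> \<gamma> \<alpha> \<and> ev (S2 (j + 4)) = loop_right \<beta> \<gamma> \<alpha> \<and> ev (S2 (j + 5)) = loop_left \<alpha> \<beta> \<gamma> \<and>
    ev (S3 j) = loop_both \<beta> \<gamma> \<alpha> \<and> ev (S3 (j + 1)) = loop_both \<gamma> \<alpha> \<beta> \<and> ev (S3 (j + 2)) = loop_both \<alpha> \<beta> \<gamma> \<and>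
    ev (S3 (j + 3)) = loop_both \<beta> \<gamma> \<alpha> \<and> ev (S3 (j + 4)) = loop_both \<gamma> \<alpha> \<beta> \<and> ev (S3 (j + 5)) = loop_both \<alpha> \<beta> \<gamma>"

lemma charts: "chart 1 E12 E13 E23" "chart 3 E23 E12 E13" "chart 5 E13 E23 E12"
  unfolding chart_def by (simp_all add: fun_eq_iff S1_def S2_def S3_def ev_gv gen_op_def)

text \<open>
  Every index is odd or of the form \<open>j + 5\<close> with \<open>j\<close> odd, so a relation holds for all indices once it
  holds for the positions \<open>j\<close> and \<open>j + 5\<close> of an arbitrary chart.
\<close>

lemma chart_induct:
  assumes "\<And>j \<alpha> \<beta> \<gamma>. chart j \<alpha> \<beta> \<gamma> \<Longrightarrow> P j \<and> P (j + 5)"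
  shows "P i"
proof -
  have "i \<in> {1, 3, 5} \<or> i \<in> {1 + 5, 3 + 5, 5 + 5}"
    by (cases i rule: index_cases) simp_all
  then show ?thesis
    using assms[OF charts(1)] assms[OF charts(2)] assms[OF charts(3)] by blast
qed

lemmas ev_rules = ev_simps ev_qbr c_theta c_quantum_two index_arith

lemma mul_mul: "mul a (mul b f) = mul b (mul a f)"
  by (simp add: mul_def mult.left_commute)

lemma ev_R1:
  "ev (qbr 1 (S1 i) (S1 (i + 1))) f = ev (S2 i) f"
  "i - j \<notin> {0, 1, - 1} \<Longrightarrow> ev (S1 i * S1 j) f = ev (S1 j * S1 i) f"
proof -
  show "ev (qbr 1 (S1 i) (S1 (i + 1))) f = ev (S2 i) f"
    by (induct i rule: chart_induct, simp only: chart_def ev_rules,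
      simp only: simp_thms R1a_odd R1a_even)
  have step2: "ev (S1 i * S1 (i + 2)) f = ev (S1 (i + 2) * S1 i) f" for i
    by (induct i rule: chart_induct) (simp only: chart_def ev_rules, metis R1b_13 mul_mul)
  have step3: "ev (S1 i * S1 (i + 3)) f = ev (S1 (i + 3) * S1 i) f" for i
    by (induct i rule: chart_induct) (simp only: chart_def ev_rules, metis R1b_14 R1b_63)
  have step4: "ev (S1 i * S1 (i + 4)) f = ev (S1 (i + 4) * S1 i) f" for i
    by (induct i rule: chart_induct) (simp only: chart_def ev_rules, metis R1b_15 mul_mul)
  assume "i - j \<notin> {0, 1, - 1}"
  then have "j = i + 2 \<or> j = i + 3 \<or> j = i + 4"
    by (cases i rule: index_cases; cases j rule: index_cases; simp)
  then show "ev (S1 i * S1 j) f = ev (S1 j * S1 i) f"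
    using step2 step3 step4 by metis
qed

lemma ev_R2:
  "ev (qbr 1 (S2 i) (S1 i)) f = ev (S1 (i + 1)) f"
  "ev (qbr 1 (S1 (i + 1)) (S2 i)) f = ev (S1 i) f"
  "ev (qbr 1 (S2 i) (S1 (i + 2))) f = ev (S3 i) f"
  "ev (qbr 1 (S1 (i - 1)) (S2 i)) f = ev (S3 (i - 1)) f"
  "ev (S2 i * S1 (i + 3)) f = ev (S1 (i + 3) * S2 i) f"
  "ev (S2 i * S1 (i + 4)) f = ev (S1 (i + 4) * S2 i) f"
  by (induct i rule: chart_induct, simp only: chart_def ev_rules,
      simp only: simp_thms R2a_odd R2a_even R2b_odd R2b_even R2c_odd R2c_even R2d_odd
        R2d_even R2e_odd R2e_even R2f_odd R2f_even)+

lemma ev_R3: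
  "ev (qbr 1 (S3 i) (S1 i)) f = ev (S2 (i + 1)) f"
  "ev (qbr 1 (S1 (i + 2)) (S3 i)) f = ev (S2 i) f"
  "ev (S3 i * S1 (i + 1)) f = ev (S1 (i + 1) * S3 i) f"
  by (induct i rule: chart_induct, simp only: chart_def ev_rules,
      simp only: simp_thms R3a_odd R3a_even R3b_odd R3b_even R3c_odd R3c_even)+

lemma ev_R4:
  "ev (qbr 2 (S2 (i + 1)) (S2 i)) f =
    ev (sc (qroot powi (-2) * (qpar + 1)) * S1 i * S1 (i + 2) - sc theta * S1 (i + 4)) f"
  "ev (qbr 1 (S2 i) (S2 (i + 2))) f = ev (S2 (i + 4)) f"
  by (induct i rule: chart_induct, simp only: chart_def ev_rules,
      simp only: simp_thms R4a_odd R4a_even R4b_odd R4b_even)+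

lemma ev_R4_commute: "ev (S2 i * S2 (i + 3)) f = ev (S2 (i + 3) * S2 i) f"
  by (induct i rule: chart_induct) (simp only: chart_def ev_rules, metis R4c_odd R4c_even)

lemma ev_R5:
  "ev (qbr 1 (S3 i) (S2 i)) f = ev (S1 (i + 2)) f"
  "ev (qbr 1 (S2 (i + 1)) (S3 i)) f = ev (S1 i) f"
  "ev (qbr 0 (S3 i) (S2 (i + 2))) f = ev (S1 (i + 2) * S2 (i + 4) - S1 (i + 3) * S2 i) f"
  by (induct i rule: chart_induct, simp only: chart_def ev_rules,
      simp only: simp_thms R5a_odd R5a_even R5b_odd R5b_even R5c_odd R5c_even)+

lemma c_theta_qroot: "c (theta * qroot powi (-1)) = \<theta> * u'" "c (theta * qroot powi 1) = \<theta> * u"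
  by (simp_all only: c_mult c_theta c_roots)

text \<open>
  The first and the third relation arise from each other by a rotation of the hexagon. The second one
  does not: the cubic term on its right-hand side has two even indices where theirs have two odd ones.
\<close>

lemma ev_R6:
  "ev (qbr 2 (S3 1) (S3 3)) f = ev (- sc theta * S1 1 * S1 5 * S1 6 + sc (theta * qroot powi (-1)) * S1 5 * S2 6
         + sc (theta * qroot powi 1) * S1 1 * S2 5 - sc theta * S3 2
         + sc (qroot powi (-2) * (qpar + 1)) * S1 3 * S1 6) f" (is ?thesis1)
  "ev (qbr 2 (S3 2) (S3 1)) f = ev (- sc theta * S1 2 * S1 6 * S1 1 + sc (theta * qroot powi (-1)) * S1 6 * S2 1
         + sc (theta * qroot powi 1) * S1 2 * S2 6 - sc theta * S3 3
         + sc (qroot powi (-2) * (qpar + 1)) * S1 4 * S1 1) f" (is ?thesis2)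
  "ev (qbr 2 (S3 3) (S3 2)) f = ev (- sc theta * S1 3 * S1 1 * S1 2 + sc (theta * qroot powi (-1)) * S1 1 * S2 2
         + sc (theta * qroot powi 1) * S1 3 * S2 1 - sc theta * S3 1
         + sc (qroot powi (-2) * (qpar + 1)) * S1 5 * S1 2) f" (is ?thesis3)
proof -
  note ops = charts(1)[unfolded chart_def, simplified]
  note ev = ev_simps ev_qbr c_theta c_quantum_two c_theta_qroot
  show "?thesis1" "?thesis3"
    unfolding ev using ops by (simp_all add: R6_odd mult.assoc)
  show "?thesis2"
    unfolding ev using ops by (simp add: R6_even mult.assoc)
qed

lemma casimir_coefficients:
  assumes sixth: "c (1/6) = e" and third: "c (1/3) = 2 * e"
  shows
    "c (1/6 * qroot powi (-2) * (qpar^2 + 2)) = e * (h' * (h ^ 4 + 2))"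
    "c (1/6 * qroot powi (-5) * troot powi (-2) * (2 * qpar + 1) * (qpar + tpar)) = e * (u' ^ 3 * (2 * h\<^sup>2 + 1) * \<theta>)"
    "c (1/3 * qroot powi 2) = e * (2 * h)"
    "c (1/6 * qroot powi (-6) * troot powi (-2) * (2 * qpar + 1) * (qpar + tpar)) = e * (h'\<^sup>2 * (2 * h\<^sup>2 + 1) * \<theta>)"
    "c (1/6 * qroot powi (-6) * troot powi (-2) * (qpar - 1) * (qpar + tpar)) = e * (h'\<^sup>2 * (h\<^sup>2 - 1) * \<theta>)"
    "c (qroot powi (-6) * troot powi (-6) * (tpar + 1) * (qpar + tpar) * (qpar^2 + tpar)) = \<theta> * (\<theta> * \<theta> + \<kappa> * \<kappa>)"
proof -
  note c_hom = c_mult c_add c_diff c_power c_numeral c_roots c_1 third sixth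
  note expand = \<theta>_def \<kappa>_def power2_eq_square power3_eq_cube power4_eq_xxxx
  have sq: "u' * u' = h'" "u' * (u' * a) = h' * a" for a
    by (simp_all add: h'_eq mult.assoc)
  show "c (1/6 * qroot powi (-2) * (qpar^2 + 2)) = e * (h' * (h ^ 4 + 2))"
    unfolding c_hom expand by (simp add: algebra_simps)
  show "c (1/6 * qroot powi (-5) * troot powi (-2) * (2 * qpar + 1) * (qpar + tpar)) = e * (u' ^ 3 * (2 * h\<^sup>2 + 1) * \<theta>)"
    unfolding c_hom expand by (simp add: algebra_simps cancels sq)
  show "c (1/3 * qroot powi 2) = e * (2 * h)"
    unfolding c_hom by simp
  show "c (1/6 * qroot powi (-6) * troot powi (-2) * (2 * qpar + 1) * (qpar + tpar)) = e * (h'\<^sup>2 * (2 * h\<^sup>2 + 1) * \<theta>)"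
    unfolding c_hom expand by (simp add: algebra_simps cancels)
  show "c (1/6 * qroot powi (-6) * troot powi (-2) * (qpar - 1) * (qpar + tpar)) = e * (h'\<^sup>2 * (h\<^sup>2 - 1) * \<theta>)"
    unfolding c_hom expand by (simp add: algebra_simps cancels)
  show "c (qroot powi (-6) * troot powi (-6) * (tpar + 1) * (qpar + tpar) * (qpar^2 + tpar)) = \<theta> * (\<theta> * \<theta> + \<kappa> * \<kappa>)"
    unfolding c_hom expand by (simp add: algebra_simps cancels)
qed

lemma ev_casimir: "ev casimir f = 0"
proof -
  define e where "e = c (1/6)"
  have "(2 :: scalar) * (1/6) = 2 / 6"
    by (rule times_divide_eq_right[THEN trans]) (simp only: mult_1_right)
  also have "\<dots> = 1/3"
    by (subst frac_eq_eq) (simp_all add: numeral_scalar_nonzero)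
  finally have third: "c (1/3) = 2 * e"
    unfolding e_def c_numeral[symmetric] c_mult[symmetric] by (rule arg_cong[OF sym])
  have e6: "6 * e = 1"
    unfolding e_def c_numeral[symmetric] c_mult[symmetric] by (simp add: c_1 numeral_scalar_nonzero)
  note coeffs = casimir_coefficients[OF e_def[symmetric] third]
  \<comment> \<open>the constant term carries no factor \<open>1/6\<close>, so one is inserted\<close>
  have k6: "\<theta> * (\<theta> * \<theta> + \<kappa> * \<kappa>) * f = e * (6 * (\<theta> * ((\<theta> * \<theta> + \<kappa> * \<kappa>) * f)))"
  proof -
    have "e * (6 * z) = (6 * e) * z" for z
      by (simp only: mult.assoc mult.left_commute[of e 6])
    then show ?thesis
      unfolding e6 by (simp add: mult.assoc)
  qed
  have d: "E12 \<noteq> E13" "E13 \<noteq> E23" "E12 \<noteq> E23" by simp_all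
  have ev_ops: "ev (S1 1) = loop E12 E13 E23" "ev (S1 2) = mul E12" "ev (S1 3) = loop E23 E12 E13"
    "ev (S1 4) = mul E23" "ev (S1 5) = loop E13 E23 E12" "ev (S1 6) = mul E13"
    "ev (S2 1) = loop_right E12 E13 E23" "ev (S2 2) = loop_left E23 E12 E13" "ev (S2 3) = loop_right E23 E12 E13"
    "ev (S2 4) = loop_left E13 E23 E12" "ev (S2 5) = loop_right E13 E23 E12" "ev (S2 6) = loop_left E12 E13 E23"
    "ev (S3 1) = loop_both E13 E23 E12" "ev (S3 2) = loop_both E23 E12 E13" "ev (S3 3) = loop_both E12 E13 E23"
    using charts(1)[unfolded chart_def, simplified] by blast+
  have collect: "2 * e * a1 - e * b2 * a2 + e * b3 * a3 - e * b4 * a4 - e * b5 * a5 + e * b6 * a6 + e * a7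
      = e * (2 * a1 - b2 * a2 + b3 * a3 - b4 * a4 - b5 * a5 + b6 * a6 + a7)" for a1 a2 a3 a4 a5 a6 a7 b2 b3 b4 b5 b6 :: 'k
    by (simp only: distrib_left right_diff_distrib mult.assoc mult.left_commute[of e 2])
  show ?thesis
    unfolding casimir_def ev_simps coeffs third k6 ev_ops collect q_casimir[OF d, of f] by (rule mult_zero_right)
qed

lemma ev_relation:
  assumes "(A, B) \<in> defining_relations"
  shows "ev A f = ev B f"
  using assms
proof cases
  case (R1b i j)
  show ?thesis unfolding R1b(1,2) by (rule ev_R1(2)[OF R1b(3)])
qed (simp_all only: ev_R1(1) ev_R2 ev_R3 ev_R4 ev_R4_commute ev_R5 ev_R6 ev_casimir ev_0)

end

section \<open>The field of rational functions\<close>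

lemma cst_power: "cst (a ^ n) = cst a ^ n"
  by (induction n) (simp_all only: power_0 power_Suc cst_hom)

lemma cst_inverse: "cst (inverse a) = inverse (cst a)"
proof (cases "a = 0")
  case False
  then have "cst a * cst (inverse a) = 1"
    by (simp flip: cst_hom)
  then show ?thesis by (rule inverse_unique[symmetric])
qed (simp add: cst_hom)

lemma cst_powi: "cst (a powi n) = cst a powi n"
  by (simp only: power_int_def cst_power cst_inverse if_distrib[of cst])

text \<open>
  \<open>q\<close> is transcendental over the complex numbers, so it is not 1 and the brackets are defined.
\<close>

lemma qroot_power_neq_1: "qroot ^ 4 \<noteq> 1"
proof
  define F where "F = (Fract [:0, 1:] 1 :: complex poly fract)"
  have Fract_power: "Fract a 1 ^ n = Fract (a ^ n) 1" for a :: "'a::idom" and n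
    by (induction n) (simp_all add: One_fract_def)
  assume "qroot ^ 4 = 1"
  then have "[:F:] ^ 4 = 1"
    by (simp only: qroot_def F_def Fract_power Fract_1_eq_iff)
  then have "F ^ 4 = 1"
    by (metis one_pCons pCons_eq_iff poly_const_pow)
  then have "[:0, 1 :: complex:] ^ 4 = 1"
    by (simp only: F_def Fract_power Fract_1_eq_iff)
  then have "poly ([:0, 1 :: complex:] ^ 4) 0 = poly 1 0" by simp
  then show False by simp
qed

lemma dilate_dilate: "dilate \<alpha> c (dilate \<beta> d p) = dilate \<beta> d (dilate \<alpha> c p)"
  by transfer (simp add: fun_eq_iff mult.left_commute)

lemma dilate_dilate_same: "dilate \<alpha> c (dilate \<alpha> d p) = dilate \<alpha> (c * d) p"
  by transfer (simp add: fun_eq_iff power_mult_distrib mult.assoc)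

lemma dilate_one: "dilate \<alpha> 1 p = p"
  by transfer simp

lemma shift_commute: "shift \<alpha> a (shift \<beta> b f) = shift \<beta> b (shift \<alpha> a f)"
  by (cases f) (simp add: shift_Fract dilate_eq_0_iff dilate_dilate)

lemma shift_shift: "shift \<alpha> a (shift \<alpha> b f) = shift \<alpha> (a + b) f"
proof (cases f)
  case (Fract p r)
  have nz: "qroot powi k \<noteq> 0" for k
    by (simp add: power_int_eq_0_iff)
  have pw: "qroot powi (2 * a) * qroot powi (2 * b) = qroot powi (2 * (a + b))"
    by (simp only: distrib_left power_int_add qroot_nonzero not_False_eq_True disj_not1 simp_thms)
  have r: "r \<noteq> 0" "dilate \<alpha> (qroot powi (2 * b)) r \<noteq> 0"
    using Fract nz by (simp_all only: dilate_eq_0_iff not_False_eq_True)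
  show ?thesis
    unfolding Fract(1) shift_Fract[OF r(1)] shift_Fract[OF r(2)] dilate_dilate_same pw ..
qed

lemma shift_zero: "shift \<alpha> 0 f = f"
  by (cases f) (simp add: shift_Fract dilate_one)

abbreviation "xh \<equiv> cst (qroot ^ 2)"
abbreviation "xh' \<equiv> cst (qroot powi (-2))"
abbreviation "xs \<equiv> cst (troot ^ 2)"
abbreviation "xs' \<equiv> cst (troot powi (-2))"

lemma cst_mult_eq_1: "a * b = 1 \<Longrightarrow> cst a * cst b = 1"
  by (simp only: cst_hom flip: cst_hom(4))

lemma q_inverse: "qroot ^ 2 * qroot powi (-2) = 1" "troot ^ 2 * troot powi (-2) = 1" "qroot * inverse qroot = 1"
  by (simp_all add: power_int_minus)

interpretation xdil: dilation_system shift xv xh xh' xs xs'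
proof
  fix \<alpha> \<beta> a
  have "cst (qroot powi (2 * a)) = xh powi a"
    by (simp only: cst_powi cst_power power_int_mult power_int_numeral)
  then show "shift \<alpha> a (xv \<beta>) = (if \<alpha> = \<beta> then xh powi a * xv \<beta> else xv \<beta>)"
    by (simp only: shift_xv)
qed (fact shift_add shift_mult shift_0_1(2) shift_zero shift_shift shift_commute shift_cst xv_nonzero xv_diff_nonzero
    q_inverse(1,2)[THEN cst_mult_eq_1])+

lemma qroot_bracket_nonzero: "qroot ^ 2 - qroot powi (-2) \<noteq> 0"
proof
  assume "qroot ^ 2 - qroot powi (-2) = 0"
  then have "qroot ^ 2 * qroot ^ 2 = qroot ^ 2 * qroot powi (-2)"
    by (simp only: right_minus_eq)
  then show False
    using qroot_power_neq_1 unfolding q_inverse(1) power_add[symmetric] by (simp only: numeral_plus_numeral add_num_simps)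
qed

abbreviation "xk \<equiv> cst (1 / (qroot ^ 2 - qroot powi (-2)))"

lemma cst_diff: "cst (a - b) = cst a - cst b"
  by (simp only: diff_conv_add_uminus cst_hom cst_uminus)

interpretation xloop: loop_operators shift xv xh xh' xs xs' "cst qroot" "cst (inverse qroot)" xk
proof
  show "xh = cst qroot * cst qroot"
    by (simp only: power2_eq_square cst_hom)
  show "cst qroot * cst (inverse qroot) = 1"
    by (rule cst_mult_eq_1[OF q_inverse(3)])
  show "xdil.scal (cst qroot)"
    by (simp only: xdil.scal_def shift_cst simp_thms)
  have "(qroot ^ 2 - qroot powi (-2)) * (1 / (qroot ^ 2 - qroot powi (-2))) = 1"
    using divide_self[OF qroot_bracket_nonzero] by (simp only: times_divide_eq_right mult_1_right)
  then show "xdil.\<kappa> * xk = 1"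
    unfolding xdil.\<kappa>_def cst_diff[symmetric] by (rule cst_mult_eq_1)
qed

interpretation xmodel: operator_model shift xv xh xh' xs xs' "cst qroot" "cst (inverse qroot)" xk cst
proof
  show "xdil.scal (cst a)" for a
    by (simp only: xdil.scal_def shift_cst simp_thms)
qed (fact cst_hom refl)+

lemma T_eq_Tsh: "xdil.T \<alpha> n f = Tsh \<alpha> n f"
  by (simp only: xdil.T_def Tsh_def)

lemma loop_eq_D: "\<alpha> \<noteq> \<beta> \<Longrightarrow> xloop.loop \<alpha> \<beta> \<gamma> f = D \<alpha> \<beta> \<gamma> f"
  unfolding xloop.loop_def xdil.W_def T_eq_Tsh D_eq_Tsh xdil.p_def by (simp only: diff_conv_add_uminus) (simp add: power_int_numeral)

lemma mul_eq: "xloop.mul \<alpha> = (\<lambda>f. (xv \<alpha> + xv \<alpha> powi (-1)) * f)"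
  by (rule ext) (simp only: xloop.mul_def xdil.p_def power_int_minus power_int_1_right)

lemma ev_S1: "xmodel.ev (S1 i) = Ohat i"
proof -
  have loop: "xloop.loop E12 E13 E23 = D E12 E13 E23" "xloop.loop E13 E23 E12 = D E13 E23 E12"
    by (rule ext, rule loop_eq_D, simp)+
  have swap: "xloop.loop E23 E12 E13 = D E12 E23 E13"
  proof
    fix f
    have "xloop.loop E23 E12 E13 f = xloop.loop E12 E23 E13 f"
      unfolding xloop.loop_def by (rule xdil.W_swap) simp
    also have "\<dots> = D E12 E23 E13 f"
      by (rule loop_eq_D) simp
    finally show "xloop.loop E23 E12 E13 f = D E12 E23 E13 f" .
  qed
  have "xmodel.gen_op (Single i) = Ohat i"
    unfolding xmodel.gen_op_def Ohat_def gen.case loop swap mul_eq ..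
  then show ?thesis
    by (intro ext) (simp only: S1_def xmodel.ev_gv)
qed

section \<open>The homomorphism\<close>

interpretation Dalg: assoc_algebra scalar_ring diff_op_alg
  by (rule diff_op_alg_algebra)

text \<open>
  Operators act on all rational functions here, whereas the elements of \<open>diff_op_alg\<close> are their
  restrictions to \<open>Hspace\<close>.
\<close>

definition diff_op :: "(xfield \<Rightarrow> xfield) \<Rightarrow> bool" where
  "diff_op F \<longleftrightarrow> restrict F Hspace \<in> carrier diff_op_alg"

lemma diff_op_Hspace: "diff_op F \<Longrightarrow> f \<in> Hspace \<Longrightarrow> F f \<in> Hspace"
proof -
  assume F: "diff_op F" and f: "f \<in> Hspace"
  interpret E: assoc_algebra scalar_ring EndH by (rule EndH_algebra)
  have "restrict F Hspace \<in> carrier EndH"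
    using F E.generate_ring_in_carrier[OF diff_op_gens_in_EndH] by (auto simp: diff_op_def diff_op_alg_def)
  then have "restrict F Hspace \<in> Hspace \<rightarrow>\<^sub>E Hspace"
    by (simp add: EndH_def)
  then show "F f \<in> Hspace"
    using f by (metis PiE_mem restrict_apply')
qed

lemma diff_op_alg_record:
  "F \<oplus>\<^bsub>diff_op_alg\<^esub> G = (\<lambda>f\<in>Hspace. F f + G f)"
  "F \<otimes>\<^bsub>diff_op_alg\<^esub> G = compose Hspace F G"
  "a \<odot>\<^bsub>diff_op_alg\<^esub> F = (\<lambda>f\<in>Hspace. cst a * F f)"
  "\<one>\<^bsub>diff_op_alg\<^esub> = (\<lambda>f\<in>Hspace. f)"
  by (simp_all add: diff_op_alg_def EndH_def)

lemma diff_op_alg_ops: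
  "restrict F Hspace \<oplus>\<^bsub>diff_op_alg\<^esub> restrict G Hspace = (\<lambda>f\<in>Hspace. F f + G f)"
  "a \<odot>\<^bsub>diff_op_alg\<^esub> restrict F Hspace = (\<lambda>f\<in>Hspace. cst a * F f)"
  "\<one>\<^bsub>diff_op_alg\<^esub> = (\<lambda>f\<in>Hspace. f)"
  unfolding diff_op_alg_record by (rule restrict_ext, simp only: restrict_apply' refl)+

lemma diff_op_alg_mult:
  assumes "diff_op G"
  shows "restrict F Hspace \<otimes>\<^bsub>diff_op_alg\<^esub> restrict G Hspace = (\<lambda>f\<in>Hspace. F (G f))"
  unfolding diff_op_alg_record compose_def
  by (rule restrict_ext) (simp only: restrict_apply' diff_op_Hspace[OF assms])

lemma diff_op_add: "diff_op F \<Longrightarrow> diff_op G \<Longrightarrow> diff_op (\<lambda>f. F f + G f)"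
  unfolding diff_op_def diff_op_alg_ops(1)[symmetric] by (rule Dalg.a_closed)

lemma diff_op_scale: "diff_op F \<Longrightarrow> diff_op (\<lambda>f. cst a * F f)"
  unfolding diff_op_def diff_op_alg_ops(2)[symmetric] by (rule Dalg.smult_closed) (simp only: scalar_ring_simps UNIV_I)

lemma diff_op_comp:
  assumes "diff_op F" "diff_op G"
  shows "diff_op (\<lambda>f. F (G f))"
  unfolding diff_op_def diff_op_alg_mult[OF assms(2), symmetric]
  by (rule Dalg.m_closed) (use assms in \<open>simp_all only: diff_op_def\<close>)

lemma diff_op_id: "diff_op (\<lambda>f. f)"
  using Dalg.one_closed unfolding diff_op_def diff_op_alg_ops(3) .

lemma diff_op_Ohat: "diff_op (Ohat i)"
  unfolding diff_op_def OhatH_def[symmetric] diff_op_alg_def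
  by (simp add: generate_ring.incl)

lemma diff_op_qb: "diff_op F \<Longrightarrow> diff_op G \<Longrightarrow> diff_op (xloop.qbracket j F G)"
proof -
  assume F: "diff_op F" and G: "diff_op G"
  have eq: "xloop.qbracket j F G = (\<lambda>f. xk * (cst (qroot powi j) * F (G f) + cst (- (qroot powi (- j))) * G (F f)))"
    by (rule ext) (simp only: xloop.qbracket_def cst_powi cst_uminus mult_minus_left add_uminus_conv_diff)
  show ?thesis
    unfolding eq by (rule diff_op_scale[OF diff_op_add[OF diff_op_scale[OF diff_op_comp[OF F G]] diff_op_scale[OF diff_op_comp[OF G F]]]])
qed

text \<open>
  The bracket relations that define \<open>O\<^sub>i\<^sub>,\<^sub>i\<^sub>+\<^sub>1\<close> and \<open>O\<^sub>i\<^sub>,\<^sub>i\<^sub>+\<^sub>1\<^sub>,\<^sub>i\<^sub>+\<^sub>2\<close> make every generator an iterated bracket of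
  the \<open>O\<^sub>i\<close>.
\<close>

lemma diff_op_gen_op: "diff_op (xmodel.gen_op g)"
proof -
  have ev_ext: "xmodel.ev A = xmodel.ev B" if "\<And>f. xmodel.ev A f = xmodel.ev B f" for A B
    using that by (rule ext)
  have q: "xmodel.ev (qbr j A B) = xloop.qbracket j (xmodel.ev A) (xmodel.ev B)" for j A B
    by (rule ext) (rule xmodel.ev_qbr)
  have 1: "diff_op (xmodel.ev (S1 i))" for i
    unfolding ev_S1 by (rule diff_op_Ohat)
  have 2: "diff_op (xmodel.ev (S2 i))" for i
    unfolding ev_ext[OF xmodel.ev_R1(1)[of i, symmetric]] q by (rule diff_op_qb[OF 1 1])
  have 3: "diff_op (xmodel.ev (S3 i))" for i
    unfolding ev_ext[OF xmodel.ev_R2(3)[of i, symmetric]] q by (rule diff_op_qb[OF 2 1])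
  have gv: "xmodel.gen_op g = xmodel.ev (gv g)" for g
    by (rule ext) (simp only: xmodel.ev_gv)
  have "gv G123 = S3 1" "gv G234 = S3 2" "gv G345 = S3 3"
    by (simp_all add: S3_def)
  then show ?thesis
    using 1 2 3 by (cases g) (simp_all only: gv flip: S1_def S2_def)
qed

lemma diff_op_ev: "diff_op (xmodel.ev A)"
proof (induction A rule: poly_mapping_induct_single)
  case zero
  have "xmodel.ev 0 = (\<lambda>f. cst 0 * f)"
    by (rule ext) (simp only: xmodel.ev_0 cst_hom mult_zero_left)
  then show ?case
    by (simp only: diff_op_scale[OF diff_op_id])
next
  case (add_single A w a)
  have "diff_op (xmodel.word_op (Word gs))" for gs
  proof (induction gs)
    case Nil
    have "xmodel.word_op (Word []) = (\<lambda>f. f)"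
      by (rule ext) (simp only: xmodel.word_op.simps foldr.simps id_apply)
    then show ?case by (simp only: diff_op_id)
  next
    case (Cons g gs)
    have "xmodel.word_op (Word (g # gs)) = (\<lambda>f. xmodel.gen_op g (xmodel.word_op (Word gs) f))"
      by (rule ext) (simp only: xmodel.word_op.simps foldr.simps comp_apply)
    then show ?case by (simp only: diff_op_comp[OF diff_op_gen_op Cons])
  qed
  then have "diff_op (xmodel.word_op w)"
    by (cases w) (simp only:)
  moreover have "xmodel.ev (A + Poly_Mapping.single w a) = (\<lambda>f. xmodel.ev A f + cst a * xmodel.word_op w f)"
    by (rule ext) (simp only: xmodel.ev_add xmodel.ev_single)
  ultimately show ?case
    by (simp only: diff_op_add[OF add_single diff_op_scale])
qed

text \<open>
  The elements that evaluate to zero form a two-sided ideal, which contains the defining relations.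
\<close>

lemma ev_relation_ideal:
  assumes "A \<in> relation_ideal"
  shows "xmodel.ev A f = 0"
proof -
  define K where "K = {A. \<forall>f. xmodel.ev A f = 0}"
  have ev_zero: "xmodel.ev A 0 = 0" for A
    using xmodel.linear_ev[of A] unfolding xmodel.linear_op_def by (metis cst_hom(1) mult_zero_left)
  have "ideal K free_ring"
  proof (rule idealI)
    show "ring free_ring" by (rule free.ring_axioms)
    show "subgroup K (add_monoid free_ring)"
    proof (rule free.add.subgroupI)
      show "K \<subseteq> carrier free_ring" by simp
      show "K \<noteq> {}" using xmodel.ev_0 by (auto simp: K_def)
    next
      fix A assume "A \<in> K"
      moreover have "\<ominus>\<^bsub>free_ring\<^esub> A = - A"
        by (rule free.minus_equality) simp_all
      ultimately show "\<ominus>\<^bsub>free_ring\<^esub> A \<in> K"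
        by (simp add: K_def xmodel.ev_uminus)
    next
      fix A B assume "A \<in> K" "B \<in> K"
      then show "A \<oplus>\<^bsub>free_ring\<^esub> B \<in> K"
        by (simp add: K_def xmodel.ev_add)
    qed
  next
    fix A B assume "A \<in> K"
    then show "B \<otimes>\<^bsub>free_ring\<^esub> A \<in> K" "A \<otimes>\<^bsub>free_ring\<^esub> B \<in> K"
      by (simp_all add: K_def xmodel.ev_mult ev_zero)
  qed
  moreover have "{A - B | A B. (A, B) \<in> defining_relations} \<subseteq> K"
    using xmodel.ev_relation by (auto simp: K_def xmodel.ev_diff)
  ultimately have "relation_ideal \<subseteq> K"
    unfolding relation_ideal_def by (rule free.genideal_minimal)
  then show ?thesis
    using assms by (auto simp: K_def)
qed

lemma ev_residue_class:
  assumes "residue_class A = residue_class B"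
  shows "xmodel.ev A f = xmodel.ev B f"
proof -
  have "0 \<in> relation_ideal"
    using additive_subgroup.zero_closed[OF ideal.axioms(1)[OF relation_ideal_ideal]]
    by (simp only: free_ring_simps)
  then have "0 + A \<in> residue_class A"
    unfolding residue_class_def a_r_coset_def' free_ring_simps by blast
  then have "A \<in> residue_class B"
    by (simp only: assms add_0_left)
  then have "A - B \<in> relation_ideal"
    unfolding residue_class_def a_r_coset_def' free_ring_simps by auto
  then have "xmodel.ev (A - B) f = 0"
    by (rule ev_relation_ideal)
  then show ?thesis
    by (simp only: xmodel.ev_diff right_minus_eq)
qed

definition difference_operator :: "free_alg set \<Rightarrow> xfield \<Rightarrow> xfield" where
  "difference_operator F = restrict (xmodel.ev (SOME A. residue_class A = F)) Hspace"

lemma difference_operator: "difference_operator (residue_class A) = restrict (xmodel.ev A) Hspace"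
proof -
  have "residue_class (SOME B. residue_class B = residue_class A) = residue_class A"
    by (rule someI) (rule refl)
  then show ?thesis
    unfolding difference_operator_def by (intro restrict_ext) (rule ev_residue_class)
qed

theorem proposition9:
  shows "\<exists>\<Delta> \<in> algebra_hom scalar_ring Aqt diff_op_alg.
           \<forall>i :: 6. \<Delta> (residue_class (S1 i)) = OhatH i"
proof (rule bexI[of _ difference_operator])
  show "\<forall>i. difference_operator (residue_class (S1 i)) = OhatH i"
    by (simp only: difference_operator ev_S1 OhatH_def simp_thms)
  show "difference_operator \<in> algebra_hom scalar_ring Aqt diff_op_alg"
    unfolding algebra_hom_def
  proof (intro CollectI conjI ballI ring_hom_memI)
    fix F assume "F \<in> carrier Aqt"
    then show "difference_operator F \<in> carrier diff_op_alg"
      using diff_op_ev by (auto simp only: Aqt_carrier difference_operator diff_op_def)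
  next
    fix F G assume "F \<in> carrier Aqt" "G \<in> carrier Aqt"
    then obtain A B where AB: "F = residue_class A" "G = residue_class B"
      by (auto simp only: Aqt_carrier)
    show "difference_operator (F \<otimes>\<^bsub>Aqt\<^esub> G) = difference_operator F \<otimes>\<^bsub>diff_op_alg\<^esub> difference_operator G"
      unfolding AB Aqt_ops difference_operator diff_op_alg_mult[OF diff_op_ev]
      by (rule restrict_ext) (rule xmodel.ev_mult)
    show "difference_operator (F \<oplus>\<^bsub>Aqt\<^esub> G) = difference_operator F \<oplus>\<^bsub>diff_op_alg\<^esub> difference_operator G"
      unfolding AB Aqt_ops difference_operator diff_op_alg_ops
      by (rule restrict_ext) (rule xmodel.ev_add)
  next
    have "xmodel.ev 1 f = f" for f
      using xmodel.ev_sc[of 1 f] by (simp only: sc_hom cst_hom mult_1_left)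
    then show "difference_operator \<one>\<^bsub>Aqt\<^esub> = \<one>\<^bsub>diff_op_alg\<^esub>"
      unfolding Aqt_ops difference_operator diff_op_alg_ops by (intro restrict_ext)
  next
    fix a F assume "F \<in> carrier Aqt"
    then obtain A where A: "F = residue_class A"
      by (auto simp only: Aqt_carrier)
    show "difference_operator (a \<odot>\<^bsub>Aqt\<^esub> F) = a \<odot>\<^bsub>diff_op_alg\<^esub> difference_operator F"
      unfolding A Aqt_ops difference_operator diff_op_alg_ops xmodel.ev_mult xmodel.ev_sc ..
  qed
qed

end
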